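(* For any $0<r<1$ and $\kappa>0$, define $$\mathscr{F}_{r,\kappa}:=\left\{f\in C^2(\mathbb{C}):\ \Delta f(z)=0\ \text{for all } z\in\mathbb{C}\setminus\mathbb{D}_r\ \text{ and }\ \max_{\mathbb{C}}|\Delta f|\le N^\kappa\right\}.$$ For any $\eta>0$ (possibly depending on $N$, with $\eta\le \frac{N}{\log N}$), there exists a constant $C_r>0$ (the subscript indicating dependence on $r$) such that $$\mathbb{P}_N\left[\sup\left\{|\mathrm{X}(f)|:\ f\in\mathscr{F}_{r,\kappa}\ \text{and}\ \int_{\mathbb{D}}|\Delta f(z)|\frac{d^2z}{\pi}\le1\right\}\ge \eta\log N+1\right]\le C_r\,N^{5/4+\kappa-\eta}.$$
   Context: For $N\in\mathbb{N}$, $(\lambda_1,\dots,\lambda_N)$ are the eigenvalues of an $N\times N$ Ginibre matrix (independent complex Gaussian entries, mean zero, variance $1/N$), with joint law $\mathbb{P}_N$; equivalently $d\mathbb{P}_N\propto e^{-\mathrm{H}_N(x)}\prod_{j=1}^N d^2x_j$ on $\mathbb{C}^N$ with $\mathrm{H}_N(x)=\sum_{j\ne k}\log|x_j-x_k|^{-1}+N\sum_{j=1}^N|x_j|^2$, where $d^2x$ is Lebesgue measure on $\mathbb{C}$. $\mathbb{D}$ is the open unit disk, $\mathbb{D}_r=\{z\in\mathbb{C}:|z|\le r\}$, $\sigma(dx)=\frac1\pi\mathbf{1}_{\mathbb{D}}(x)\,d^2x$, and $\mathrm{X}=\sum_{j=1}^N\delta_{\lambda_j}-N\sigma$, so that $\mathrm{X}(f)=\sum_{j=1}^N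 f(\lambda_j)-N\int f\,d\sigma$. $\Delta$ is the usual Laplacian on $\mathbb{C}\cong\mathbb{R}^2$.
   Formalization: The supremum runs only over f in F_{r,κ} with f(z)=o(|z|) at infinity; without this the claim fails, since f=c·Re z has Δf=0 but |X(f)|=|c·Re Σλ_j| is unbounded in c, so the supremum is a.s. infinite. *)

theory Defs
  imports "HOL-Probability.Probability" "HOL-Library.Landau_Symbols"
begin

section \<open>The Ginibre point process\<close>

text \<open>
  A configuration \<open>x = (x\<^sub>1, \<dots>, x\<^sub>N)\<close> in \<open>\<complex>\<^sup>N\<close> is an extensional function on \<open>{..<N}\<close>.
  On the null set where two points coincide the Hamiltonian is \<open>+\<infinity>\<close>, whereas \<open>ln 0 = 0\<close>
  gives it a finite value here; this does not affect the law.
\<close>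

definition ginibre_hamiltonian :: "nat \<Rightarrow> (nat \<Rightarrow> complex) \<Rightarrow> real" where
  "ginibre_hamiltonian N x =
     (\<Sum>j<N. \<Sum>k\<in>{..<N} - {j}. ln (inverse (cmod (x j - x k))))
     + real N * (\<Sum>j<N. (cmod (x j))\<^sup>2)"

definition lebesgue_CN :: "nat \<Rightarrow> (nat \<Rightarrow> complex) measure" where
  "lebesgue_CN N = (\<Pi>\<^sub>M j\<in>{..<N}. (lborel :: complex measure))"

definition ginibre_partition :: "nat \<Rightarrow> ennreal" where
  "ginibre_partition N =
     (\<integral>\<^sup>+ x. ennreal (exp (- ginibre_hamiltonian N x)) \<partial>lebesgue_CN N)"

definition ginibre :: "nat \<Rightarrow> (nat \<Rightarrow> complex) measure" where
  "ginibre N = density (lebesgue_CN N)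
     (\<lambda>x. ennreal (exp (- ginibre_hamiltonian N x)) / ginibre_partition N)"

definition circular_law :: "complex measure" where
  "circular_law = density lborel (\<lambda>z. ennreal (indicator (ball 0 1) z / pi))"

definition lin_stat :: "nat \<Rightarrow> (nat \<Rightarrow> complex) \<Rightarrow> (complex \<Rightarrow> real) \<Rightarrow> real" where
  "lin_stat N x f = (\<Sum>j<N. f (x j)) - real N * (\<integral>z. f z \<partial>circular_law)"

section \<open>Functions of class \<open>C\<^sup>2\<close> on \<open>\<complex> \<cong> \<real>\<^sup>2\<close>\<close>

text \<open>\<open>Basis :: complex set\<close> is \<open>{1, \<i>}\<close>, so the partials below are those in the
  real and imaginary directions.\<close>

definition partial_deriv :: "complex \<Rightarrow> (complex \<Rightarrow> real) \<Rightarrow> complex \<Rightarrow> real" where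
  "partial_deriv b f z = frechet_derivative f (at z) b"

definition C2_complex :: "(complex \<Rightarrow> real) \<Rightarrow> bool" where
  "C2_complex f \<longleftrightarrow>
     f differentiable_on UNIV \<and>
     (\<forall>b\<in>Basis. partial_deriv b f differentiable_on UNIV) \<and>
     (\<forall>b\<in>Basis. \<forall>c\<in>Basis. continuous_on UNIV (partial_deriv c (partial_deriv b f)))"

definition laplacian :: "(complex \<Rightarrow> real) \<Rightarrow> complex \<Rightarrow> real" where
  "laplacian f z = (\<Sum>b\<in>Basis. partial_deriv b (partial_deriv b f) z)"

section \<open>The test functions\<close>

definition test_class :: "nat \<Rightarrow> real \<Rightarrow> real \<Rightarrow> (complex \<Rightarrow> real) set" where
  "test_class N r \<kappa> =
     {f. C2_complex f \<and> (\<forall>z\<in>- cball 0 r. laplacian f z = 0)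
         \<and> (\<forall>z. \<bar>laplacian f z\<bar> \<le> real N powr \<kappa>)}"

text \<open>
  \<open>test_class\<close> is stable under adding any entire harmonic function \<open>h\<close>. Such an \<open>h\<close> is
  invisible to all constraints on the Laplacian, while \<open>\<Sum>\<^sub>j h(x\<^sub>j) - N h(0)\<close> can be made
  arbitrarily large by scaling \<open>h\<close>. The linear statistics are therefore controlled by the
  Laplacian only for functions which are, up to a constant, the logarithmic potential of their
  Laplacian. Within \<open>test_class\<close>, these are exactly the functions with \<open>f(z) = o(|z|)\<close> at infinity;
  this includes all compactly supported ones. The exponent is optimal, since \<open>h = Re\<close> must
  be excluded.
\<close>

definition no_harmonic_part :: "(complex \<Rightarrow> real) \<Rightarrow> bool" where
  "no_harmonic_part f \<longleftrightarrow> f \<in> o[at_infinity](\<lambda>z. cmod z)"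

end

theory Submission
  imports Defs "HOL-Real_Asymp.Real_Asymp" "Jordan_Normal_Form.Determinant"
begin

text \<open>
  A function in the class is, up to a constant, the logarithmic potential of its Laplacian. Hence
  \<open>X(f) = \<integral> \<Psi>(w) \<Delta>f(w) dw / (2 \<pi>)\<close>, where \<open>\<Psi>(w) = ln |det (w - A)| - N (|w|\<^sup>2 - 1) / 2\<close> is the centred logarithm of the
  characteristic polynomial, and Jensen's inequality bounds \<open>exp |X(f)|\<close> for all \<open>f\<close> simultaneously by
  \<open>1 + (N\<^sup>\<kappa> / \<pi>) \<integral> exp (|\<Psi>(w)| / 2) dw\<close>, the integral being over the disk of radius \<open>r\<close>. By Markov's inequality it suffices
  that \<open>\<Psi>(w)\<close> has exponential moments of order 2 and -1 which grow at most linearly in \<open>N\<close>. The moment of order 2 is explicit. For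
  the moment of order -1, Lagrange interpolation of the truncated reproducing kernel at the eigenvalues writes
  \<open>1 / det (w - A)\<close> as a sum over the eigenvalues \<open>\<lambda>\<close> of residues containing \<open>1 / \<Prod> (\<lambda> - \<mu>)\<close>. One of the two factors
  \<open>\<Prod> |\<lambda> - \<mu>|\<close> of the density cancels this, and the other one is controlled by a second moment for \<open>N - 1\<close> eigenvalues.
\<close>

section \<open>Polar coordinates\<close>

text \<open>The density \<open>|\<Delta>f| / \<pi>\<close> leaves \<open>\<Psi> / 2\<close> in the
  exponent, so moments of order 1/2 and -1/2 would suffice. No closed form is at hand for these;
  \<open>exp (|a| / 2) \<le> 1 + exp (2 a) + exp (-a)\<close> moves to orders that can be treated.
  Order 2 amounts to adjoining \<open>w\<close> as one more point of a squared Vandermonde product.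
  Its mirror image, order -2, is infinite, since \<open>1 / |w - \<lambda>|^2\<close> is not
  integrable in the plane. Order -1 is finite, but is not the integral of a squared determinant.
  Interpolating the reproducing kernel loses nothing exponential: at \<open>w\<close> it is at least
  \<open>(1 - r^2) exp (N |w|^2)\<close>, and by Cauchy-Schwarz its values at the eigenvalues
  combine with the first moment of the other factors into the exact one-point density, against which
  the remaining pole \<open>1 / |w - \<lambda>|\<close> is harmless. Linear growth of both moments
  yields the exponent \<open>1 + \<kappa> - \<eta>\<close>, slightly better than required.\<close>

lemma nn_integral_lborel_shift:
  fixes g :: "'a::euclidean_space \<Rightarrow> ennreal"
  assumes [measurable]: "g \<in> borel_measurable borel"
  shows "(\<integral>\<^sup>+y. g (x + y) \<partial>lborel) = (\<integral>\<^sup>+y. g y \<partial>lborel)"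
    and "(\<integral>\<^sup>+y. g (x - y) \<partial>lborel) = (\<integral>\<^sup>+y. g y \<partial>lborel)"
proof -
  have "(\<integral>\<^sup>+y. g y \<partial>lborel) = (\<integral>\<^sup>+y. g (x + y) \<partial>lborel)"
    by (subst lborel_affine[of 1 x]) (simp_all add: nn_integral_density nn_integral_distr)
  thus "(\<integral>\<^sup>+y. g (x + y) \<partial>lborel) = (\<integral>\<^sup>+y. g y \<partial>lborel)" ..
  have "(\<integral>\<^sup>+y. g y \<partial>lborel) = (\<integral>\<^sup>+y. g (x - y) \<partial>lborel)"
    by (subst lborel_affine[of "-1" x]) (simp_all add: nn_integral_density nn_integral_distr)
  thus "(\<integral>\<^sup>+y. g (x - y) \<partial>lborel) = (\<integral>\<^sup>+y. g y \<partial>lborel)" ..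
qed

text \<open>Uniqueness of Haar measure: both \<open>M A * \<lambda> B\<close> and \<open>M B * \<lambda> A\<close> equal the double integral of
  \<open>1\<^sub>A(x) 1\<^sub>B(x + y)\<close> with respect to \<open>M \<Otimes> \<lambda>\<close>.\<close>

lemma lborel_eqI_translation:
  fixes M :: "'a::euclidean_space measure"
  assumes sets [measurable_cong, simp]: "sets M = sets borel" and "sigma_finite_measure M"
    and shift: "\<And>a. distr M borel (\<lambda>x. x + a) = M"
    and ball: "emeasure M (ball 0 1) = emeasure lborel (ball (0::'a) 1)"
  shows "M = lborel"
proof (rule measure_eqI)
  show "sets M = sets lborel" by simp
next
  fix A assume "A \<in> sets M"
  hence [measurable]: "A \<in> sets borel" by simp
  interpret M: sigma_finite_measure M by fact
  interpret pair_sigma_finite M lborel ..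
  define B :: "'a set" where "B = ball 0 1"
  have [measurable]: "B \<in> sets borel" by (simp add: B_def)
  have [simp]: "space M = UNIV" using sets_eq_imp_space_eq[OF sets] by simp
  have sh: "(\<integral>\<^sup>+x. g (x + a) \<partial>M) = (\<integral>\<^sup>+x. g x \<partial>M)" if [measurable]: "g \<in> borel_measurable borel" for g a
    by (subst (2) shift[of a, symmetric], subst nn_integral_distr) (auto cong: measurable_cong_sets)
  have "emeasure M A * emeasure lborel B = (\<integral>\<^sup>+x. indicator A x * emeasure lborel B \<partial>M)"
    by (simp add: nn_integral_multc)
  also have "\<dots> = (\<integral>\<^sup>+x. indicator A x * (\<integral>\<^sup>+y. indicator B (x + y) \<partial>lborel) \<partial>M)"
    by (subst nn_integral_lborel_shift) auto
  also have "\<dots> = (\<integral>\<^sup>+x. (\<integral>\<^sup>+y. indicator A x * indicator B (x + y) \<partial>lborel) \<partial>M)"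
    by (subst nn_integral_cmult) auto
  also have "\<dots> = (\<integral>\<^sup>+y. (\<integral>\<^sup>+x. indicator A x * indicator B (x + y) \<partial>M) \<partial>lborel)"
    by (subst Fubini') auto
  also have "\<dots> = (\<integral>\<^sup>+y. (\<integral>\<^sup>+x. indicator A (x - y) * indicator B x \<partial>M) \<partial>lborel)"
  proof (rule nn_integral_cong)
    fix y
    show "(\<integral>\<^sup>+x. indicator A x * indicator B (x + y) \<partial>M) = (\<integral>\<^sup>+x. indicator A (x - y) * indicator B x \<partial>M)"
      using sh[of "\<lambda>x. indicator A (x - y) * indicator B x" y] by simp
  qed
  also have "\<dots> = (\<integral>\<^sup>+x. (\<integral>\<^sup>+y. indicator A (x - y) * indicator B x \<partial>lborel) \<partial>M)"
    by (subst Fubini') auto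
  also have "\<dots> = (\<integral>\<^sup>+x. emeasure lborel A * indicator B x \<partial>M)"
    by (subst nn_integral_multc) (auto simp: nn_integral_lborel_shift)
  also have "\<dots> = emeasure lborel A * emeasure M B"
    by (simp add: nn_integral_cmult)
  finally have eq: "emeasure M A * emeasure lborel B = emeasure lborel A * emeasure M B" .
  have "emeasure lborel B < \<infinity>" unfolding B_def by (rule emeasure_lborel_ball_finite)
  moreover have "emeasure lborel B \<noteq> 0"
    using content_ball_gt_0_iff[of "0::'a" 1] by (auto simp: B_def measure_def)
  moreover have "emeasure lborel B * emeasure M A = emeasure lborel B * emeasure lborel A"
    using eq ball by (simp add: B_def mult.commute)
  ultimately show "emeasure M A = emeasure lborel A"
    by (auto simp: ennreal_mult_cancel_left simp del: mult_eq_0_iff)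
qed

text \<open>Multiplication by \<open>c\<close> maps centred balls to themselves and turns the
  translation by \<open>a / c\<close> into the translation by \<open>a\<close>, so the uniqueness
  result applies to the image measure. This rotation invariance replaces a Jacobian computation for
  polar coordinates.\<close>

lemma lborel_distr_unit_mult:
  fixes c :: complex
  assumes "cmod c = 1"
  shows "distr lborel borel (\<lambda>w. c * w) = (lborel :: complex measure)"
proof (rule lborel_eqI_translation)
  have c: "c \<noteq> 0" using assms by auto
  show "sets (distr lborel borel (\<lambda>w. c * w)) = sets (borel :: complex measure)" by simp
  have ball: "(\<lambda>w. c * w) -` ball 0 R = ball 0 R" for R
    using assms by (auto simp: norm_mult)
  show "emeasure (distr lborel borel ((*) c)) (ball 0 1) = emeasure lborel (ball (0::complex) 1)"
    by (subst emeasure_distr) (simp_all add: ball)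
  show "sigma_finite_measure (distr lborel borel ((*) c))"
  proof
    show "\<exists>A. countable A \<and> A \<subseteq> sets (distr lborel borel ((*) c)) \<and> \<Union> A = space (distr lborel borel ((*) c)) \<and>
       (\<forall>a\<in>A. emeasure (distr lborel borel ((*) c)) a \<noteq> \<infinity>)"
    proof (intro exI[of _ "range (\<lambda>n::nat. ball (0::complex) (real n))"] conjI ballI)
      have "\<exists>n::nat. cmod x < real n" for x by (rule reals_Archimedean2)
      thus "\<Union> (range (\<lambda>n::nat. ball (0::complex) (real n))) = space (distr lborel borel ((*) c))"
        by auto
      fix a assume "a \<in> range (\<lambda>n::nat. ball (0::complex) (real n))"
      then obtain n where a: "a = ball 0 (real n)" by auto
      show "emeasure (distr lborel borel ((*) c)) a \<noteq> \<infinity>"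
        unfolding a using emeasure_lborel_ball_finite[of "0::complex" "real n"]
        by (subst emeasure_distr) (auto simp: ball)
    qed auto
  qed
  fix a :: complex
  have "distr (distr lborel borel ((*) c)) borel (\<lambda>x. x + a) = distr lborel borel (\<lambda>w. c * w + a)"
    by (subst distr_distr) (auto simp: o_def)
  also have "\<dots> = distr (distr lborel borel ((+) (a / c))) borel ((*) c)"
  proof -
    have "c * w + a = c * (a / c + w)" for w using c by (simp add: algebra_simps)
    thus ?thesis by (subst distr_distr) (auto simp: o_def)
  qed
  also have "distr lborel borel ((+) (a / c)) = lborel" by (rule lborel_distr_plus)
  finally show "distr (distr lborel borel ((*) c)) borel (\<lambda>x. x + a) = distr lborel borel ((*) c)" .
qed

text \<open>The area \<open>pi * a^2\<close> of a disk is the distribution function of the modulus,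
  and the density is its derivative; half-lines form a generator stable under intersection.\<close>

lemma distr_lborel_cmod:
  "distr lborel borel cmod = density lborel (\<lambda>\<rho>. ennreal (2 * pi * \<rho> * indicator {0..} \<rho>))"
proof (rule measure_eqI_generator_eq[where E = "range (\<lambda>a::real. {..a})" and \<Omega> = UNIV and A = "\<lambda>n::nat. {..real n}"])
  show "Int_stable (range (\<lambda>a::real. {..a}))" by (auto simp: Int_stable_def)
  have *: "emeasure (distr lborel borel cmod) {..a} = ennreal (if 0 \<le> a then pi * a\<^sup>2 else 0)" for a
  proof -
    have "cmod -` {..a} = cball 0 a" by auto
    thus ?thesis by (subst emeasure_distr)
      (auto simp: emeasure_cball DIM_complex unit_ball_vol_2 simp flip: ennreal_mult')
  qed
  have **: "emeasure (density lborel (\<lambda>\<rho>. ennreal (2 * pi * \<rho> * indicator {0..} \<rho>))) {..a} = ennreal (if 0 \<le> a then pi * a\<^sup>2 else 0)" for a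
  proof -
    have "emeasure (density lborel (\<lambda>\<rho>. ennreal (2 * pi * \<rho> * indicator {0..} \<rho>))) {..a}
      = (\<integral>\<^sup>+\<rho>. ennreal (2 * pi * \<rho>) * indicator {0..a} \<rho> \<partial>lborel)"
      by (subst emeasure_density) (auto intro!: nn_integral_cong split: split_indicator)
    also have "\<dots> = ennreal (if 0 \<le> a then pi * a\<^sup>2 else 0)"
    proof (cases "0 \<le> a")
      case True
      have "(\<integral>\<^sup>+\<rho>. ennreal (2 * pi * \<rho>) * indicator {0..a} \<rho> \<partial>lborel) = pi * a\<^sup>2 - pi * 0\<^sup>2"
        using True by (intro nn_integral_FTC_Icc) (auto intro!: derivative_eq_intros)
      thus ?thesis using True by simp
    qed auto
    finally show ?thesis .
  qed
  show "emeasure (distr lborel borel cmod) X = emeasure (density lborel (\<lambda>\<rho>. ennreal (2 * pi * \<rho> * indicator {0..} \<rho>))) X"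
    if "X \<in> range (\<lambda>a::real. {..a})" for X using that * ** by auto
  show "(\<Union>i::nat. {..real i}) = UNIV"
    using real_arch_simple by auto
  show "emeasure (distr lborel borel cmod) {..real i} \<noteq> \<infinity>" for i using * by simp
qed (auto simp: borel_eq_atMost)

lemma nn_integral_radial:
  fixes g :: "real \<Rightarrow> ennreal"
  assumes [measurable]: "g \<in> borel_measurable borel"
  shows "(\<integral>\<^sup>+w. g (cmod w) \<partial>lborel) = (\<integral>\<^sup>+\<rho>. ennreal (2 * pi * \<rho> * indicator {0..} \<rho>) * g \<rho> \<partial>lborel)"
proof -
  have "(\<integral>\<^sup>+w. g (cmod w) \<partial>lborel) = (\<integral>\<^sup>+\<rho>. g \<rho> \<partial>distr lborel borel cmod)"
    by (subst nn_integral_distr) auto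
  thus ?thesis unfolding distr_lborel_cmod by (subst (asm) nn_integral_density) auto
qed

lemma nn_integral_periodic_shift:
  fixes g :: "real \<Rightarrow> ennreal"
  assumes [measurable]: "g \<in> borel_measurable borel" and per: "\<And>t. g (t + p) = g t" and a: "0 \<le> a" "a < p"
  shows "(\<integral>\<^sup>+t. indicator {0..<p} t * g (t + a) \<partial>lborel) = (\<integral>\<^sup>+t. indicator {0..<p} t * g t \<partial>lborel)"
proof -
  have "(\<integral>\<^sup>+t. indicator {0..<p} t * g (t + a) \<partial>lborel) = (\<integral>\<^sup>+t. indicator {a..<p+a} (a + t) * g (a + t) \<partial>lborel)"
    by (intro nn_integral_cong) (auto simp: add.commute split: split_indicator)
  also have "\<dots> = (\<integral>\<^sup>+t. indicator {a..<p+a} t * g t \<partial>lborel)"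
    by (rule nn_integral_lborel_shift(1)[of "\<lambda>t. indicator {a..<p+a} t * g t"]) auto
  also have "\<dots> = (\<integral>\<^sup>+t. indicator {a..<p} t * g t + indicator {p..<p+a} t * g t \<partial>lborel)"
    using a by (intro nn_integral_cong) (auto split: split_indicator)
  also have "\<dots> = (\<integral>\<^sup>+t. indicator {a..<p} t * g t \<partial>lborel) + (\<integral>\<^sup>+t. indicator {p..<p+a} t * g t \<partial>lborel)"
    by (subst nn_integral_add) auto
  also have "(\<integral>\<^sup>+t. indicator {p..<p+a} t * g t \<partial>lborel) = (\<integral>\<^sup>+t. indicator {p..<p+a} (p + t) * g (p + t) \<partial>lborel)"
    by (rule nn_integral_lborel_shift(1)[of "\<lambda>t. indicator {p..<p+a} t * g t", symmetric]) auto
  also have "\<dots> = (\<integral>\<^sup>+t. indicator {0..<a} t * g t \<partial>lborel)"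
    using per by (intro nn_integral_cong) (auto simp: add.commute split: split_indicator)
  also have "(\<integral>\<^sup>+t. indicator {a..<p} t * g t \<partial>lborel) + \<dots> = (\<integral>\<^sup>+t. indicator {a..<p} t * g t + indicator {0..<a} t * g t \<partial>lborel)"
    by (subst nn_integral_add) auto
  also have "\<dots> = (\<integral>\<^sup>+t. indicator {0..<p} t * g t \<partial>lborel)"
    using a by (intro nn_integral_cong) (auto split: split_indicator)
  finally show ?thesis .
qed

text \<open>Averaging the rotation-invariant integral over all angles and exchanging the integrals
  replaces \<open>g\<close> by its circular mean \<open>G\<close>, a function of
  \<open>cmod w\<close> alone, to which the radial formula applies.\<close>

lemma nn_integral_polar:
  fixes g :: "complex \<Rightarrow> ennreal"
  assumes [measurable]: "g \<in> borel_measurable borel"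
  shows "(\<integral>\<^sup>+w. g w \<partial>lborel) =
    (\<integral>\<^sup>+\<theta>. (\<integral>\<^sup>+\<rho>. indicator {0..<2*pi} \<theta> * (indicator {0..} \<rho> * (ennreal \<rho> * g (of_real \<rho> * cis \<theta>))) \<partial>lborel) \<partial>lborel)"
proof -
  have rot: "(\<integral>\<^sup>+w. g (c * w) \<partial>lborel) = (\<integral>\<^sup>+w. g w \<partial>lborel)" if "cmod c = 1" for c
    by (subst (2) lborel_distr_unit_mult[OF that, symmetric], subst nn_integral_distr) auto
  define G where "G = (\<lambda>\<rho>::real. \<integral>\<^sup>+\<theta>. indicator {0..<2*pi} \<theta> * g (of_real \<rho> * cis \<theta>) \<partial>lborel)"
  have [measurable]: "cis \<in> borel_measurable borel"
    by (intro borel_measurable_continuous_onI continuous_intros)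
  have G_meas [measurable]: "G \<in> borel_measurable borel" unfolding G_def by measurable
  have circ: "(\<integral>\<^sup>+\<theta>. indicator {0..<2*pi} \<theta> * g (cis \<theta> * w) \<partial>lborel) = G (cmod w)" for w
  proof -
    have "0 \<le> Arg2pi w" "Arg2pi w < 2 * pi" by (auto simp: Arg2pi_ge_0 Arg2pi_lt_2pi)
    have "cis \<theta> * w = of_real (cmod w) * cis (\<theta> + Arg2pi w)" for \<theta>
      by (subst Arg2pi_eq[of w]) (simp add: cis_mult[symmetric] cis_conv_exp[of "Arg2pi w"] mult_ac)
    hence "(\<integral>\<^sup>+\<theta>. indicator {0..<2*pi} \<theta> * g (cis \<theta> * w) \<partial>lborel)
       = (\<integral>\<^sup>+\<theta>. indicator {0..<2*pi} \<theta> * g (of_real (cmod w) * cis (\<theta> + Arg2pi w)) \<partial>lborel)"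
      by simp
    also have "\<dots> = G (cmod w)" unfolding G_def
      using \<open>0 \<le> Arg2pi w\<close> \<open>Arg2pi w < 2 * pi\<close>
      by (intro nn_integral_periodic_shift[where g = "\<lambda>\<theta>. g (of_real (cmod w) * cis \<theta>)"]) (auto simp: cis_mult[symmetric])
    finally show ?thesis .
  qed
  have "ennreal (2 * pi) * (\<integral>\<^sup>+w. g w \<partial>lborel) = (\<integral>\<^sup>+\<theta>. indicator {0..<2*pi} \<theta> * (\<integral>\<^sup>+w. g w \<partial>lborel) \<partial>(lborel::real measure))"
    by (subst nn_integral_multc) auto
  also have "\<dots> = (\<integral>\<^sup>+\<theta>. indicator {0..<2*pi} \<theta> * (\<integral>\<^sup>+w. g (cis \<theta> * w) \<partial>lborel) \<partial>lborel)"
    by (simp add: rot)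
  also have "\<dots> = (\<integral>\<^sup>+\<theta>. (\<integral>\<^sup>+w. indicator {0..<2*pi} \<theta> * g (cis \<theta> * w) \<partial>lborel) \<partial>lborel)"
    by (subst nn_integral_cmult) auto
  also have "\<dots> = (\<integral>\<^sup>+w. (\<integral>\<^sup>+\<theta>. indicator {0..<2*pi} \<theta> * g (cis \<theta> * w) \<partial>lborel) \<partial>lborel)"
    by (subst lborel_pair.Fubini') auto
  also have "\<dots> = (\<integral>\<^sup>+w. G (cmod w) \<partial>lborel)" by (simp add: circ)
  also have "\<dots> = (\<integral>\<^sup>+\<rho>. ennreal (2 * pi * \<rho> * indicator {0..} \<rho>) * G \<rho> \<partial>lborel)"
    by (rule nn_integral_radial) auto
  also have "\<dots> = (\<integral>\<^sup>+\<rho>. ennreal (2 * pi) * (ennreal (\<rho> * indicator {0..} \<rho>) * G \<rho>) \<partial>lborel)"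
    by (intro nn_integral_cong) (auto simp: ennreal_mult' mult_ac split: split_indicator simp flip: ennreal_mult)
  also have "\<dots> = ennreal (2 * pi) * (\<integral>\<^sup>+\<rho>. (ennreal (\<rho> * indicator {0..} \<rho>) * G \<rho>) \<partial>lborel)"
    by (rule nn_integral_cmult) auto
  finally have "(\<integral>\<^sup>+w. g w \<partial>lborel) = (\<integral>\<^sup>+\<rho>. (ennreal (\<rho> * indicator {0..} \<rho>) * G \<rho>) \<partial>lborel)"
    by (subst (asm) ennreal_mult_cancel_left) auto
  also have "\<dots> = (\<integral>\<^sup>+\<rho>. (\<integral>\<^sup>+\<theta>. indicator {0..<2*pi} \<theta> * (indicator {0..} \<rho> * (ennreal \<rho> * g (of_real \<rho> * cis \<theta>))) \<partial>lborel) \<partial>lborel)"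
    unfolding G_def by (subst nn_integral_cmult[symmetric])
      (auto intro!: nn_integral_cong split: split_indicator)
  also have "\<dots> = (\<integral>\<^sup>+\<theta>. (\<integral>\<^sup>+\<rho>. indicator {0..<2*pi} \<theta> * (indicator {0..} \<rho> * (ennreal \<rho> * g (of_real \<rho> * cis \<theta>))) \<partial>lborel) \<partial>lborel)"
    by (subst lborel_pair.Fubini') auto
  finally show ?thesis .
qed

text \<open>Recast as an equality of measures, the nonnegative formula carries over to signed
  integrands: integrability and value of Bochner integrals follow from the rules for
  \<open>distr\<close> and \<open>density\<close>.\<close>

lemma lborel_eq_polar:
  "(lborel :: complex measure) = distr (density (lborel \<Otimes>\<^sub>M lborel)
     (\<lambda>(\<theta>, \<rho>). ennreal (indicator {0..<2*pi} \<theta> * (indicator {0..} \<rho> * \<rho>)))) borel (\<lambda>(\<theta>, \<rho>). of_real \<rho> * cis \<theta>)"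
  (is "_ = distr (density _ ?w) _ ?p")
proof (rule measure_eqI)
  fix A :: "complex set" assume "A \<in> sets lborel"
  hence [measurable]: "A \<in> sets borel" by simp
  have [measurable]: "cis \<in> borel_measurable borel"
    by (intro borel_measurable_continuous_onI continuous_intros)
  have "emeasure (distr (density (lborel \<Otimes>\<^sub>M lborel) ?w) borel ?p) A
      = (\<integral>\<^sup>+w. indicator A w \<partial>distr (density (lborel \<Otimes>\<^sub>M lborel) ?w) borel ?p)"
    by simp
  also have "\<dots> = (\<integral>\<^sup>+x. ?w x * indicator A (?p x) \<partial>(lborel \<Otimes>\<^sub>M lborel))"
    by (subst nn_integral_distr, measurable, subst nn_integral_density) auto
  also have "\<dots> = (\<integral>\<^sup>+\<theta>. \<integral>\<^sup>+\<rho>. ?w (\<theta>, \<rho>) * indicator A (?p (\<theta>, \<rho>)) \<partial>lborel \<partial>lborel)"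
    by (rule lborel.nn_integral_fst[symmetric]) measurable
  also have "\<dots> = (\<integral>\<^sup>+w. indicator A w \<partial>lborel)"
    by (subst nn_integral_polar)
       (auto intro!: nn_integral_cong split: split_indicator)
  finally show "emeasure lborel A = emeasure (distr (density (lborel \<Otimes>\<^sub>M lborel) ?w) borel ?p) A" by simp
qed simp

lemma
  fixes g :: "complex \<Rightarrow> real"
  assumes "integrable lborel g"
  shows integrable_polar: "integrable (lborel \<Otimes>\<^sub>M lborel)
          (\<lambda>(\<theta>, \<rho>). indicator {0..<2*pi} \<theta> * (indicator {0..} \<rho> * (\<rho> * g (of_real \<rho> * cis \<theta>))))" (is "integrable _ ?h")
    and integral_polar: "(\<integral>w. g w \<partial>lborel) =
          (\<integral>\<theta>. \<integral>\<rho>. indicator {0..<2*pi} \<theta> * (indicator {0..} \<rho> * (\<rho> * g (of_real \<rho> * cis \<theta>))) \<partial>lborel \<partial>lborel)"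
proof -
  have [measurable]: "g \<in> borel_measurable borel" using borel_measurable_integrable[OF assms] by simp
  have [measurable]: "cis \<in> borel_measurable borel"
    by (intro borel_measurable_continuous_onI continuous_intros)
  let ?w = "\<lambda>x::real \<times> real. indicator {0..<2*pi} (fst x) * (indicator {0..} (snd x) * snd x) :: real"
  have h: "?h = (\<lambda>x. ?w x * (case x of (\<theta>, \<rho>) \<Rightarrow> g (of_real \<rho> * cis \<theta>)))"
    by (auto simp: fun_eq_iff)
  have w: "(\<lambda>(\<theta>::real, \<rho>::real). ennreal (indicator {0..<2*pi} \<theta> * (indicator {0..} \<rho> * \<rho>))) = (\<lambda>x. ennreal (?w x))"
    by (auto simp: fun_eq_iff)
  have pos: "AE x in lborel \<Otimes>\<^sub>M lborel. 0 \<le> ?w x"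
    by (auto split: split_indicator)
  show int: "integrable (lborel \<Otimes>\<^sub>M lborel) ?h"
    using assms unfolding h
    by (subst (asm) lborel_eq_polar, subst (asm) integrable_distr_eq)
       (auto simp: w integrable_real_density[OF _ pos] split_beta)
  have "(\<integral>w. g w \<partial>lborel) = (\<integral>x. ?h x \<partial>(lborel \<Otimes>\<^sub>M lborel))"
    unfolding h by (subst lborel_eq_polar, subst integral_distr)
       (auto simp: w integral_real_density[OF _ pos] split_beta)
  also have "\<dots> = (\<integral>\<theta>. \<integral>\<rho>. ?h (\<theta>, \<rho>) \<partial>lborel \<partial>lborel)"
    by (rule lborel_pair.integral_fst'[OF int, symmetric])
  finally show "(\<integral>w. g w \<partial>lborel) =
          (\<integral>\<theta>. \<integral>\<rho>. indicator {0..<2*pi} \<theta> * (indicator {0..} \<rho> * (\<rho> * g (of_real \<rho> * cis \<theta>))) \<partial>lborel \<partial>lborel)"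
    by simp
qed

section \<open>Integrable singularities in the plane\<close>

lemma nn_integral_inverse_cmod_ball:
  assumes "0 \<le> R"
  shows "(\<integral>\<^sup>+w. indicator (ball a R) w * ennreal (inverse (cmod (a - w))) \<partial>lborel) = ennreal (2 * pi * R)"
proof -
  have "(\<integral>\<^sup>+w. indicator (ball a R) w * ennreal (inverse (cmod (a - w))) \<partial>lborel)
      = (\<integral>\<^sup>+w. indicator {..<R} (cmod (a - w)) * ennreal (inverse (cmod (a - w))) \<partial>lborel)"
    by (intro nn_integral_cong) (auto simp: dist_norm split: split_indicator)
  also have "\<dots> = (\<integral>\<^sup>+w. indicator {..<R} (cmod w) * ennreal (inverse (cmod w)) \<partial>lborel)"
    by (rule nn_integral_lborel_shift(2)[of "\<lambda>w. indicator {..<R} (cmod w) * ennreal (inverse (cmod w))" a]) measurable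
  also have "\<dots> = (\<integral>\<^sup>+\<rho>. ennreal (2 * pi * \<rho> * indicator {0..} \<rho>) * (indicator {..<R} \<rho> * ennreal (inverse \<rho>)) \<partial>lborel)"
    by (rule nn_integral_radial) measurable
  also have "\<dots> = (\<integral>\<^sup>+\<rho>. ennreal (2 * pi) * indicator {0<..<R} \<rho> \<partial>lborel)"
    by (intro nn_integral_cong) (auto simp: field_simps simp flip: ennreal_mult split: split_indicator)
  also have "\<dots> = ennreal (2 * pi * R)" using assms
    by (simp add: nn_integral_cmult ennreal_mult)
  finally show ?thesis .
qed

text \<open>Reduces the logarithmic singularity to the pole \<open>inverse s\<close>, whose integral
  over a disk is explicit.\<close>

lemma abs_ln_le: "\<bar>ln s\<bar> \<le> s + inverse s" if "0 \<le> s" for s :: real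
proof (cases "s = 0")
  case False
  hence "ln s \<le> s - 1" "ln (inverse s) \<le> inverse s - 1" "0 < inverse s"
    using that by (auto intro!: ln_le_minus_one)
  thus ?thesis using False that by (simp add: ln_inverse del: inverse_positive_iff_positive)
qed auto

lemma integrable_ln_cball:
  "integrable lborel (\<lambda>w. indicator (cball z R) w * ln (cmod (a - w)))"
proof (rule integrableI_bounded)
  have [measurable]: "cball z R \<in> sets borel" "\<And>D. ball a D \<in> sets borel" by auto
  obtain D where D: "0 \<le> D" "\<And>w. w \<in> cball z R \<Longrightarrow> w \<in> ball a D"
  proof
    show "0 \<le> dist a z + \<bar>R\<bar> + 1" by simp
    show "w \<in> ball a (dist a z + \<bar>R\<bar> + 1)" if "w \<in> cball z R" for w
      using that dist_triangle[of a w z] by auto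
  qed
  have "(\<integral>\<^sup>+w. ennreal (norm (indicator (cball z R) w * ln (cmod (a - w)))) \<partial>lborel)
     \<le> (\<integral>\<^sup>+w. ennreal D * indicator (cball z R) w + indicator (ball a D) w * ennreal (inverse (cmod (a - w))) \<partial>lborel)"
  proof (intro nn_integral_mono)
    fix w
    show "ennreal (norm (indicator (cball z R) w * ln (cmod (a - w)))) \<le>
      ennreal D * indicator (cball z R) w + indicator (ball a D) w * ennreal (inverse (cmod (a - w)))"
    proof (cases "w \<in> cball z R")
      case True
      have "\<bar>ln (cmod (a - w))\<bar> \<le> D + inverse (cmod (a - w))"
        using abs_ln_le[of "cmod (a - w)"] D(2)[OF True] by (simp add: dist_norm)
      thus ?thesis using True D(2)[OF True] \<open>0 \<le> D\<close>
        by (auto simp: ennreal_leI simp flip: ennreal_plus)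
    qed auto
  qed
  also have "\<dots> = ennreal D * emeasure lborel (cball z R) + ennreal (2 * pi * D)"
    by (subst nn_integral_add) (simp_all add: nn_integral_cmult_indicator nn_integral_inverse_cmod_ball \<open>0 \<le> D\<close>)
  also have "\<dots> < \<infinity>"
    using emeasure_lborel_cball_finite[of z R] by (auto simp: ennreal_mult_less_top)
  finally show "(\<integral>\<^sup>+w. ennreal (norm (indicator (cball z R) w * ln (cmod (a - w)))) \<partial>lborel) < \<infinity>" .
  have "(\<lambda>w. ln (cmod (a - w))) \<in> borel_measurable borel" by measurable
  thus "(\<lambda>w. indicator (cball z R) w * ln (cmod (a - w))) \<in> borel_measurable lborel" by simp
qed

lemma partial_deriv_along:
  assumes "f differentiable (at (\<gamma> t))" "(\<gamma> has_vector_derivative v) (at t)"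
  shows "((\<lambda>s. f (\<gamma> s)) has_real_derivative
     Re v * partial_deriv 1 f (\<gamma> t) + Im v * partial_deriv \<i> f (\<gamma> t)) (at t)"
proof -
  have D: "(f has_derivative frechet_derivative f (at (\<gamma> t))) (at (\<gamma> t))"
    using assms(1) by (simp add: frechet_derivative_works)
  interpret linear "frechet_derivative f (at (\<gamma> t))"
    using D has_derivative_linear by blast
  have v: "x *\<^sub>R v = (x * Re v) *\<^sub>R 1 + (x * Im v) *\<^sub>R \<i>" for x
    by (simp add: complex_eq_iff)
  have "frechet_derivative f (at (\<gamma> t)) (x *\<^sub>R v) =
      x * (Re v * partial_deriv 1 f (\<gamma> t) + Im v * partial_deriv \<i> f (\<gamma> t))" for x
    unfolding v add scale by (simp add: partial_deriv_def algebra_simps)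
  moreover have "((\<lambda>s. f (\<gamma> s)) has_derivative (\<lambda>x. frechet_derivative f (at (\<gamma> t)) (x *\<^sub>R v))) (at t)"
    using assms(2) D unfolding has_vector_derivative_def by (rule has_derivative_compose)
  ultimately show ?thesis by (simp add: has_field_derivative_def mult_commute_abs)
qed

section \<open>The logarithmic potential of the Laplacian\<close>

text \<open>The radial weight \<open>g(w) = ball_kernel R |w|\<close> satisfies \<open>\<Delta> g = 2 / R\<^sup>2 - 2 \<pi> \<delta>\<^sub>0\<close> in the disk of radius \<open>R\<close>,
  and vanishes to second order on its boundary.\<close>

definition ball_kernel :: "real \<Rightarrow> real \<Rightarrow> real" where
  "ball_kernel R s = ln R - ln s - 1/2 + s\<^sup>2 / (2 * R\<^sup>2)"

lemma ball_kernel_measurable [measurable]: "ball_kernel R \<in> borel_measurable borel"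
  unfolding ball_kernel_def by measurable

lemma ball_kernel_deriv:
  assumes "0 < s" "0 < R"
  shows "(ball_kernel R has_real_derivative (s / R\<^sup>2 - 1 / s)) (at s)"
  unfolding ball_kernel_def using assms
  by (auto intro!: derivative_eq_intros simp: field_simps)

lemma ball_kernel_self: "0 < R \<Longrightarrow> ball_kernel R R = 0"
  by (simp add: ball_kernel_def power2_eq_square)

lemma ball_kernel_nonneg:
  assumes "0 < s" "s \<le> R"
  shows "0 \<le> ball_kernel R s"
proof -
  have "ball_kernel R R \<le> ball_kernel R s"
  proof (rule DERIV_nonpos_imp_nonincreasing[OF assms(2)])
    fix x assume x: "s \<le> x" "x \<le> R"
    hence "x / R\<^sup>2 - 1 / x \<le> 0"
      using assms by (auto simp: field_simps power2_eq_square intro!: mult_mono)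
    thus "\<exists>y. (ball_kernel R has_real_derivative y) (at x) \<and> y \<le> 0"
      using ball_kernel_deriv[of x R] x assms by auto
  qed
  thus ?thesis using assms ball_kernel_self[of R] by simp
qed

lemma tendsto_mult_ln_at_right_0: "((\<lambda>s::real. s * ln s) \<longlongrightarrow> 0) (at 0 within {0..R})"
proof -
  have "((\<lambda>s::real. s * ln s) \<longlongrightarrow> 0) (at_right 0)" by real_asymp
  hence "((\<lambda>s::real. s * ln s) \<longlongrightarrow> 0) (at 0 within {0..})"
    by (subst at_within_Ici_at_right)
  thus ?thesis by (rule tendsto_within_subset) auto
qed

lemma continuous_on_mult_ln: "continuous_on {0..R} (\<lambda>s::real. s * ln s)"
  unfolding continuous_on_eq_continuous_within
proof
  fix s assume "s \<in> {0..R}"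
  show "continuous (at s within {0..R}) (\<lambda>s. s * ln s)"
  proof (cases "s = 0")
    case True
    thus ?thesis using tendsto_mult_ln_at_right_0[of R] by (simp add: continuous_within)
  next
    case False
    thus ?thesis unfolding continuous_within by (intro tendsto_intros) auto
  qed
qed

lemma continuous_on_mult_ball_kernel:
  assumes "0 < R"
  shows "continuous_on {0..R} (\<lambda>s. s * ball_kernel R s)"
proof -
  have eq: "(\<lambda>s. s * ball_kernel R s) = (\<lambda>s. s * (ln R - 1/2) - s * ln s + s * (s\<^sup>2 / (2 * R\<^sup>2)))"
    by (auto simp: ball_kernel_def algebra_simps)
  show ?thesis unfolding eq using assms by (intro continuous_intros continuous_on_mult_ln) auto
qed

text \<open>Integrability against \<open>d\<rho>\<close>, without the factor \<open>\<rho>\<close>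
  of polar coordinates, is required because the second angular derivative enters divided by
  \<open>\<rho>\<close> and need not vanish at the centre.\<close>

lemma integrable_ball_kernel:
  assumes "0 < R"
  shows "integrable lborel (\<lambda>s. indicator {0..R} s * ball_kernel R s)"
proof -
  define F where "F = (\<lambda>s. s * (ln R + 1/2) - s * ln s + s ^ 3 / (6 * R\<^sup>2))"
  have "(ball_kernel R has_integral F R - F 0) {0..R}"
  proof (rule fundamental_theorem_of_calculus_interior)
    show "continuous_on {0..R} F" unfolding F_def using assms by (intro continuous_intros continuous_on_mult_ln) auto
    fix s assume "s \<in> {0<..<R}"
    hence "(F has_real_derivative ball_kernel R s) (at s)"
      unfolding F_def ball_kernel_def using assms
      by (auto intro!: derivative_eq_intros simp: field_simps power2_eq_square power3_eq_cube)
    thus "(F has_vector_derivative ball_kernel R s) (at s)"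
      by (simp add: has_real_derivative_iff_has_vector_derivative)
  qed (use assms in auto)
  \<comment> \<open>At 0 the convention \<open>ln 0 = 0\<close> may make the kernel negative; on the
    open interval it is nonnegative, as the comparison with the nonnegative integral
    demands.\<close>
  hence "(ball_kernel R has_integral F R - F 0) {0<..<R}"
    by (simp only: has_integral_Icc_iff_Ioo)
  hence "((\<lambda>s. if s \<in> {0<..<R} then ball_kernel R s else 0) has_integral F R - F 0) UNIV"
    by (subst has_integral_restrict_UNIV)
  hence "(\<integral>\<^sup>+s. ennreal (if s \<in> {0<..<R} then ball_kernel R s else 0) \<partial>lborel) = F R - F 0"
    by (intro nn_integral_has_integral_lborel) (auto simp: ball_kernel_nonneg)
  hence "integrable lborel (\<lambda>s. if s \<in> {0<..<R} then ball_kernel R s else 0)"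
    by (intro integrableI_nn_integral_finite[where x = "F R - F 0"]) (auto simp: ball_kernel_nonneg)
  also have "?this \<longleftrightarrow> ?thesis"
  proof (intro integrable_cong_AE)
    have "AE s in lborel. s \<noteq> (0::real)" "AE s in lborel. s \<noteq> R" by (rule AE_lborel_singleton)+
    thus "AE s in lborel. (if s \<in> {0<..<R} then ball_kernel R s else 0) = indicator {0..R} s * ball_kernel R s"
      by eventually_elim auto
  qed auto
  finally show ?thesis .
qed

section \<open>Green's representation formula on a disk\<close>

lemma bounded_on_rectangle:
  fixes g :: "real \<times> real \<Rightarrow> real"
  assumes "continuous_on UNIV g"
  obtains B where "0 \<le> B" "\<And>x y. a \<le> x \<Longrightarrow> x \<le> b \<Longrightarrow> c \<le> y \<Longrightarrow> y \<le> d \<Longrightarrow> \<bar>g (x, y)\<bar> \<le> B"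
proof -
  have "compact (g ` ({a..b} \<times> {c..d}))"
    by (intro compact_continuous_image compact_Times continuous_on_subset[OF assms]) auto
  then obtain B where B: "\<And>u. u \<in> g ` ({a..b} \<times> {c..d}) \<Longrightarrow> norm u \<le> B"
    using compact_imp_bounded bounded_iff by metis
  show thesis
  proof (rule that[of "max 0 B"])
    fix x y assume "a \<le> x" "x \<le> b" "c \<le> y" "y \<le> d"
    hence "norm (g (x, y)) \<le> B" by (intro B imageI) auto
    thus "\<bar>g (x, y)\<bar> \<le> max 0 B" by simp
  qed simp
qed

lemma continuous_on_slice:
  assumes "continuous_on UNIV (\<lambda>(x, y). g x y)"
  shows "continuous_on UNIV (\<lambda>y. g x y)" "continuous_on UNIV (\<lambda>x. g x y)"
proof -
  have "continuous_on UNIV (\<lambda>y. (x, y))" "continuous_on UNIV (\<lambda>x. (x, y))"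
    by (intro continuous_on_Pair continuous_on_const continuous_on_id)+
  from this[THEN continuous_on_compose2[OF assms]]
  show "continuous_on UNIV (\<lambda>y. g x y)" "continuous_on UNIV (\<lambda>x. g x y)" by auto
qed

lemma
  assumes "C2_complex f"
  shows C2_differentiable: "f differentiable at z"
    and C2_partial_differentiable: "b \<in> {1, \<i>} \<Longrightarrow> partial_deriv b f differentiable at z"
    and C2_continuous: "continuous_on UNIV f"
    and C2_partial_continuous: "b \<in> {1, \<i>} \<Longrightarrow> continuous_on UNIV (partial_deriv b f)"
    and C2_partial2_continuous: "b \<in> {1, \<i>} \<Longrightarrow> c \<in> {1, \<i>} \<Longrightarrow> continuous_on UNIV (partial_deriv c (partial_deriv b f))"
proof -
  show 1: "\<And>z. f differentiable at z" "\<And>b z. b \<in> {1, \<i>} \<Longrightarrow> partial_deriv b f differentiable at z"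
    "\<And>b c. b \<in> {1, \<i>} \<Longrightarrow> c \<in> {1, \<i>} \<Longrightarrow> continuous_on UNIV (partial_deriv c (partial_deriv b f))"
    using assms unfolding C2_complex_def Basis_complex_def by (auto simp: differentiable_on_def)
  thus "continuous_on UNIV f" "b \<in> {1, \<i>} \<Longrightarrow> continuous_on UNIV (partial_deriv b f)"
    by (auto simp: differentiable_on_def intro!: differentiable_imp_continuous_on)
qed

lemma laplacian_eq: "laplacian f z = partial_deriv 1 (partial_deriv 1 f) z + partial_deriv \<i> (partial_deriv \<i> f) z"
  by (simp add: laplacian_def Basis_complex_def)

lemma C2_laplacian_continuous: "C2_complex f \<Longrightarrow> continuous_on UNIV (laplacian f)"
  unfolding laplacian_eq[abs_def] by (intro continuous_intros C2_partial2_continuous) auto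

lemma integrable_lborel_mult:
  fixes g h :: "real \<Rightarrow> real"
  assumes "integrable lborel g" "integrable lborel h"
  shows "integrable (lborel \<Otimes>\<^sub>M lborel) (\<lambda>x. g (fst x) * h (snd x))"
proof (rule lborel_pair.Fubini_integrable)
  have [measurable]: "g \<in> borel_measurable lborel" "h \<in> borel_measurable lborel"
    using assms by auto
  show "(\<lambda>x. g (fst x) * h (snd x)) \<in> borel_measurable (lborel \<Otimes>\<^sub>M lborel)" by measurable
qed (use assms in \<open>auto simp: abs_mult\<close>)

context
  fixes f :: "complex \<Rightarrow> real" and z :: complex and R :: real
  assumes f: "C2_complex f" and R: "0 < R"
begin

private definition pt :: "real \<Rightarrow> real \<Rightarrow> complex" where
  "pt \<theta> \<rho> = z + of_real \<rho> * cis \<theta>"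

private definition fr :: "real \<Rightarrow> real \<Rightarrow> real" where
  "fr \<theta> \<rho> = cos \<theta> * partial_deriv 1 f (pt \<theta> \<rho>) + sin \<theta> * partial_deriv \<i> f (pt \<theta> \<rho>)"

text \<open>This is the second angular derivative of \<open>f\<close>, divided by \<open>\<rho>\<close>.\<close>

private definition ft2 :: "real \<Rightarrow> real \<Rightarrow> real" where
  "ft2 \<theta> \<rho> = \<rho> * ((sin \<theta>)\<^sup>2 * partial_deriv 1 (partial_deriv 1 f) (pt \<theta> \<rho>)
      - sin \<theta> * cos \<theta> * (partial_deriv \<i> (partial_deriv 1 f) (pt \<theta> \<rho>) + partial_deriv 1 (partial_deriv \<i> f) (pt \<theta> \<rho>))
      + (cos \<theta>)\<^sup>2 * partial_deriv \<i> (partial_deriv \<i> f) (pt \<theta> \<rho>)) - fr \<theta> \<rho>"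

private lemma deriv_radial:
  assumes "\<And>w. g differentiable at w"
  shows "((\<lambda>\<rho>. g (pt \<theta> \<rho>)) has_real_derivative
     cos \<theta> * partial_deriv 1 g (pt \<theta> \<rho>) + sin \<theta> * partial_deriv \<i> g (pt \<theta> \<rho>)) (at \<rho>)"
proof -
  have "(pt \<theta> has_vector_derivative cis \<theta>) (at \<rho>)"
    unfolding pt_def by (auto intro!: derivative_eq_intros simp: has_vector_derivative_def fun_eq_iff scaleR_conv_of_real)
  from partial_deriv_along[OF assms this] show ?thesis by simp
qed

private lemma deriv_angular:
  assumes "\<And>w. g differentiable at w"
  shows "((\<lambda>\<theta>. g (pt \<theta> \<rho>)) has_real_derivative
     (- \<rho> * sin \<theta>) * partial_deriv 1 g (pt \<theta> \<rho>) + (\<rho> * cos \<theta>) * partial_deriv \<i> g (pt \<theta> \<rho>)) (at \<theta>)"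
proof -
  have "((\<lambda>\<theta>. pt \<theta> \<rho>) has_vector_derivative (of_real \<rho> * (\<i> * cis \<theta>))) (at \<theta>)"
    unfolding pt_def cis_conv_exp
    by (auto intro!: derivative_eq_intros has_vector_derivative_real_field simp: algebra_simps)
  from partial_deriv_along[OF assms this] show ?thesis by simp
qed

private lemma cont_pt: "continuous_on UNIV g \<Longrightarrow> continuous_on UNIV (\<lambda>(\<theta>, \<rho>). g (pt \<theta> \<rho>))"
  for g :: "complex \<Rightarrow> real"
  unfolding split_beta pt_def
  by (rule continuous_on_compose2[of UNIV g]) (assumption | intro continuous_intros | simp)+

private lemma cont_fr: "continuous_on UNIV (\<lambda>(\<theta>, \<rho>). fr \<theta> \<rho>)"
  using cont_pt[OF C2_partial_continuous[OF f, of 1]] cont_pt[OF C2_partial_continuous[OF f, of \<i>]]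
  unfolding fr_def split_beta by (intro continuous_intros) simp_all

private lemma cont_ft2: "continuous_on UNIV (\<lambda>(\<theta>, \<rho>). ft2 \<theta> \<rho>)"
  using cont_pt[OF C2_partial2_continuous[OF f, of 1 1]] cont_pt[OF C2_partial2_continuous[OF f, of 1 \<i>]]
    cont_pt[OF C2_partial2_continuous[OF f, of \<i> 1]] cont_pt[OF C2_partial2_continuous[OF f, of \<i> \<i>]] cont_fr
  unfolding ft2_def split_beta by (intro continuous_intros) simp_all

text \<open>\<open>V\<close>, the angular derivative of \<open>f\<close> divided by
  \<open>\<rho>\<close>, is a primitive that takes the same value after a full turn. Hence
  \<open>ft2\<close> can be added to the radial integrand without changing the integral over the
  disk.\<close>

private lemma angular_integral: "(\<integral>\<theta>. indicator {0..<2*pi} \<theta> * ft2 \<theta> \<rho> \<partial>lborel) = 0"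
proof -
  define V where "V = (\<lambda>\<theta>. - sin \<theta> * partial_deriv 1 f (pt \<theta> \<rho>) + cos \<theta> * partial_deriv \<i> f (pt \<theta> \<rho>))"
  have "(\<integral>\<theta>. indicator {0..<2*pi} \<theta> * ft2 \<theta> \<rho> \<partial>lborel) = (\<integral>\<theta>. ft2 \<theta> \<rho> * indicator {0..2*pi} \<theta> \<partial>lborel)"
  proof (rule integral_cong_AE)
    have [measurable]: "(\<lambda>\<theta>. ft2 \<theta> \<rho>) \<in> borel_measurable borel"
      using continuous_on_slice(2)[OF cont_ft2] by (intro borel_measurable_continuous_onI)
    show "(\<lambda>\<theta>. indicator {0..<2*pi} \<theta> * ft2 \<theta> \<rho>) \<in> borel_measurable lborel"
      "(\<lambda>\<theta>. ft2 \<theta> \<rho> * indicator {0..2*pi} \<theta>) \<in> borel_measurable lborel" by auto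
    have "AE \<theta> in lborel. \<theta> \<noteq> 2 * pi" by (rule AE_lborel_singleton)
    thus "AE \<theta> in lborel. indicator {0..<2*pi} \<theta> * ft2 \<theta> \<rho> = ft2 \<theta> \<rho> * indicator {0..2*pi} \<theta>"
      by eventually_elim (auto split: split_indicator)
  qed
  also have "\<dots> = V (2 * pi) - V 0"
  proof (rule integral_FTC_Icc_real)
    fix \<theta>
    show "isCont (\<lambda>\<theta>. ft2 \<theta> \<rho>) \<theta>"
      using continuous_on_slice(2)[OF cont_ft2] by (simp add: continuous_on_eq_continuous_at)
    note d = deriv_angular[OF C2_partial_differentiable[OF f]]
    show "(V has_real_derivative ft2 \<theta> \<rho>) (at \<theta>)"
      unfolding V_def ft2_def fr_def
      by (rule derivative_eq_intros d refl | simp)+ (simp add: algebra_simps power2_eq_square)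
  qed simp
  also have "\<dots> = 0" by (simp add: V_def pt_def)
  finally show ?thesis .
qed

text \<open>Up to \<open>ft2\<close>, the quantity \<open>\<rho> * laplacian f\<close> is the
  \<open>\<rho>\<close>-derivative of \<open>\<rho> * fr\<close>. On each single ray the integrand
  is therefore the derivative of \<open>P\<close>, and the one-dimensional fundamental theorem
  suffices. At \<open>R\<close> both the kernel and \<open>\<rho>^2 / R^2 - 1\<close> vanish; at the
  centre only \<open>P 0 = - f z\<close> survives.\<close>

private lemma radial_integral:
  "((\<lambda>\<rho>. \<rho> * (2 / R\<^sup>2 * f (pt \<theta> \<rho>) - ball_kernel R \<rho> * laplacian f (pt \<theta> \<rho>)) + ball_kernel R \<rho> * ft2 \<theta> \<rho>)
      has_integral f z) {0..R}"
proof -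
  define P where "P = (\<lambda>\<rho>. (\<rho>\<^sup>2 / R\<^sup>2 - 1) * f (pt \<theta> \<rho>) - \<rho> * ball_kernel R \<rho> * fr \<theta> \<rho>)"
  have "((\<lambda>\<rho>. \<rho> * (2 / R\<^sup>2 * f (pt \<theta> \<rho>) - ball_kernel R \<rho> * laplacian f (pt \<theta> \<rho>)) + ball_kernel R \<rho> * ft2 \<theta> \<rho>)
      has_integral P R - P 0) {0..R}"
  proof (rule fundamental_theorem_of_calculus_interior)
    note continuous_on_slice(1)[OF cont_fr] continuous_on_slice(1)[OF cont_pt[OF C2_continuous[OF f]]]
    hence "continuous_on {0..R} (fr \<theta>)" "continuous_on {0..R} (\<lambda>\<rho>. f (pt \<theta> \<rho>))"
      by (auto intro: continuous_on_subset)
    thus "continuous_on {0..R} P" unfolding P_def using R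
      by (intro continuous_intros continuous_on_mult_ball_kernel) auto
    fix \<rho> assume \<rho>: "\<rho> \<in> {0<..<R}"
    note d = deriv_radial[OF C2_differentiable[OF f]] deriv_radial[OF C2_partial_differentiable[OF f]]
    define q where "q = ball_kernel R \<rho>"
    define u where "u = f (pt \<theta> \<rho>)"
    define v where "v = fr \<theta> \<rho>"
    define s where "s = (cos \<theta>)\<^sup>2 * partial_deriv 1 (partial_deriv 1 f) (pt \<theta> \<rho>)
      + sin \<theta> * cos \<theta> * (partial_deriv \<i> (partial_deriv 1 f) (pt \<theta> \<rho>) + partial_deriv 1 (partial_deriv \<i> f) (pt \<theta> \<rho>))
      + (sin \<theta>)\<^sup>2 * partial_deriv \<i> (partial_deriv \<i> f) (pt \<theta> \<rho>)"
    have du: "((\<lambda>\<rho>. f (pt \<theta> \<rho>)) has_real_derivative v) (at \<rho>)"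
      unfolding v_def fr_def by (rule d)
    have dv: "(fr \<theta> has_real_derivative s) (at \<rho>)"
      unfolding fr_def s_def
      by (rule derivative_eq_intros d refl | simp)+ (simp add: algebra_simps power2_eq_square)
    have dq: "(ball_kernel R has_real_derivative (\<rho> / R\<^sup>2 - 1 / \<rho>)) (at \<rho>)"
      using \<rho> R by (intro ball_kernel_deriv) auto
    have "((\<lambda>\<rho>. \<rho>\<^sup>2 / R\<^sup>2 - 1) has_real_derivative 2 * \<rho> / R\<^sup>2) (at \<rho>)"
      using R by (auto intro!: derivative_eq_intros simp: field_simps power2_eq_square power4_eq_xxxx)
    from DERIV_diff[OF DERIV_mult[OF this du] DERIV_mult[OF DERIV_mult[OF DERIV_ident dq] dv]]
    have "(P has_real_derivative (2 * \<rho> / R\<^sup>2 * u + (\<rho>\<^sup>2 / R\<^sup>2 - 1) * v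
          - ((q + \<rho> * (\<rho> / R\<^sup>2 - 1 / \<rho>)) * v + \<rho> * q * s))) (at \<rho>)"
      unfolding P_def by (rule DERIV_cong) (simp add: u_def v_def q_def algebra_simps)
    \<comment> \<open>The prefactor \<open>\<rho>^2 / R^2 - 1\<close> equals \<open>\<rho>\<close>
      times the derivative of the kernel, so the first-order terms cancel except for
      \<open>q * v\<close>.\<close>
    also have "2 * \<rho> / R\<^sup>2 * u + (\<rho>\<^sup>2 / R\<^sup>2 - 1) * v - ((q + \<rho> * (\<rho> / R\<^sup>2 - 1 / \<rho>)) * v + \<rho> * q * s)
       = \<rho> * (2 / R\<^sup>2 * u) - q * (v + \<rho> * s)"
      using \<rho> by (simp add: algebra_simps power2_eq_square)
    also have "v + \<rho> * s = \<rho> * laplacian f (pt \<theta> \<rho>) - ft2 \<theta> \<rho>"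
    proof -
      have "laplacian f (pt \<theta> \<rho>) = ((sin \<theta>)\<^sup>2 + (cos \<theta>)\<^sup>2) * partial_deriv 1 (partial_deriv 1 f) (pt \<theta> \<rho>)
         + ((sin \<theta>)\<^sup>2 + (cos \<theta>)\<^sup>2) * partial_deriv \<i> (partial_deriv \<i> f) (pt \<theta> \<rho>)"
        by (simp add: laplacian_eq)
      thus ?thesis unfolding s_def ft2_def v_def by (simp only: algebra_simps)
    qed
    finally show "(P has_vector_derivative (\<rho> * (2 / R\<^sup>2 * f (pt \<theta> \<rho>) - ball_kernel R \<rho> * laplacian f (pt \<theta> \<rho>))
        + ball_kernel R \<rho> * ft2 \<theta> \<rho>)) (at \<rho>)"
      by (simp add: has_real_derivative_iff_has_vector_derivative u_def q_def algebra_simps)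
  qed (use R in auto)
  also have "P R - P 0 = f z" using R by (simp add: P_def ball_kernel_self pt_def)
  finally show ?thesis .
qed

private lemma cont_imp_measurable_pair:
  "continuous_on UNIV g \<Longrightarrow> g \<in> borel_measurable (lborel \<Otimes>\<^sub>M lborel)" for g :: "real \<times> real \<Rightarrow> real"
  by (simp add: lborel_prod borel_measurable_continuous_onI)

lemma integrable_disk:
  "integrable lborel (\<lambda>w. indicator (ball z R) w * (2 / R\<^sup>2 * f w - ball_kernel R (cmod (z - w)) * laplacian f w))"
proof -
  have [measurable]: "cball z R \<in> sets borel" "ball z R \<in> sets borel" by auto
  have [measurable]: "f \<in> borel_measurable borel" "laplacian f \<in> borel_measurable borel"
    using C2_continuous[OF f] C2_laplacian_continuous[OF f] by (auto intro: borel_measurable_continuous_onI)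
  have "compact ((\<lambda>w. (f w, laplacian f w)) ` cball z R)"
    by (intro compact_continuous_image continuous_on_Pair continuous_on_subset[OF C2_continuous[OF f]]
        continuous_on_subset[OF C2_laplacian_continuous[OF f]]) auto
  then obtain B where "\<And>u. u \<in> (\<lambda>w. (f w, laplacian f w)) ` cball z R \<Longrightarrow> norm u \<le> B"
    using compact_imp_bounded bounded_iff by metis
  hence "norm (f w, laplacian f w) \<le> B" if "w \<in> cball z R" for w using that by blast
  hence B: "\<bar>f w\<bar> \<le> B" "\<bar>laplacian f w\<bar> \<le> B" if "w \<in> cball z R" for w
    using that norm_fst_le[of "f w" "laplacian f w"] norm_snd_le[of "laplacian f w" "f w"] by force+
  have B0: "0 \<le> B" using B(1)[of z] R by auto
  have fin: "integrable lborel (indicator (cball z R) :: complex \<Rightarrow> real)"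
    using emeasure_lborel_cball_finite[of z R] by (intro integrable_real_indicator) auto
  have int: "integrable lborel (\<lambda>w. B * (2 / R\<^sup>2 + \<bar>ln R\<bar> + 2) * indicator (cball z R) w
        + B * \<bar>indicator (cball z R) w * ln (cmod (z - w))\<bar>)"
    by (intro Bochner_Integration.integrable_add integrable_mult_right integrable_abs integrable_ln_cball fin)
  show ?thesis
  proof (rule Bochner_Integration.integrable_bound[OF int])
    show "AE w in lborel. norm (indicator (ball z R) w * (2 / R\<^sup>2 * f w - ball_kernel R (cmod (z - w)) * laplacian f w))
       \<le> norm (B * (2 / R\<^sup>2 + \<bar>ln R\<bar> + 2) * indicator (cball z R) w + B * \<bar>indicator (cball z R) w * ln (cmod (z - w))\<bar>)"
    proof (intro AE_I2)
      fix w
      show "norm (indicator (ball z R) w * (2 / R\<^sup>2 * f w - ball_kernel R (cmod (z - w)) * laplacian f w))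
       \<le> norm (B * (2 / R\<^sup>2 + \<bar>ln R\<bar> + 2) * indicator (cball z R) w + B * \<bar>indicator (cball z R) w * ln (cmod (z - w))\<bar>)"
      proof (cases "w \<in> ball z R")
        case True
        hence w: "w \<in> cball z R" "cmod (z - w) \<le> R" by (auto simp: dist_norm)
        have "(cmod (z - w))\<^sup>2 / (2 * R\<^sup>2) \<le> R\<^sup>2 / (2 * R\<^sup>2)"
          using w R by (intro divide_right_mono power_mono) auto
        hence "\<bar>(cmod (z - w))\<^sup>2 / (2 * R\<^sup>2)\<bar> \<le> 1/2" using R by simp
        hence "\<bar>ball_kernel R (cmod (z - w))\<bar> \<le> \<bar>ln R\<bar> + \<bar>ln (cmod (z - w))\<bar> + 1"
          unfolding ball_kernel_def by linarith
        hence b: "\<bar>ball_kernel R (cmod (z - w)) * laplacian f w\<bar> \<le> (\<bar>ln R\<bar> + \<bar>ln (cmod (z - w))\<bar> + 1) * B"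
          unfolding abs_mult using B(2)[OF w(1)] B0 by (intro mult_mono) auto
        have a: "\<bar>2 / R\<^sup>2 * f w\<bar> \<le> 2 / R\<^sup>2 * B"
          unfolding abs_mult using B(1)[OF w(1)] R by (intro mult_mono) auto
        have "0 \<le> B / R\<^sup>2" "0 \<le> B * \<bar>ln R\<bar>" "0 \<le> B * \<bar>ln (cmod (z - w))\<bar>" using B0 by auto
        hence "2 / R\<^sup>2 * B + (\<bar>ln R\<bar> + \<bar>ln (cmod (z - w))\<bar> + 1) * B \<le>
           B * (2 / R\<^sup>2 + \<bar>ln R\<bar> + 2) + B * \<bar>ln (cmod (z - w))\<bar>"
          using B0 by (simp add: algebra_simps)
        with a b have "\<bar>2 / R\<^sup>2 * f w - ball_kernel R (cmod (z - w)) * laplacian f w\<bar> \<le>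
           B * (2 / R\<^sup>2 + \<bar>ln R\<bar> + 2) + B * \<bar>ln (cmod (z - w))\<bar>"
          by linarith
        thus ?thesis using True w by simp
      qed auto
    qed
  qed measurable
qed

text \<open>\<open>T\<close> is the given integrand in polar coordinates and \<open>U\<close> the
  angular correction. The radial identity evaluates \<open>T + U\<close> with \<open>\<rho>\<close>
  integrated first, whereas \<open>U\<close> vanishes with \<open>\<theta>\<close> integrated first.
  Both orders are legitimate because \<open>T\<close> and \<open>U\<close> are separately integrable
  on the product.\<close>

lemma integral_disk:
  "(\<integral>w. indicator (ball z R) w * (2 / R\<^sup>2 * f w - ball_kernel R (cmod (z - w)) * laplacian f w) \<partial>lborel) = 2 * pi * f z"
proof -
  define G where "G = (\<lambda>w. indicator (ball z R) w * (2 / R\<^sup>2 * f w - ball_kernel R (cmod (z - w)) * laplacian f w))"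
  define T where "T = (\<lambda>(\<theta>, \<rho>). indicator {0..<2*pi} \<theta> * (indicator {0..<R} \<rho> *
     (\<rho> * (2 / R\<^sup>2 * f (pt \<theta> \<rho>) - ball_kernel R \<rho> * laplacian f (pt \<theta> \<rho>)))))"
  define U where "U = (\<lambda>(\<theta>, \<rho>). indicator {0..<2*pi} \<theta> * (indicator {0..<R} \<rho> * (ball_kernel R \<rho> * ft2 \<theta> \<rho>)))"
  have G: "integrable lborel G" unfolding G_def by (rule integrable_disk)
  have sh: "lborel = distr lborel borel ((+) z)" by (rule lborel_distr_plus[symmetric])
  have G': "integrable lborel (\<lambda>w. G (z + w))"
    using G by (subst (asm) sh, subst (asm) integrable_distr_eq) auto
  have GT: "(\<lambda>(\<theta>, \<rho>). indicator {0..<2*pi} \<theta> * (indicator {0..} \<rho> * (\<rho> * G (z + of_real \<rho> * cis \<theta>)))) = T"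
    by (auto simp: fun_eq_iff T_def G_def pt_def dist_norm norm_mult split: split_indicator)
  have T: "integrable (lborel \<Otimes>\<^sub>M lborel) T"
    using integrable_polar[OF G'] unfolding GT .
  have "(\<integral>w. G w \<partial>lborel) = (\<integral>w. G (z + w) \<partial>lborel)"
    using G by (subst sh, subst integral_distr) auto
  also have "\<dots> = (\<integral>\<theta>. \<integral>\<rho>. T (\<theta>, \<rho>) \<partial>lborel \<partial>lborel)"
    using integral_polar[OF G'] unfolding GT[symmetric] by simp
  also have "\<dots> = (\<integral>x. T x \<partial>(lborel \<Otimes>\<^sub>M lborel))"
    by (rule lborel_pair.integral_fst'[OF T])
  finally have int_G: "(\<integral>w. G w \<partial>lborel) = (\<integral>x. T x \<partial>(lborel \<Otimes>\<^sub>M lborel))" .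

  obtain B where B: "0 \<le> B" "\<And>\<theta> \<rho>. 0 \<le> \<theta> \<Longrightarrow> \<theta> \<le> 2 * pi \<Longrightarrow> 0 \<le> \<rho> \<Longrightarrow> \<rho> \<le> R \<Longrightarrow> \<bar>ft2 \<theta> \<rho>\<bar> \<le> B"
    using bounded_on_rectangle[OF cont_ft2, of 0 "2 * pi" 0 R] by auto
  have [measurable]: "(\<lambda>x. ft2 (fst x) (snd x)) \<in> borel_measurable (lborel \<Otimes>\<^sub>M lborel)"
    using cont_imp_measurable_pair[OF cont_ft2] by (simp add: split_beta)
  \<comment> \<open>\<open>ft2\<close> is bounded on the rectangle, so a constant times the
    one-dimensionally integrable kernel dominates \<open>U\<close>.\<close>
  have dom: "integrable (lborel \<Otimes>\<^sub>M lborel) (\<lambda>(\<theta>::real, \<rho>). (B * indicator {0..<2*pi} \<theta>) * (indicator {0..R} \<rho> * ball_kernel R \<rho>))"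
    unfolding split_beta by (intro integrable_lborel_mult integrable_ball_kernel R) auto
  have U: "integrable (lborel \<Otimes>\<^sub>M lborel) U"
  proof (rule Bochner_Integration.integrable_bound[OF dom])
    show "U \<in> borel_measurable (lborel \<Otimes>\<^sub>M lborel)" unfolding U_def split_beta by measurable
    show "AE x in lborel \<Otimes>\<^sub>M lborel. norm (U x) \<le>
       norm (case x of (\<theta>, \<rho>) \<Rightarrow> (B * indicator {0..<2*pi} \<theta>) * (indicator {0..R} \<rho> * ball_kernel R \<rho>))"
      using B by (auto simp: U_def abs_mult mult.commute[of B] intro!: AE_I2 mult_left_mono split: split_indicator)
  qed
  have "(\<integral>x. U x \<partial>(lborel \<Otimes>\<^sub>M lborel)) = (\<integral>\<rho>. \<integral>\<theta>. U (\<theta>, \<rho>) \<partial>lborel \<partial>lborel)"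
    using lborel_pair.integral_snd[of "\<lambda>\<theta> \<rho>. U (\<theta>, \<rho>)"] U by simp
  also have "\<dots> = (\<integral>\<rho>. indicator {0..<R} \<rho> * ball_kernel R \<rho> * (\<integral>\<theta>. indicator {0..<2*pi} \<theta> * ft2 \<theta> \<rho> \<partial>lborel) \<partial>lborel)"
    unfolding U_def by (subst integral_mult_right_zero[symmetric]) (auto simp: mult_ac)
  also have "\<dots> = 0" by (simp add: angular_integral)
  finally have int_U: "(\<integral>x. U x \<partial>(lborel \<Otimes>\<^sub>M lborel)) = 0" .

  have TU: "integrable (lborel \<Otimes>\<^sub>M lborel) (\<lambda>x. T x + U x)" using T U by simp
  have "(\<integral>x. T x + U x \<partial>(lborel \<Otimes>\<^sub>M lborel)) = (\<integral>\<theta>. \<integral>\<rho>. T (\<theta>, \<rho>) + U (\<theta>, \<rho>) \<partial>lborel \<partial>lborel)"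
    by (rule lborel_pair.integral_fst'[OF TU, symmetric])
  also have "\<dots> = (\<integral>\<theta>. indicator {0..<2*pi} \<theta> * f z \<partial>lborel)"
  proof (rule integral_cong_AE)
    show "(\<lambda>\<theta>. \<integral>\<rho>. T (\<theta>, \<rho>) + U (\<theta>, \<rho>) \<partial>lborel) \<in> borel_measurable lborel"
      using borel_measurable_integrable[OF TU] by measurable
    show "AE \<theta> in lborel. (\<integral>\<rho>. T (\<theta>, \<rho>) + U (\<theta>, \<rho>) \<partial>lborel) = indicator {0..<2*pi} \<theta> * f z"
      using lborel_pair.AE_integrable_fst'[OF TU]
    proof eventually_elim
      fix \<theta> assume int: "integrable lborel (\<lambda>\<rho>. T (\<theta>, \<rho>) + U (\<theta>, \<rho>))"
      show "(\<integral>\<rho>. T (\<theta>, \<rho>) + U (\<theta>, \<rho>) \<partial>lborel) = indicator {0..<2*pi} \<theta> * f z"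
      proof (cases "\<theta> \<in> {0..<2*pi}")
        case True
        let ?h = "\<lambda>\<rho>. \<rho> * (2 / R\<^sup>2 * f (pt \<theta> \<rho>) - ball_kernel R \<rho> * laplacian f (pt \<theta> \<rho>)) + ball_kernel R \<rho> * ft2 \<theta> \<rho>"
        have "(?h has_integral f z) {0..R}" by (rule radial_integral)
        hence "(?h has_integral f z) {0<..<R}" by (simp only: has_integral_Icc_iff_Ioo)
        hence *: "((\<lambda>\<rho>. if \<rho> \<in> {0<..<R} then ?h \<rho> else 0) has_integral f z) UNIV"
          by (subst has_integral_restrict_UNIV)
        have "((\<lambda>\<rho>. T (\<theta>, \<rho>) + U (\<theta>, \<rho>)) has_integral f z) UNIV"
          by (rule has_integral_spike[OF _ _ *, of "{0}"])
             (use True in \<open>auto simp: T_def U_def split: split_indicator\<close>)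
        moreover have "((\<lambda>\<rho>. T (\<theta>, \<rho>) + U (\<theta>, \<rho>)) has_integral (\<integral>\<rho>. T (\<theta>, \<rho>) + U (\<theta>, \<rho>) \<partial>lborel)) UNIV"
          by (rule has_integral_integral_lborel[OF int])
        ultimately have "(\<integral>\<rho>. T (\<theta>, \<rho>) + U (\<theta>, \<rho>) \<partial>lborel) = f z" by (intro has_integral_unique)
        thus ?thesis using True by simp
      qed (auto simp: T_def U_def)
    qed
  qed auto
  also have "\<dots> = 2 * pi * f z" by simp
  finally have "2 * pi * f z = (\<integral>x. T x \<partial>(lborel \<Otimes>\<^sub>M lborel)) + (\<integral>x. U x \<partial>(lborel \<Otimes>\<^sub>M lborel))"
    by (subst (asm) Bochner_Integration.integral_add[OF T U]) simp
  thus ?thesis using int_U int_G unfolding G_def by simp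
qed

end

section \<open>Linear statistics as integrals against the Laplacian\<close>

lemma integrable_cball_continuous:
  fixes g :: "complex \<Rightarrow> real"
  assumes "continuous_on UNIV g"
  shows "integrable lborel (\<lambda>w. indicator (cball z R) w * g w)"
    and "integrable lborel (\<lambda>w. indicator (ball z R) w * g w)"
proof -
  show *: "integrable lborel (\<lambda>w. indicator (cball z R) w * g w)"
    using borel_integrable_compact[of "cball z R" g] continuous_on_subset[OF assms]
    by (simp add: indicator_def)
  have "ball z R \<in> sets lborel" by simp
  from integrable_mult_indicator[OF this *]
  show "integrable lborel (\<lambda>w. indicator (ball z R) w * g w)"
    by (rule Bochner_Integration.integrable_cong[THEN iffD1, rotated 2]) (auto split: split_indicator)
qed

lemma integrable_continuous_mult_ln:
  fixes h :: "complex \<Rightarrow> real"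
  assumes h: "continuous_on UNIV h" and supp: "\<And>w. w \<notin> cball 0 r \<Longrightarrow> h w = 0"
  shows "integrable lborel (\<lambda>w. h w * ln (cmod (z - w)))"
proof -
  have [measurable]: "h \<in> borel_measurable borel" using h by (rule borel_measurable_continuous_onI)
  have "compact (h ` cball 0 r)"
    by (intro compact_continuous_image continuous_on_subset[OF h]) auto
  then obtain B where "\<And>u. u \<in> h ` cball 0 r \<Longrightarrow> norm u \<le> B"
    using compact_imp_bounded bounded_iff by metis
  hence B: "\<bar>h w\<bar> \<le> B" if "w \<in> cball 0 r" for w using that by force
  have int: "integrable lborel (\<lambda>w. B * \<bar>indicator (cball 0 r) w * ln (cmod (z - w))\<bar>)"
    by (intro integrable_mult_right integrable_abs integrable_ln_cball)
  show ?thesis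
  proof (rule Bochner_Integration.integrable_bound[OF int])
    show "AE w in lborel. norm (h w * ln (cmod (z - w))) \<le> norm (B * \<bar>indicator (cball 0 r) w * ln (cmod (z - w))\<bar>)"
    proof (intro AE_I2)
      fix w
      show "norm (h w * ln (cmod (z - w))) \<le> norm (B * \<bar>indicator (cball 0 r) w * ln (cmod (z - w))\<bar>)"
        using B[of w] supp[of w] by (cases "w \<in> cball 0 r") (auto simp: abs_mult intro!: mult_right_mono)
    qed
  qed measurable
qed

abbreviation disk_integral :: "(complex \<Rightarrow> real) \<Rightarrow> complex \<Rightarrow> real \<Rightarrow> real" where
  "disk_integral f z R \<equiv> \<integral>w. indicator (ball z R) w * f w \<partial>lborel"

abbreviation log_potential :: "(complex \<Rightarrow> real) \<Rightarrow> complex \<Rightarrow> real" where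
  "log_potential f z \<equiv> \<integral>w. laplacian f w * ln (cmod (z - w)) \<partial>lborel"

text \<open>\<open>f = o(|z|)\<close> and the symmetric difference of the two disks has area \<open>O(R)\<close>.\<close>

lemma disk_averages_close:
  assumes f: "continuous_on UNIV f" and o: "no_harmonic_part f" and \<epsilon>: "0 < \<epsilon>"
  shows "\<forall>\<^sub>F R in at_top. \<bar>2 / R\<^sup>2 * (disk_integral f z R - disk_integral f 0 R)\<bar> \<le> \<epsilon>"
proof -
  \<comment> \<open>The symmetric difference lies in an annulus of area
    \<open>4 * pi * R * cmod z\<close>, on which \<open>|f|\<close> is at most
    \<open>2 * \<delta> * R\<close>; together with the factor \<open>2 / R^2\<close> this gives 16.
    The summand 1 keeps the denominator positive at \<open>z = 0\<close>.\<close>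
  define \<delta> where "\<delta> = \<epsilon> / (16 * pi * (cmod z + 1))"
  have "0 < 16 * pi * (cmod z + 1)" by (intro mult_pos_pos) (auto intro: add_nonneg_pos)
  hence \<delta>: "0 < \<delta>" unfolding \<delta>_def using \<epsilon> by (intro divide_pos_pos)
  have "\<forall>\<^sub>F w in at_infinity. norm (f w) \<le> \<delta> * norm (cmod w)"
    using landau_o.smallD[OF o[unfolded no_harmonic_part_def] \<delta>] .
  then obtain R0 where R0: "\<And>w. R0 \<le> cmod w \<Longrightarrow> \<bar>f w\<bar> \<le> \<delta> * cmod w"
    by (auto simp: eventually_at_infinity)
  have "\<forall>\<^sub>F R in at_top. max (cmod z + 1) (R0 + cmod z) \<le> R" by (rule eventually_ge_at_top)
  thus ?thesis
  proof eventually_elim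
    fix R assume R: "max (cmod z + 1) (R0 + cmod z) \<le> R"
    have R1: "cmod z \<le> R" "0 < R" "R0 \<le> R - cmod z" using R by auto (use norm_ge_zero[of z] in linarith)
    define A where "A = ball 0 (R + cmod z) - ball (0::complex) (R - cmod z)"
    have A: "A \<in> sets lborel" "emeasure lborel A < \<infinity>"
      using emeasure_mono[of A "ball 0 (R + cmod z)" lborel] emeasure_lborel_ball_finite[of "0::complex" "R + cmod z"]
      by (auto simp: A_def)
    have mA: "measure lborel A = 4 * pi * R * cmod z"
    proof -
      have "measure lborel A = measure lborel (ball (0::complex) (R + cmod z)) - measure lborel (ball (0::complex) (R - cmod z))"
        unfolding A_def using R1 emeasure_lborel_ball_finite[of "0::complex"]
          subset_ball[of "R - cmod z" "R + cmod z" "0::complex"]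
        by (intro measure_Diff) (auto simp: less_top)
      also have "\<dots> = pi * (R + cmod z)\<^sup>2 - pi * (R - cmod z)\<^sup>2"
        using R1 by (simp add: content_ball DIM_complex unit_ball_vol_2)
      finally show ?thesis by (simp add: power2_eq_square algebra_simps)
    qed
    have int: "integrable lborel (\<lambda>w. indicator (ball z R) w * f w)" "integrable lborel (\<lambda>w. indicator (ball 0 R) w * f w)"
      by (intro integrable_cball_continuous f)+
    have iA: "integrable lborel (indicator A :: complex \<Rightarrow> real)"
      using A by (intro integrable_real_indicator)
    have "\<bar>disk_integral f z R - disk_integral f 0 R\<bar>
       = \<bar>\<integral>w. indicator (ball z R) w * f w - indicator (ball 0 R) w * f w \<partial>lborel\<bar>"
      using int by simp
    also have "\<dots> \<le> (\<integral>w. \<bar>indicator (ball z R) w * f w - indicator (ball 0 R) w * f w\<bar> \<partial>lborel)"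
      by (rule integral_abs_bound)
    also have "\<dots> \<le> (\<integral>w. \<delta> * (R + cmod z) * indicator A w \<partial>lborel)"
    proof (rule integral_mono)
      show "integrable lborel (\<lambda>w. \<bar>indicator (ball z R) w * f w - indicator (ball 0 R) w * f w\<bar>)"
        using int by (intro integrable_abs Bochner_Integration.integrable_diff)
      show "integrable lborel (\<lambda>w. \<delta> * (R + cmod z) * indicator A w)"
        using iA by (intro integrable_mult_right)
      fix w
      show "\<bar>indicator (ball z R) w * f w - indicator (ball 0 R) w * f w\<bar> \<le> \<delta> * (R + cmod z) * indicator A w"
      proof (cases "w \<in> ball z R \<longleftrightarrow> w \<in> ball 0 R")
        case True
        thus ?thesis using \<delta> R1 by (auto split: split_indicator)
      next
        case False
        have "cmod w \<le> cmod z + dist z w" "cmod w \<ge> dist z w - cmod z"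
          using norm_triangle_ineq2[of w z] norm_triangle_ineq4[of z w] by (auto simp: dist_norm norm_minus_commute)
        with False R1 have w: "w \<in> A" by (auto simp: A_def)
        hence "R0 \<le> cmod w" "cmod w \<le> R + cmod z" using R1 by (auto simp: A_def)
        hence "\<bar>f w\<bar> \<le> \<delta> * (R + cmod z)"
          using R0[of w] \<delta> mult_left_mono[of "cmod w" "R + cmod z" \<delta>] by linarith
        thus ?thesis using w False by (auto split: split_indicator)
      qed
    qed
    also have "\<dots> = \<delta> * (R + cmod z) * (4 * pi * R * cmod z)" using A mA by simp
    also have "\<dots> \<le> \<delta> * (R + R) * (4 * pi * R * (cmod z + 1))"
      using \<delta> R1 by (intro mult_mono) auto
    also have "\<dots> = R\<^sup>2 / 2 * \<epsilon>"
    proof -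
      define t where "t = cmod z + 1"
      have "t \<noteq> 0" unfolding t_def using norm_ge_zero[of z] by linarith
      thus ?thesis unfolding \<delta>_def t_def[symmetric] by (simp add: field_simps power2_eq_square)
    qed
    finally have *: "\<bar>disk_integral f z R - disk_integral f 0 R\<bar> \<le> R\<^sup>2 / 2 * \<epsilon>" .
    have "\<bar>2 / R\<^sup>2 * (disk_integral f z R - disk_integral f 0 R)\<bar> \<le> 2 / R\<^sup>2 * (R\<^sup>2 / 2 * \<epsilon>)"
      unfolding abs_mult using * R1 by (intro mult_mono) auto
    thus "\<bar>2 / R\<^sup>2 * (disk_integral f z R - disk_integral f 0 R)\<bar> \<le> \<epsilon>"
      using R1 by simp
  qed
qed

text \<open>\<open>(|w|^2 - 1) / 2\<close> is the logarithmic potential of the circular law inside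
  the unit disk. Outside, that potential is \<open>ln |w|\<close>, so this is a centring only on the
  disk, which contains the supports of the Laplacians.\<close>

definition log_field :: "nat \<Rightarrow> (nat \<Rightarrow> complex) \<Rightarrow> complex \<Rightarrow> real" where
  "log_field N x w = (\<Sum>j<N. ln (cmod (x j - w))) - real N * (((cmod w)\<^sup>2 - 1) / 2)"

context
  fixes f :: "complex \<Rightarrow> real" and r :: real
  assumes f: "C2_complex f" and supp: "\<And>w. w \<notin> cball 0 r \<Longrightarrow> laplacian f w = 0"
begin

private lemma int_cont: "continuous_on UNIV g \<Longrightarrow> integrable lborel (\<lambda>w. laplacian f w * g w)"
proof -
  assume g: "continuous_on UNIV g"
  have "integrable lborel (\<lambda>w. indicator (cball 0 r) w * (laplacian f w * g w))"
    by (intro integrable_cball_continuous continuous_on_mult g C2_laplacian_continuous f)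
  also have "(\<lambda>w. indicator (cball 0 r) w * (laplacian f w * g w)) = (\<lambda>w. laplacian f w * g w)"
    using supp by (auto simp: fun_eq_iff split: split_indicator)
  finally show ?thesis .
qed

lemma integrable_laplacian: "integrable lborel (laplacian f)"
  using int_cont[of "\<lambda>_. 1"] by simp

lemma integrable_laplacian_mult_ln: "integrable lborel (\<lambda>w. laplacian f w * ln (cmod (z - w)))"
  using C2_laplacian_continuous[OF f] supp by (rule integrable_continuous_mult_ln)

lemma integrable_laplacian_mult_square: "integrable lborel (\<lambda>w. laplacian f w * (cmod (z - w))\<^sup>2)"
  by (intro int_cont continuous_intros)

text \<open>\<open>R\<close> is so large that the disk contains the support of the Laplacian, so the
  kernel splits into its summands. The divergent \<open>ln R\<close> multiplies only the total mass
  of the Laplacian; it is the same for every \<open>z\<close> and drops out of differences.\<close>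

lemma integral_disk_supp:
  assumes "cmod z + r < R" "0 < R"
  shows "2 * pi * f z - log_potential f z =
     2 / R\<^sup>2 * disk_integral f z R - (ln R - 1 / 2) * (\<integral>w. laplacian f w \<partial>lborel)
     - 1 / (2 * R\<^sup>2) * (\<integral>w. laplacian f w * (cmod (z - w))\<^sup>2 \<partial>lborel)"
proof -
  have ball: "w \<in> ball z R" if "laplacian f w \<noteq> 0" for w
  proof -
    have "w \<in> cball 0 r" using that supp by blast
    thus ?thesis using assms norm_triangle_ineq4[of z w] by (simp add: dist_norm)
  qed
  have eq: "indicator (ball z R) w * (2 / R\<^sup>2 * f w - ball_kernel R (cmod (z - w)) * laplacian f w) =
     2 / R\<^sup>2 * (indicator (ball z R) w * f w) - (ln R - 1 / 2) * laplacian f w + laplacian f w * ln (cmod (z - w))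
       - 1 / (2 * R\<^sup>2) * (laplacian f w * (cmod (z - w))\<^sup>2)" for w
  proof (cases "laplacian f w = 0")
    case False
    thus ?thesis using ball[OF False] by (simp add: ball_kernel_def algebra_simps)
  qed auto
  have i1: "integrable lborel (\<lambda>w. 2 / R\<^sup>2 * (indicator (ball z R) w * f w))"
    by (intro integrable_mult_right integrable_cball_continuous C2_continuous f)
  have i2: "integrable lborel (\<lambda>w. (ln R - 1 / 2) * laplacian f w)"
    by (intro integrable_mult_right integrable_laplacian)
  have i3: "integrable lborel (\<lambda>w. 1 / (2 * R\<^sup>2) * (laplacian f w * (cmod (z - w))\<^sup>2))"
    by (intro integrable_mult_right integrable_laplacian_mult_square)
  note i4 = integrable_laplacian_mult_ln[of z]
  have "2 * pi * f z = (\<integral>w. 2 / R\<^sup>2 * (indicator (ball z R) w * f w) - (ln R - 1 / 2) * laplacian f w + laplacian f w * ln (cmod (z - w))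
       - 1 / (2 * R\<^sup>2) * (laplacian f w * (cmod (z - w))\<^sup>2) \<partial>lborel)"
    using integral_disk[OF f assms(2), of z] unfolding eq by simp
  also have "\<dots> = (\<integral>w. 2 / R\<^sup>2 * (indicator (ball z R) w * f w) \<partial>lborel) - (\<integral>w. (ln R - 1 / 2) * laplacian f w \<partial>lborel)
      + log_potential f z - (\<integral>w. 1 / (2 * R\<^sup>2) * (laplacian f w * (cmod (z - w))\<^sup>2) \<partial>lborel)"
    using i1 i2 i3 i4
    by (simp only: Bochner_Integration.integral_diff Bochner_Integration.integral_add
          Bochner_Integration.integrable_diff Bochner_Integration.integrable_add)
  finally show ?thesis by (simp only: integral_mult_right_zero)
qed

text \<open>A Liouville argument: the harmonic function \<open>2 \<pi> f - \<integral> \<Delta> f(w) ln |\<sqdot> - w|\<close> is a limit of disk averages, up to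
  a term that depends only on the radius.\<close>

lemma log_potential_constant:
  assumes "no_harmonic_part f"
  shows "2 * pi * f z - log_potential f z =
         2 * pi * f 0 - log_potential f 0" (is "?H z = ?H 0")
proof -
  define Q where "Q = (\<lambda>z. \<integral>w. laplacian f w * (cmod (z - w))\<^sup>2 \<partial>lborel)"
  have "\<bar>?H z - ?H 0\<bar> \<le> \<epsilon>" if \<epsilon>: "0 < \<epsilon>" for \<epsilon>
  proof -
    have lim: "((\<lambda>R. \<epsilon> / 2 + 1 / (2 * R\<^sup>2) * \<bar>Q z - Q 0\<bar>) \<longlongrightarrow> \<epsilon> / 2) at_top"
      by real_asymp
    have "\<forall>\<^sub>F R in at_top. \<bar>?H z - ?H 0\<bar> \<le> \<epsilon> / 2 + 1 / (2 * R\<^sup>2) * \<bar>Q z - Q 0\<bar>"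
      using disk_averages_close[OF C2_continuous[OF f] assms half_gt_zero[OF \<epsilon>], of z] eventually_gt_at_top[of "cmod z + r"]
        eventually_gt_at_top[of r] eventually_gt_at_top[of 0]
    proof eventually_elim
      fix R assume R: "\<bar>2 / R\<^sup>2 * (disk_integral f z R - disk_integral f 0 R)\<bar> \<le> \<epsilon> / 2"
        "cmod z + r < R" "r < R" "0 < R"
      have "?H z - ?H 0 = 2 / R\<^sup>2 * (disk_integral f z R - disk_integral f 0 R)
          - 1 / (2 * R\<^sup>2) * (Q z - Q 0)"
        using integral_disk_supp[of z R] integral_disk_supp[of 0 R] R unfolding Q_def
        by (simp add: algebra_simps)
      moreover have "\<bar>1 / (2 * R\<^sup>2) * (Q z - Q 0)\<bar> = 1 / (2 * R\<^sup>2) * \<bar>Q z - Q 0\<bar>"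
        by (simp add: abs_mult)
      ultimately show "\<bar>?H z - ?H 0\<bar> \<le> \<epsilon> / 2 + 1 / (2 * R\<^sup>2) * \<bar>Q z - Q 0\<bar>" using R(1) by linarith
    qed
    hence "\<bar>?H z - ?H 0\<bar> \<le> \<epsilon> / 2" by (rule tendsto_lowerbound[OF lim]) simp
    thus ?thesis using \<epsilon> by simp
  qed
  hence "\<bar>?H z - ?H 0\<bar> \<le> 0" by (rule field_le_epsilon[of _ 0, simplified])
  thus ?thesis by simp
qed

lemma integrable_laplacian_mult_log_field:
  "integrable lborel (\<lambda>w. laplacian f w * log_field N x w)"
proof -
  have "integrable lborel (\<lambda>w. (\<Sum>j<N. laplacian f w * ln (cmod (x j - w))) - laplacian f w * (real N * (((cmod w)\<^sup>2 - 1) / 2)))"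
    by (intro Bochner_Integration.integrable_diff Bochner_Integration.integrable_sum integrable_laplacian_mult_ln int_cont continuous_intros) auto
  thus ?thesis by (simp add: log_field_def right_diff_distrib sum_distrib_left)
qed

text \<open>The unknown constant \<open>c\<close> enters the sum over the points and its centring
  with the same weight \<open>N\<close> and cancels. What remains pairs the Laplacian with the
  potentials of the points minus \<open>N\<close> times that of the circular law.\<close>

lemma lin_stat_eq_integral_log_field:
  assumes "no_harmonic_part f" "r < 1"
  shows "lin_stat N x f = 1 / (2 * pi) * (\<integral>w. laplacian f w * log_field N x w \<partial>lborel)"
proof -
  define c where "c = 2 * pi * f 0 - log_potential f 0"
  have fz: "f z = 1 / (2 * pi) * (c + log_potential f z)" for z
    using log_potential_constant[OF assms(1), of z] unfolding c_def by (simp add: field_simps)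
  have i0: "integrable lborel (\<lambda>w. laplacian f w * (((cmod w)\<^sup>2 - 1) / 2))"
    by (intro int_cont continuous_intros) auto
  have "(\<integral>w. laplacian f w * (((cmod w)\<^sup>2 - 1) / 2) \<partial>lborel) =
      (\<integral>w. 1 / 2 * (laplacian f w * (cmod (0 - w))\<^sup>2) - 1 / 2 * laplacian f w \<partial>lborel)"
    by (intro Bochner_Integration.integral_cong) (auto simp: right_diff_distrib diff_divide_distrib)
  also have "\<dots> = 1 / 2 * (\<integral>w. laplacian f w * (cmod (0 - w))\<^sup>2 \<partial>lborel) - 1 / 2 * (\<integral>w. laplacian f w \<partial>lborel)"
    using integrable_laplacian integrable_laplacian_mult_square[of 0]
    by (subst Bochner_Integration.integral_diff) (simp_all only: integrable_mult_right integral_mult_right_zero)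
  \<comment> \<open>The disk formula at centre 0 and radius 1, where \<open>ln R = 0\<close>; its
    terms \<open>1/2\<close> and \<open>|w|^2 / 2\<close> assemble the potential of the circular
    law.\<close>
  finally have "2 * (\<integral>w. indicator (ball 0 1) w * f w \<partial>lborel) = c + (\<integral>w. laplacian f w * (((cmod w)\<^sup>2 - 1) / 2) \<partial>lborel)"
    using integral_disk_supp[of 0 1] assms(2) unfolding c_def by (simp add: diff_divide_distrib)
  moreover have "(\<integral>z. f z \<partial>circular_law) = 1 / pi * (\<integral>w. indicator (ball 0 1) w * f w \<partial>lborel)"
  proof -
    have [measurable]: "f \<in> borel_measurable borel"
      using C2_continuous[OF f] by (rule borel_measurable_continuous_onI)
    have [measurable]: "ball (0::complex) 1 \<in> sets borel" by simp
    have "(\<integral>z. f z \<partial>circular_law) = (\<integral>w. (indicator (ball 0 1) w / pi) * f w \<partial>lborel)"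
      unfolding circular_law_def by (subst integral_real_density) (auto split: split_indicator)
    also have "\<dots> = (\<integral>w. 1 / pi * (indicator (ball 0 1) w * f w) \<partial>lborel)" by simp
    finally show ?thesis by (simp only: integral_mult_right_zero)
  qed
  ultimately have circ: "(\<integral>z. f z \<partial>circular_law) = 1 / (2 * pi) * (c + (\<integral>w. laplacian f w * (((cmod w)\<^sup>2 - 1) / 2) \<partial>lborel))"
    by (simp add: field_simps)
  define S where "S = (\<Sum>j<N. \<integral>w. laplacian f w * ln (cmod (x j - w)) \<partial>lborel)"
  define I where "I = (\<integral>w. laplacian f w * (((cmod w)\<^sup>2 - 1) / 2) \<partial>lborel)"
  have "(\<integral>w. laplacian f w * log_field N x w \<partial>lborel) =
     (\<integral>w. (\<Sum>j<N. laplacian f w * ln (cmod (x j - w))) - real N * (laplacian f w * (((cmod w)\<^sup>2 - 1) / 2)) \<partial>lborel)"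
    by (simp add: log_field_def right_diff_distrib sum_distrib_left mult_ac)
  also have "\<dots> = (\<Sum>j<N. \<integral>w. laplacian f w * ln (cmod (x j - w)) \<partial>lborel) - real N * (\<integral>w. laplacian f w * (((cmod w)\<^sup>2 - 1) / 2) \<partial>lborel)"
    using i0 integrable_laplacian_mult_ln
    by (subst Bochner_Integration.integral_diff)
       (simp_all only: Bochner_Integration.integrable_sum integrable_mult_right integral_mult_right_zero Bochner_Integration.integral_sum)
  finally have eq: "(\<integral>w. laplacian f w * log_field N x w \<partial>lborel) = S - real N * I"
    unfolding S_def I_def .
  have "(\<Sum>j<N. f (x j)) = (\<Sum>j<N. 1 / (2 * pi) * (c + log_potential f (x j)))"
    by (intro sum.cong refl fz)
  also have "\<dots> = 1 / (2 * pi) * (real N * c + S)"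
    by (simp only: sum_distrib_left[symmetric] sum.distrib S_def) simp
  finally show ?thesis
    unfolding lin_stat_def circ eq I_def[symmetric] by (simp only: right_diff_distrib distrib_left) simp
qed

end

section \<open>Jensen's inequality, uniformly over the test functions\<close>

lemma log_field_measurable [measurable]: "log_field N x \<in> borel_measurable borel"
  unfolding log_field_def by measurable

lemma exp_mult_le_one: "exp a * (1 - a) \<le> (1::real)"
proof -
  have "exp a * (1 - a) \<le> exp a * exp (- a)"
    using exp_ge_add_one_self[of "- a"] by (intro mult_left_mono) auto
  thus ?thesis by (simp add: exp_minus)
qed

text \<open>The summand 1 compensates for the mass missing from the sub-probability density \<open>\<rho>\<close>.\<close>

lemma exp_integral_le:
  fixes \<rho> g :: "'a \<Rightarrow> real"
  assumes [measurable]: "\<rho> \<in> borel_measurable M" "g \<in> borel_measurable M"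
    and \<rho>: "\<And>x. 0 \<le> \<rho> x" "integrable M \<rho>" "(\<integral>x. \<rho> x \<partial>M) \<le> 1"
    and g: "\<And>x. 0 \<le> g x" "integrable M (\<lambda>x. \<rho> x * g x)"
  shows "ennreal (exp (\<integral>x. \<rho> x * g x \<partial>M)) \<le> 1 + (\<integral>\<^sup>+x. ennreal (\<rho> x * exp (g x)) \<partial>M)"
proof -
  define a where "a = (\<integral>x. \<rho> x * g x \<partial>M)"
  define m where "m = (\<integral>x. \<rho> x \<partial>M)"
  have m: "0 \<le> m" "m \<le> 1" unfolding m_def using \<rho> by (auto intro: Bochner_Integration.integral_nonneg)
  show ?thesis
  proof (cases "(\<integral>\<^sup>+x. ennreal (\<rho> x * exp (g x)) \<partial>M) = \<infinity>")
    case False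
    hence int: "integrable M (\<lambda>x. \<rho> x * exp (g x))"
      using \<rho>(1) by (intro integrableI_nonneg) (auto simp: less_top)
    have "exp a * (m * (1 - a) + a) = (\<integral>x. exp a * ((1 - a) * \<rho> x + \<rho> x * g x) \<partial>M)"
      using \<rho>(2) g(2) unfolding a_def m_def by (simp add: mult.commute)
    also have "\<dots> \<le> (\<integral>x. \<rho> x * exp (g x) \<partial>M)"
    proof (rule integral_mono)
      show "integrable M (\<lambda>x. exp a * ((1 - a) * \<rho> x + \<rho> x * g x))"
        using \<rho>(2) g(2) by simp
      fix x
      \<comment> \<open>The tangent of \<open>exp\<close> at \<open>a\<close>. Integrated against
        total mass \<open>m\<close>, it falls short of \<open>exp a\<close> by
        \<open>exp a * (1 - a) * (1 - m)\<close>, which is at most 1.\<close>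
      have "exp a * (1 + (g x - a)) \<le> exp a * exp (g x - a)"
        by (intro mult_left_mono exp_ge_add_one_self) auto
      also have "\<dots> = exp (g x)" by (simp flip: exp_add)
      finally have "\<rho> x * (exp a * (1 + (g x - a))) \<le> \<rho> x * exp (g x)"
        using \<rho>(1) by (intro mult_left_mono)
      thus "exp a * ((1 - a) * \<rho> x + \<rho> x * g x) \<le> \<rho> x * exp (g x)"
        by (simp add: algebra_simps)
    qed (use int in auto)
    finally have *: "exp a * (m * (1 - a) + a) \<le> (\<integral>x. \<rho> x * exp (g x) \<partial>M)" .
    have "exp a - exp a * (m * (1 - a) + a) = (exp a * (1 - a)) * (1 - m)"
      by (simp add: algebra_simps)
    also have "\<dots> \<le> 1 * (1 - m)" using m exp_mult_le_one by (intro mult_right_mono) auto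
    also have "\<dots> \<le> 1" using m by simp
    finally have "exp a \<le> 1 + (\<integral>x. \<rho> x * exp (g x) \<partial>M)" using * by linarith
    hence "ennreal (exp a) \<le> ennreal (1 + (\<integral>x. \<rho> x * exp (g x) \<partial>M))" by (rule ennreal_leI)
    also have "\<dots> = 1 + ennreal (\<integral>x. \<rho> x * exp (g x) \<partial>M)"
      using \<rho>(1) by (subst ennreal_plus) (auto intro!: Bochner_Integration.integral_nonneg)
    also have "ennreal (\<integral>x. \<rho> x * exp (g x) \<partial>M) = (\<integral>\<^sup>+x. ennreal (\<rho> x * exp (g x)) \<partial>M)"
      using int \<rho>(1) by (intro nn_integral_eq_integral[symmetric]) auto
    finally show ?thesis by (simp add: a_def)
  qed simp
qed

text \<open>No test function occurs here, so a bound by this quantity survives the supremum. Values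
  in \<open>ennreal\<close> are convenient because the integral is infinite when many points
  coincide.\<close>

definition exp_field_integral :: "real \<Rightarrow> nat \<Rightarrow> (nat \<Rightarrow> complex) \<Rightarrow> ennreal" where
  "exp_field_integral r N x = (\<integral>\<^sup>+w. indicator (cball 0 r) w * ennreal (exp (\<bar>log_field N x w\<bar> / 2)) \<partial>lborel)"

text \<open>The prefactor \<open>1 / (2 * pi)\<close> is shared out: \<open>1 / pi\<close> turns
  \<open>|laplacian f|\<close> into a density of mass at most 1, and \<open>1 / 2\<close> goes into
  the exponent. The pointwise bound on the Laplacian is applied after Jensen's inequality, outside
  the exponential, and so costs a mere factor \<open>N powr \<kappa> / pi\<close>.\<close>

lemma exp_lin_stat_le:
  assumes f: "f \<in> test_class N r \<kappa>" "no_harmonic_part f" and r: "r < 1"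
    and mass: "(LINT z:ball 0 1|lborel. \<bar>laplacian f z\<bar> / pi) \<le> 1"
  shows "ennreal (exp \<bar>lin_stat N x f\<bar>) \<le> 1 + ennreal (real N powr \<kappa> / pi) * exp_field_integral r N x"
proof -
  have C2: "C2_complex f" and supp: "\<And>w. w \<notin> cball 0 r \<Longrightarrow> laplacian f w = 0"
    and bd: "\<And>w. \<bar>laplacian f w\<bar> \<le> real N powr \<kappa>"
    using f(1) by (auto simp: test_class_def)
  define \<rho> where "\<rho> = (\<lambda>w. \<bar>laplacian f w\<bar> / pi)"
  define g where "g = (\<lambda>w. \<bar>log_field N x w\<bar> / 2)"
  have [measurable]: "laplacian f \<in> borel_measurable borel"
    using C2_laplacian_continuous[OF C2] by (rule borel_measurable_continuous_onI)
  have [measurable]: "\<rho> \<in> borel_measurable borel" "g \<in> borel_measurable borel"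
    unfolding \<rho>_def g_def by measurable
  have int: "integrable lborel (\<lambda>w. laplacian f w * log_field N x w)"
    by (rule integrable_laplacian_mult_log_field[OF C2 supp])
  have \<rho>g: "\<rho> w * g w = 1 / (2 * pi) * \<bar>laplacian f w * log_field N x w\<bar>" for w
    by (simp add: \<rho>_def g_def abs_mult)
  have "(\<integral>w. \<rho> w \<partial>lborel) = (LINT z:ball 0 1|lborel. \<bar>laplacian f z\<bar> / pi)"
    unfolding set_lebesgue_integral_def
  proof (intro Bochner_Integration.integral_cong refl)
    fix w
    show "\<rho> w = indicat_real (ball 0 1) w *\<^sub>R (\<bar>laplacian f w\<bar> / pi)"
      using supp[of w] r by (auto simp: \<rho>_def split: split_indicator)
  qed
  hence \<rho>1: "(\<integral>w. \<rho> w \<partial>lborel) \<le> 1" using mass by simp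
  have "\<bar>lin_stat N x f\<bar> = 1 / (2 * pi) * \<bar>\<integral>w. laplacian f w * log_field N x w \<partial>lborel\<bar>"
    by (subst lin_stat_eq_integral_log_field[OF C2 supp f(2) r]) (auto simp: abs_mult)
  also have "\<dots> \<le> 1 / (2 * pi) * (\<integral>w. \<bar>laplacian f w * log_field N x w\<bar> \<partial>lborel)"
    by (intro mult_left_mono integral_abs_bound) auto
  also have "\<dots> = (\<integral>w. \<rho> w * g w \<partial>lborel)" unfolding \<rho>g by simp
  finally have "ennreal (exp \<bar>lin_stat N x f\<bar>) \<le> ennreal (exp (\<integral>w. \<rho> w * g w \<partial>lborel))"
    by (intro ennreal_leI) simp
  also have "\<dots> \<le> 1 + (\<integral>\<^sup>+w. ennreal (\<rho> w * exp (g w)) \<partial>lborel)"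
  proof (rule exp_integral_le)
    show "integrable lborel \<rho>" unfolding \<rho>_def
      using integrable_laplacian[OF C2 supp] by simp
    show "integrable lborel (\<lambda>w. \<rho> w * g w)" unfolding \<rho>g
      using int by (intro integrable_mult_right integrable_abs)
  qed (auto simp: \<rho>1, auto simp: \<rho>_def g_def)
  also have "(\<integral>\<^sup>+w. ennreal (\<rho> w * exp (g w)) \<partial>lborel)
      \<le> (\<integral>\<^sup>+w. ennreal (real N powr \<kappa> / pi) * (indicator (cball 0 r) w * ennreal (exp (\<bar>log_field N x w\<bar> / 2))) \<partial>lborel)"
  proof (intro nn_integral_mono)
    fix w
    show "ennreal (\<rho> w * exp (g w)) \<le> ennreal (real N powr \<kappa> / pi) * (indicator (cball 0 r) w * ennreal (exp (\<bar>log_field N x w\<bar> / 2)))"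
    proof (cases "w \<in> cball 0 r")
      case True
      have "\<rho> w * exp (g w) \<le> real N powr \<kappa> / pi * exp (g w)"
        unfolding \<rho>_def using bd[of w] by (intro mult_right_mono divide_right_mono) auto
      thus ?thesis using True by (auto simp: g_def ennreal_leI simp flip: ennreal_mult)
    qed (auto simp: \<rho>_def supp)
  qed
  also have "\<dots> = ennreal (real N powr \<kappa> / pi) * exp_field_integral r N x"
    unfolding exp_field_integral_def
  proof (rule nn_integral_cmult)
    have [measurable]: "cball (0::complex) r \<in> sets borel" by auto
    show "(\<lambda>w. indicator (cball 0 r) w * ennreal (exp (\<bar>log_field N x w\<bar> / 2))) \<in> borel_measurable lborel"
      by measurable
  qed
  finally show ?thesis by (simp add: add_left_mono)
qed

section \<open>Determinantal integrals\<close>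

text \<open>The squared norm of \<open>z ^ k\<close> for the weight
  \<open>exp (- t |z|^2)\<close>.\<close>

definition gauss_moment :: "real \<Rightarrow> nat \<Rightarrow> real" where
  "gauss_moment t k = pi * fact k / t ^ Suc k"

lemma gauss_moment_pos: "0 < t \<Longrightarrow> 0 < gauss_moment t k"
  by (simp add: gauss_moment_def)

lemma nn_integral_gauss_moment:
  assumes t: "0 < t"
  shows "(\<integral>\<^sup>+z. ennreal (cmod z ^ (2 * k) * exp (- t * (cmod z)\<^sup>2)) \<partial>lborel) = ennreal (gauss_moment t k)"
proof -
  \<comment> \<open>Minus the tail of the radial integral: repeated integration by parts expresses
    the incomplete Gamma function as \<open>exp\<close> times a truncated exponential series, and
    the derivative telescopes to the top term.\<close>
  define F where "F = (\<lambda>s. - gauss_moment t k * (exp (- t * s\<^sup>2) * (\<Sum>i\<le>k. (t * s\<^sup>2) ^ i / fact i)))"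
  have F': "(F has_real_derivative 2 * pi * s * (s ^ (2 * k) * exp (- t * s\<^sup>2))) (at s)" for s
  proof -
    have "((\<lambda>s. \<Sum>i\<le>k. (t * s\<^sup>2) ^ i / fact i) has_real_derivative 2 * t * s * (\<Sum>i<k. (t * s\<^sup>2) ^ i / fact i)) (at s)"
    proof (induction k)
      case (Suc k)
      have "((\<lambda>s. (t * s\<^sup>2) ^ Suc k / fact (Suc k)) has_real_derivative 2 * t * s * ((t * s\<^sup>2) ^ k / fact k)) (at s)"
        by (rule derivative_eq_intros refl | simp)+
      from DERIV_add[OF Suc this] show ?case by (simp add: distrib_left lessThan_Suc_atMost[symmetric])
    qed simp
    moreover have "((\<lambda>s. exp (- t * s\<^sup>2)) has_real_derivative - 2 * t * s * exp (- t * s\<^sup>2)) (at s)"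
      by (auto intro!: derivative_eq_intros)
    ultimately have "((\<lambda>s. exp (- t * s\<^sup>2) * (\<Sum>i\<le>k. (t * s\<^sup>2) ^ i / fact i)) has_real_derivative
       - 2 * t * s * exp (- t * s\<^sup>2) * (\<Sum>i\<le>k. (t * s\<^sup>2) ^ i / fact i)
       + 2 * t * s * (\<Sum>i<k. (t * s\<^sup>2) ^ i / fact i) * exp (- t * s\<^sup>2)) (at s)"
      by (rule DERIV_mult[rotated])
    also have "- 2 * t * s * exp (- t * s\<^sup>2) * (\<Sum>i\<le>k. (t * s\<^sup>2) ^ i / fact i)
       + 2 * t * s * (\<Sum>i<k. (t * s\<^sup>2) ^ i / fact i) * exp (- t * s\<^sup>2) = - 2 * t * s * exp (- t * s\<^sup>2) * ((t * s\<^sup>2) ^ k / fact k)"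
      by (simp add: lessThan_Suc_atMost[symmetric] algebra_simps)
    finally have "(F has_real_derivative - gauss_moment t k * (- 2 * t * s * exp (- t * s\<^sup>2) * ((t * s\<^sup>2) ^ k / fact k))) (at s)"
      unfolding F_def by (rule DERIV_cmult)
    also have "- gauss_moment t k * (- 2 * t * s * exp (- t * s\<^sup>2) * ((t * s\<^sup>2) ^ k / fact k)) = 2 * pi * s * (s ^ (2 * k) * exp (- t * s\<^sup>2))"
      using t by (simp add: gauss_moment_def power_mult_distrib power_mult[symmetric] field_simps)
    finally show ?thesis .
  qed
  have lim: "(F \<longlongrightarrow> 0) at_top"
  proof -
    have "((\<lambda>s. exp (- t * s\<^sup>2) * ((t * s\<^sup>2) ^ i / fact i)) \<longlongrightarrow> 0) at_top" for i :: nat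
    proof -
      have "((\<lambda>u. u ^ i / exp u) \<longlongrightarrow> (0::real)) at_top" by (rule tendsto_power_div_exp_0)
      moreover have "filterlim (\<lambda>s. t * s\<^sup>2) at_top at_top" using t by real_asymp
      ultimately have "((\<lambda>s. (t * s\<^sup>2) ^ i / exp (t * s\<^sup>2)) \<longlongrightarrow> 0) at_top" by (rule filterlim_compose)
      hence "((\<lambda>s. (t * s\<^sup>2) ^ i / exp (t * s\<^sup>2) / fact i) \<longlongrightarrow> 0 / fact i) at_top"
        by (intro tendsto_intros) auto
      thus ?thesis by (simp add: exp_minus field_simps)
    qed
    hence "((\<lambda>s. - gauss_moment t k * (\<Sum>i\<le>k. exp (- t * s\<^sup>2) * ((t * s\<^sup>2) ^ i / fact i))) \<longlongrightarrow> - gauss_moment t k * (\<Sum>i\<le>k. 0)) at_top"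
      by (intro tendsto_intros)
    thus ?thesis unfolding F_def by (simp add: sum_distrib_left)
  qed
  have "(\<integral>\<^sup>+z. ennreal (cmod z ^ (2 * k) * exp (- t * (cmod z)\<^sup>2)) \<partial>lborel)
      = (\<integral>\<^sup>+s. ennreal (2 * pi * s * indicator {0..} s) * ennreal (s ^ (2 * k) * exp (- t * s\<^sup>2)) \<partial>lborel)"
    by (rule nn_integral_radial) measurable
  also have "\<dots> = (\<integral>\<^sup>+s. ennreal (2 * pi * s * (s ^ (2 * k) * exp (- t * s\<^sup>2))) * indicator {0..} s \<partial>lborel)"
    by (intro nn_integral_cong) (auto simp flip: ennreal_mult split: split_indicator)
  also have "\<dots> = ennreal (0 - F 0)"
    using F' lim by (intro nn_integral_FTC_atLeast) auto
  also have "F 0 = - gauss_moment t k"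
    by (simp add: F_def power_0_left sum.delta' if_distrib[of "\<lambda>x. x / _"] cong: if_cong)
  finally show ?thesis by simp
qed

definition gauss_monom :: "real \<Rightarrow> nat \<Rightarrow> nat \<Rightarrow> complex \<Rightarrow> complex" where
  "gauss_monom t a b z = z ^ a * cnj z ^ b * of_real (exp (- t * (cmod z)\<^sup>2))"

lemma gauss_monom_measurable [measurable]: "gauss_monom t a b \<in> borel_measurable borel"
  unfolding gauss_monom_def[abs_def] by (intro borel_measurable_continuous_onI continuous_intros)

lemma integrable_gauss_monom:
  assumes t: "0 < t"
  shows "integrable lborel (gauss_monom t a b)"
proof (rule integrableI_bounded)
  have "(\<integral>\<^sup>+z. ennreal (norm (gauss_monom t a b z)) \<partial>lborel) \<le>
     (\<integral>\<^sup>+z. ennreal (cmod z ^ (2 * a) * exp (- t * (cmod z)\<^sup>2)) + ennreal (cmod z ^ (2 * b) * exp (- t * (cmod z)\<^sup>2)) \<partial>lborel)"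
  proof (intro nn_integral_mono)
    fix z
    have "0 \<le> (cmod z ^ a)\<^sup>2 + (cmod z ^ b)\<^sup>2 - 2 * (cmod z ^ a * cmod z ^ b)"
      using zero_le_power2[of "cmod z ^ a - cmod z ^ b"] by (simp add: power2_diff)
    moreover have "0 \<le> cmod z ^ a * cmod z ^ b" by simp
    ultimately have "cmod z ^ a * cmod z ^ b \<le> cmod z ^ (2 * a) + cmod z ^ (2 * b)"
      unfolding power_even_eq by linarith
    hence "cmod z ^ a * cmod z ^ b * exp (- t * (cmod z)\<^sup>2) \<le> (cmod z ^ (2 * a) + cmod z ^ (2 * b)) * exp (- t * (cmod z)\<^sup>2)"
      by (intro mult_right_mono) auto
    hence "ennreal (norm (gauss_monom t a b z)) \<le> ennreal (cmod z ^ (2 * a) * exp (- t * (cmod z)\<^sup>2) + cmod z ^ (2 * b) * exp (- t * (cmod z)\<^sup>2))"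
      by (intro ennreal_leI) (simp add: gauss_monom_def norm_mult norm_power distrib_right)
    also have "\<dots> = ennreal (cmod z ^ (2 * a) * exp (- t * (cmod z)\<^sup>2)) + ennreal (cmod z ^ (2 * b) * exp (- t * (cmod z)\<^sup>2))"
      by (rule ennreal_plus) auto
    finally show "ennreal (norm (gauss_monom t a b z)) \<le> \<dots>" .
  qed
  also have "\<dots> = ennreal (gauss_moment t a) + ennreal (gauss_moment t b)"
    by (subst nn_integral_add, measurable) (simp only: nn_integral_gauss_moment[OF t])
  also have "\<dots> < \<infinity>" by simp
  finally show "(\<integral>\<^sup>+z. ennreal (norm (gauss_monom t a b z)) \<partial>lborel) < \<infinity>" .
qed simp

lemma integral_gauss_monom:
  assumes t: "0 < t"
  shows "(\<integral>z. gauss_monom t a b z \<partial>lborel) = (if a = b then of_real (gauss_moment t a) else 0)"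
proof (cases "a = b")
  case True
  have "gauss_monom t a a z = of_real (cmod z ^ (2 * a) * exp (- t * (cmod z)\<^sup>2))" for z
  proof -
    have "of_real (cmod z ^ (2 * a)) = (z * cnj z) ^ a"
      by (simp only: power_mult complex_norm_square[symmetric] of_real_power)
    thus ?thesis by (simp add: gauss_monom_def power_mult_distrib)
  qed
  hence "(\<integral>z. gauss_monom t a a z \<partial>lborel) = of_real (\<integral>z. cmod z ^ (2 * a) * exp (- t * (cmod z)\<^sup>2) \<partial>lborel)"
    by (simp only: integral_complex_of_real)
  also have "(\<integral>z. cmod z ^ (2 * a) * exp (- t * (cmod z)\<^sup>2) \<partial>lborel) = gauss_moment t a"
    using nn_integral_gauss_moment[OF t, of a] gauss_moment_pos[OF t, of a]
    by (intro integral_eq_nn_integral[THEN trans]) (auto)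
  finally show ?thesis using True by simp
next
  case False
  \<comment> \<open>Rotation by the angle \<open>pi / (a - b)\<close> preserves the measure and
    multiplies the integrand by \<open>cis pi = -1\<close>, so the integral equals its own
    negative.\<close>
  define c where "c = cis (pi / (real a - real b))"
  have c: "cmod c = 1" by (simp add: c_def)
  have ab: "real a - real b \<noteq> 0" using False by simp
  have "c ^ a * cnj c ^ b = cis (real a * (pi / (real a - real b)) - real b * (pi / (real a - real b)))"
    by (simp add: c_def Complex.DeMoivre cis_cnj cis_mult)
  also have "real a * (pi / (real a - real b)) - real b * (pi / (real a - real b)) = pi"
    unfolding left_diff_distrib[symmetric] using ab by (rule nonzero_mult_div_cancel_left[of _ pi, unfolded times_divide_eq_right[symmetric]])
  finally have cc: "c ^ a * cnj c ^ b = - 1" by simp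
  have "gauss_monom t a b (c * z) = - gauss_monom t a b z" for z
  proof -
    have "gauss_monom t a b (c * z) = (c ^ a * cnj c ^ b) * gauss_monom t a b z"
      using c by (simp add: gauss_monom_def power_mult_distrib norm_mult)
    thus ?thesis using cc by simp
  qed
  moreover have "(\<integral>z. gauss_monom t a b z \<partial>lborel) = (\<integral>z. gauss_monom t a b (c * z) \<partial>lborel)"
    by (subst lborel_distr_unit_mult[OF c, symmetric], subst integral_distr) auto
  ultimately show ?thesis using False by simp
qed

section \<open>Vandermonde products\<close>

lemma vandermonde_det:
  fixes x :: "nat \<Rightarrow> complex"
  shows "det (mat n n (\<lambda>(i, j). x i ^ j)) = (\<Prod>i<n. \<Prod>j<i. x i - x j)"
proof (induction n)
  case 0
  show ?case by (simp add: det_dim_zero)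
next
  case (Suc n)
  \<comment> \<open>With the last node freed as \<open>w\<close>, expansion along its row gives a
    polynomial \<open>P\<close> of degree at most \<open>n\<close> whose coefficient of order
    \<open>n\<close> is the smaller determinant. For distinct nodes it has the roots
    \<open>x j\<close>, which identifies it with \<open>Q\<close>; repeated nodes make both sides
    vanish.\<close>
  define V where "V = (\<lambda>w. mat (Suc n) (Suc n) (\<lambda>(i, j). (if i = n then w else x i) ^ j))"
  define c where "c = (\<lambda>k. cofactor (V 0) n k)"
  have V [simp]: "V w \<in> carrier_mat (Suc n) (Suc n)" for w by (simp add: V_def)
  have V0: "mat_delete (V w) n k = mat_delete (V 0) n k" for w k
    by (rule eq_matI) (auto simp: V_def mat_delete_def)
  have cof: "cofactor (V w) n k = c k" for w k unfolding c_def cofactor_def V0[of w k] by (rule refl)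
  define P where "P = (\<Sum>k\<le>n. monom (c k) k)"
  have detV: "det (V w) = poly P w" for w
  proof -
    have "det (V w) = (\<Sum>j<Suc n. V w $$ (n, j) * cofactor (V w) n j)"
      by (rule laplace_expansion_row[OF V]) simp
    also have "\<dots> = (\<Sum>j\<le>n. c j * w ^ j)"
      unfolding cof lessThan_Suc_atMost by (intro sum.cong) (auto simp: V_def)
    finally show ?thesis by (simp add: P_def poly_sum poly_monom)
  qed
  have cn: "c n = (\<Prod>i<n. \<Prod>j<i. x i - x j)"
  proof -
    have "mat_delete (V 0) n n = mat n n (\<lambda>(i, j). x i ^ j)"
      by (rule eq_matI) (auto simp: V_def mat_delete_def)
    thus ?thesis using Suc by (simp add: c_def cofactor_def)
  qed
  define Q where "Q = Polynomial.smult (c n) (\<Prod>j<n. [:- x j, 1:])"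
  have Q: "poly Q w = c n * (\<Prod>j<n. w - x j)" for w by (simp add: Q_def poly_prod)
  have "poly P (x n) = poly Q (x n)"
  proof (cases "inj_on x {..<n}")
    case True
    have root: "poly P (x i) = 0" if "i < n" for i
    proof -
      have "det (V (x i)) = 0"
        by (rule det_identical_rows[OF V, of i n]) (use that in \<open>auto simp: V_def\<close>)
      thus ?thesis by (simp add: detV)
    qed
    have "P = Q"
    proof (rule ccontr)
      assume "P \<noteq> Q"
      hence nz: "P - Q \<noteq> 0" by simp
      have deg: "degree (\<Prod>j<n. [:- x j, 1:]) = n"
        by (subst degree_prod_eq_sum_degree) auto
      have "lead_coeff (\<Prod>j<n. [:- x j, 1:]) = 1"
        by (subst lead_coeff_prod) simp
      hence lead: "poly.coeff (\<Prod>j<n. [:- x j, 1:]) n = 1" using deg by simp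
      have "poly.coeff (P - Q) n = 0"
        by (simp add: P_def Q_def coeff_sum lead)
      moreover have "degree (P - Q) \<le> n"
        unfolding P_def Q_def using deg
        by (intro degree_diff_le degree_sum_le order.trans[OF degree_monom_le] order.trans[OF degree_smult_le]) auto
      ultimately have "degree (P - Q) < n"
        using nz by (metis leading_coeff_0_iff order_le_less)
      moreover have "card (x ` {..<n}) \<le> card {w. poly (P - Q) w = 0}"
        using nz by (intro card_mono poly_roots_finite) (auto simp: root Q)
      moreover have "card (x ` {..<n}) = n" using True by (simp add: card_image)
      ultimately show False using card_poly_roots_bound[OF nz] by linarith
    qed
    thus ?thesis by simp
  next
    case False
    then obtain i j where ij: "i < n" "j < n" "i \<noteq> j" "x i = x j" by (auto simp: inj_on_def)
    have "det (V (x n)) = 0"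
      by (rule det_identical_rows[OF V, of i j]) (use ij in \<open>auto simp: V_def\<close>)
    moreover have "det (mat n n (\<lambda>(i, j). x i ^ j)) = 0"
      by (rule det_identical_rows[of _ n i j]) (use ij in auto)
    ultimately show ?thesis using Suc cn by (simp add: detV Q)
  qed
  moreover have "mat (Suc n) (Suc n) (\<lambda>(i, j). x i ^ j) = V (x n)"
    by (rule eq_matI) (auto simp: V_def)
  ultimately have "det (mat (Suc n) (Suc n) (\<lambda>(i, j). x i ^ j)) = c n * (\<Prod>j<n. x n - x j)"
    by (simp add: detV Q)
  thus ?case by (simp add: cn)
qed

text \<open>Each unordered pair occurs twice, which makes this the squared modulus of a Vandermonde
  determinant. A general index set allows points to be removed without renumbering the
  others.\<close>

definition vandermonde_sq :: "'i set \<Rightarrow> ('i \<Rightarrow> complex) \<Rightarrow> real" where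
  "vandermonde_sq I x = (\<Prod>j\<in>I. \<Prod>k\<in>I - {j}. cmod (x j - x k))"

lemma vandermonde_sq_nonneg: "0 \<le> vandermonde_sq I x"
  unfolding vandermonde_sq_def by (intro prod_nonneg) auto

lemma prod_off_diagonal:
  fixes g :: "nat \<Rightarrow> nat \<Rightarrow> real"
  assumes "\<And>i j. g i j = g j i"
  shows "(\<Prod>i<n. \<Prod>j\<in>{..<n} - {i}. g i j) = (\<Prod>i<n. \<Prod>j<i. g i j)\<^sup>2"
proof (induction n)
  case (Suc n)
  have "(\<Prod>i<Suc n. \<Prod>j\<in>{..<Suc n} - {i}. g i j) = (\<Prod>i<n. \<Prod>j\<in>{..<Suc n} - {i}. g i j) * (\<Prod>j<n. g n j)"
    by (simp add: lessThan_Suc)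
  also have "(\<Prod>i<n. \<Prod>j\<in>{..<Suc n} - {i}. g i j) = (\<Prod>i<n. g n i * (\<Prod>j\<in>{..<n} - {i}. g i j))"
  proof (intro prod.cong refl)
    fix i assume "i \<in> {..<n}"
    hence "{..<Suc n} - {i} = insert n ({..<n} - {i})" by auto
    thus "(\<Prod>j\<in>{..<Suc n} - {i}. g i j) = g n i * (\<Prod>j\<in>{..<n} - {i}. g i j)"
      using assms by simp
  qed
  finally show ?case using Suc by (simp add: prod.distrib power2_eq_square mult_ac)
qed simp

lemma vandermonde_sq_eq_det:
  fixes e :: "nat \<Rightarrow> 'i"
  assumes e: "bij_betw e {..<n} I"
  shows "vandermonde_sq I x = (cmod (\<Prod>i<n. \<Prod>j<i. x (e i) - x (e j)))\<^sup>2"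
proof -
  have "vandermonde_sq I x = (\<Prod>i<n. \<Prod>k\<in>I - {e i}. cmod (x (e i) - x k))"
    unfolding vandermonde_sq_def by (rule prod.reindex_bij_betw[OF e, symmetric])
  also have "\<dots> = (\<Prod>i<n. \<Prod>j\<in>{..<n} - {i}. cmod (x (e i) - x (e j)))"
  proof (intro prod.cong refl)
    fix i assume i: "i \<in> {..<n}"
    have "bij_betw e ({..<n} - {i}) (I - {e i})"
      using e i bij_betw_DiffI[OF e, of "{i}" "{e i}"] by (auto simp: bij_betw_def)
    thus "(\<Prod>k\<in>I - {e i}. cmod (x (e i) - x k)) = (\<Prod>j\<in>{..<n} - {i}. cmod (x (e i) - x (e j)))"
      by (rule prod.reindex_bij_betw[symmetric])
  qed
  also have "\<dots> = (\<Prod>i<n. \<Prod>j<i. cmod (x (e i) - x (e j)))\<^sup>2"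
    using prod_off_diagonal[of "\<lambda>i j. cmod (x (e i) - x (e j))" n] by (simp add: norm_minus_commute)
  finally show ?thesis by (simp add: prod_norm)
qed

lemma vandermonde_sq_insert:
  assumes "finite I" "i \<notin> I"
  shows "vandermonde_sq (insert i I) x = vandermonde_sq I x * (\<Prod>j\<in>I. (cmod (x i - x j))\<^sup>2)"
proof -
  have "vandermonde_sq (insert i I) x = (\<Prod>k\<in>I. cmod (x i - x k)) * (\<Prod>j\<in>I. \<Prod>k\<in>insert i I - {j}. cmod (x j - x k))"
    using assms by (simp add: vandermonde_sq_def)
  also have "(\<Prod>j\<in>I. \<Prod>k\<in>insert i I - {j}. cmod (x j - x k)) = (\<Prod>j\<in>I. cmod (x i - x j) * (\<Prod>k\<in>I - {j}. cmod (x j - x k)))"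
  proof (intro prod.cong refl)
    fix j assume "j \<in> I"
    hence "insert i I - {j} = insert i (I - {j})" using assms by auto
    thus "(\<Prod>k\<in>insert i I - {j}. cmod (x j - x k)) = cmod (x i - x j) * (\<Prod>k\<in>I - {j}. cmod (x j - x k))"
      using assms by (simp add: norm_minus_commute)
  qed
  finally show ?thesis
    by (simp add: vandermonde_sq_def prod.distrib power2_eq_square mult_ac)
qed

lemma vandermonde_sq_cong: "(\<And>i. i \<in> I \<Longrightarrow> x i = y i) \<Longrightarrow> vandermonde_sq I x = vandermonde_sq I y"
  unfolding vandermonde_sq_def by (intro prod.cong) auto

section \<open>The second moment of the characteristic polynomial\<close>

abbreviation lborel_Pi :: "'i set \<Rightarrow> ('i \<Rightarrow> complex) measure" where
  "lborel_Pi I \<equiv> \<Pi>\<^sub>M j\<in>I. lborel"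

lemma sum_permutes_last:
  fixes g :: "nat \<Rightarrow> real"
  shows "(\<Sum>p\<in>{p. p permutes {0..<Suc n}}. g (p n)) = fact n * (\<Sum>k\<le>n. g k)"
proof -
  have "{0..<Suc n} = insert n {0..<n}" by auto
  hence "(\<Sum>p\<in>{p. p permutes {0..<Suc n}}. g (p n)) = (\<Sum>p\<in>{p. p permutes insert n {0..<n}}. g (p n))"
    by simp
  also have "\<dots> = (\<Sum>b\<in>insert n {0..<n}. \<Sum>q\<in>{p. p permutes {0..<n}}. g ((Transposition.transpose n b \<circ> q) n))"
    by (rule sum_over_permutations_insert) auto
  also have "\<dots> = (\<Sum>b\<in>insert n {0..<n}. \<Sum>q\<in>{p. p permutes {0..<n}}. g b)"
  proof (intro sum.cong refl)
    fix b q assume "q \<in> {p. p permutes {0..<n}}"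
    hence "q n = n" by (auto intro: permutes_not_in)
    thus "g ((Transposition.transpose n b \<circ> q) n) = g b" by simp
  qed
  also have "\<dots> = (\<Sum>b\<in>insert n {0..<n}. fact n * g b)"
    by (simp add: card_permutations[of "{0..<n}" n])
  also have "insert n {0..<n} = {..n}" by auto
  finally show ?thesis by (simp add: sum_distrib_left)
qed

text \<open>The composition of \<open>p\<close> with the inverse of \<open>q\<close> fixes every
  \<open>i < n\<close> and so can only permute the single point \<open>n\<close>. Orthogonality in
  the \<open>n\<close> integrated variables thus forces two permutations of \<open>n + 1\<close>
  indices to agree.\<close>

lemma permutes_eqI_last:
  assumes "p permutes {0..<Suc n}" "q permutes {0..<Suc n}" "\<And>i. i < n \<Longrightarrow> p i = q i"
  shows "p = q"
proof
  fix i
  have inv: "inv_into UNIV q (q j) = j" for j using assms(2) by (simp add: permutes_inverses)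
  have pq: "(inv_into UNIV q \<circ> p) permutes {0..<Suc n}"
    using assms by (intro permutes_compose permutes_inv)
  have "(inv_into UNIV q \<circ> p) permutes {n}"
    using pq by (rule permutes_superset) (use assms(3) inv in auto)
  hence "inv_into UNIV q \<circ> p = id" by simp
  hence "q (inv_into UNIV q (p i)) = q i" by (simp add: fun_eq_iff)
  thus "p i = q i" using assms(2) by (simp add: permutes_inverses)
qed

text \<open>The factors \<open>|w - x j|^2\<close> adjoin \<open>w\<close> as the last of
  \<open>n + 1\<close> Vandermonde nodes. The Leibniz formula for the determinant and its conjugate
  then separates the variables, so each term can be integrated coordinate by coordinate.\<close>

lemma vandermonde_sq_mult_expansion:
  fixes e :: "nat \<Rightarrow> 'i"
  assumes e: "bij_betw e {..<n} I"
  defines "S \<equiv> {p. p permutes {0..<Suc n}}"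
  shows "complex_of_real (vandermonde_sq I x * (\<Prod>j\<in>I. (cmod (w - x j))\<^sup>2) * exp (- t * (\<Sum>j\<in>I. (cmod (x j))\<^sup>2)))
    = (\<Sum>\<sigma>\<in>S. \<Sum>\<tau>\<in>S. of_int (sign \<sigma>) * of_int (sign \<tau>) * w ^ \<sigma> n * cnj w ^ \<tau> n *
        (\<Prod>j\<in>I. gauss_monom t (\<sigma> (inv_into {..<n} e j)) (\<tau> (inv_into {..<n} e j)) (x j)))"
proof -
  define y where "y = (\<lambda>i. if i < n then x (e i) else w)"
  define D where "D = (\<Prod>i<Suc n. \<Prod>j<i. y i - y j)"
  have fin: "finite I" using bij_betw_finite[OF e] by simp
  have "D = (\<Prod>i<n. \<Prod>j<i. x (e i) - x (e j)) * (\<Prod>j<n. w - x (e j))"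
    unfolding D_def y_def by simp
  hence D2: "(cmod D)\<^sup>2 = vandermonde_sq I x * (\<Prod>j\<in>I. (cmod (w - x j))\<^sup>2)"
    using prod.reindex_bij_betw[OF e, of "\<lambda>j. cmod (w - x j)"]
    by (simp add: vandermonde_sq_eq_det[OF e] norm_mult power_mult_distrib prod_power_distrib prod_norm[symmetric])
  have e_inv: "inv_into {..<n} e (e i) = i" if "i < n" for i
    using e that by (auto simp: bij_betw_def inv_into_f_f)
  have D: "D = (\<Sum>\<sigma>\<in>S. of_int (sign \<sigma>) * ((\<Prod>i<n. x (e i) ^ \<sigma> i) * w ^ \<sigma> n))"
  proof -
    have "D = det (mat (Suc n) (Suc n) (\<lambda>(i, j). y i ^ j))"
      by (simp add: D_def vandermonde_det)
    also have "\<dots> = (\<Sum>\<sigma>\<in>S. of_int (sign \<sigma>) * (\<Prod>i = 0..<Suc n. mat (Suc n) (Suc n) (\<lambda>(i, j). y i ^ j) $$ (i, \<sigma> i)))"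
      unfolding S_def by (rule det_def') simp
    also have "\<dots> = (\<Sum>\<sigma>\<in>S. of_int (sign \<sigma>) * ((\<Prod>i<n. x (e i) ^ \<sigma> i) * w ^ \<sigma> n))"
    proof (intro sum.cong refl arg_cong2[of _ _ _ _ "(*)"])
      fix \<sigma> assume "\<sigma> \<in> S"
      hence "\<sigma> i < Suc n" if "i < Suc n" for i
        using permutes_in_image[of \<sigma> "{0..<Suc n}" i] that by (auto simp: S_def)
      hence "(\<Prod>i = 0..<Suc n. mat (Suc n) (Suc n) (\<lambda>(i, j). y i ^ j) $$ (i, \<sigma> i)) = (\<Prod>i<Suc n. y i ^ \<sigma> i)"
        unfolding atLeast0LessThan by (intro prod.cong) auto
      thus "(\<Prod>i = 0..<Suc n. mat (Suc n) (Suc n) (\<lambda>(i, j). y i ^ j) $$ (i, \<sigma> i)) = (\<Prod>i<n. x (e i) ^ \<sigma> i) * w ^ \<sigma> n"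
        by (simp add: y_def)
    qed
    finally show ?thesis .
  qed
  have ex: "complex_of_real (exp (- t * (\<Sum>j\<in>I. (cmod (x j))\<^sup>2))) = (\<Prod>j\<in>I. of_real (exp (- t * (cmod (x j))\<^sup>2)))"
    using fin by (simp add: sum_distrib_left exp_sum sum_negf[symmetric])
  have "complex_of_real (vandermonde_sq I x * (\<Prod>j\<in>I. (cmod (w - x j))\<^sup>2) * exp (- t * (\<Sum>j\<in>I. (cmod (x j))\<^sup>2)))
     = (D * cnj D) * (\<Prod>j\<in>I. of_real (exp (- t * (cmod (x j))\<^sup>2)))"
    unfolding of_real_mult[of _ "exp _"] ex D2[symmetric] complex_norm_square ..
  also have "D * cnj D = (\<Sum>\<sigma>\<in>S. \<Sum>\<tau>\<in>S. (of_int (sign \<sigma>) * ((\<Prod>i<n. x (e i) ^ \<sigma> i) * w ^ \<sigma> n)) *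
       (of_int (sign \<tau>) * ((\<Prod>i<n. cnj (x (e i)) ^ \<tau> i) * cnj w ^ \<tau> n)))"
    unfolding D by (simp add: sum_product)
  also have "\<dots> * (\<Prod>j\<in>I. of_real (exp (- t * (cmod (x j))\<^sup>2))) =
     (\<Sum>\<sigma>\<in>S. \<Sum>\<tau>\<in>S. of_int (sign \<sigma>) * of_int (sign \<tau>) * w ^ \<sigma> n * cnj w ^ \<tau> n *
        (\<Prod>j\<in>I. gauss_monom t (\<sigma> (inv_into {..<n} e j)) (\<tau> (inv_into {..<n} e j)) (x j)))"
    unfolding sum_distrib_right
  proof (intro sum.cong refl)
    fix \<sigma> \<tau>
    have "(\<Prod>i<n. x (e i) ^ \<sigma> i) * (\<Prod>i<n. cnj (x (e i)) ^ \<tau> i) * (\<Prod>i<n. of_real (exp (- t * (cmod (x (e i)))\<^sup>2)))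
       = (\<Prod>i<n. gauss_monom t (\<sigma> i) (\<tau> i) (x (e i)))"
      by (simp add: gauss_monom_def prod.distrib)
    also have "\<dots> = (\<Prod>i<n. gauss_monom t (\<sigma> (inv_into {..<n} e (e i))) (\<tau> (inv_into {..<n} e (e i))) (x (e i)))"
      by (intro prod.cong) (auto simp: e_inv)
    also have "\<dots> = (\<Prod>j\<in>I. gauss_monom t (\<sigma> (inv_into {..<n} e j)) (\<tau> (inv_into {..<n} e j)) (x j))"
      by (rule prod.reindex_bij_betw[OF e])
    finally show "of_int (sign \<sigma>) * ((\<Prod>i<n. x (e i) ^ \<sigma> i) * w ^ \<sigma> n) *
       (of_int (sign \<tau>) * ((\<Prod>i<n. cnj (x (e i)) ^ \<tau> i) * cnj w ^ \<tau> n)) * (\<Prod>j\<in>I. of_real (exp (- t * (cmod (x j))\<^sup>2)))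
      = of_int (sign \<sigma>) * of_int (sign \<tau>) * w ^ \<sigma> n * cnj w ^ \<tau> n *
        (\<Prod>j\<in>I. gauss_monom t (\<sigma> (inv_into {..<n} e j)) (\<tau> (inv_into {..<n} e j)) (x j))"
      unfolding prod.reindex_bij_betw[OF e, of "\<lambda>j. of_real (exp (- t * (cmod (x j))\<^sup>2))", symmetric]
      by (simp only: mult_ac)
  qed
  finally show ?thesis .
qed

text \<open>Orthogonality of the monomials removes all pairs of distinct permutations. On the
  diagonal the exponent \<open>\<sigma> n\<close> of the unintegrated variable \<open>w\<close>
  remains free, and each of its values occurs \<open>fact n\<close> times; this yields the
  reproducing kernel on the diagonal.\<close>

lemma nn_integral_vandermonde_sq_mult:
  fixes I :: "'i set"
  assumes fin: "finite I" and n: "card I = n" and t: "0 < t"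
  shows "(\<integral>\<^sup>+x. ennreal (vandermonde_sq I x * (\<Prod>j\<in>I. (cmod (w - x j))\<^sup>2) * exp (- t * (\<Sum>j\<in>I. (cmod (x j))\<^sup>2))) \<partial>lborel_Pi I)
    = ennreal (fact n * (\<Prod>k\<le>n. gauss_moment t k) * (\<Sum>k\<le>n. cmod w ^ (2 * k) / gauss_moment t k))"
proof -
  interpret product_sigma_finite "\<lambda>_::'i. lborel :: complex measure" ..
  obtain e where e: "bij_betw e {..<n} I"
    using bij_betw_from_nat_into_finite[OF fin] n by auto
  define e' where "e' = inv_into {..<n} e"
  define S where "S = {p. p permutes {0..<Suc n}}"
  have finS: "finite S" unfolding S_def by (intro finite_permutations) simp
  define P where "P = (\<lambda>\<sigma> \<tau> x. \<Prod>j\<in>I. gauss_monom t (\<sigma> (e' j)) (\<tau> (e' j)) (x j))"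
  define c where "c = (\<lambda>\<sigma> \<tau>. of_int (sign \<sigma>) * of_int (sign \<tau>) * w ^ \<sigma> n * cnj w ^ \<tau> n)"
  define G where "G = (\<lambda>x. vandermonde_sq I x * (\<Prod>j\<in>I. (cmod (w - x j))\<^sup>2) * exp (- t * (\<Sum>j\<in>I. (cmod (x j))\<^sup>2)))"
  have G: "complex_of_real (G x) = (\<Sum>\<sigma>\<in>S. \<Sum>\<tau>\<in>S. c \<sigma> \<tau> * P \<sigma> \<tau> x)" for x
    unfolding G_def c_def P_def S_def e'_def by (rule vandermonde_sq_mult_expansion[OF e])
  have intP: "integrable (lborel_Pi I) (P \<sigma> \<tau>)" for \<sigma> \<tau>
    unfolding P_def using fin t by (intro product_integrable_prod integrable_gauss_monom)
  have P: "(\<integral>x. P \<sigma> \<tau> x \<partial>lborel_Pi I) = (if \<sigma> = \<tau> then of_real (\<Prod>i<n. gauss_moment t (\<sigma> i)) else 0)"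
    if "\<sigma> \<in> S" "\<tau> \<in> S" for \<sigma> \<tau>
  proof -
    have "(\<integral>x. P \<sigma> \<tau> x \<partial>lborel_Pi I) = (\<Prod>j\<in>I. \<integral>z. gauss_monom t (\<sigma> (e' j)) (\<tau> (e' j)) z \<partial>lborel)"
      unfolding P_def using fin t by (intro product_integral_prod integrable_gauss_monom)
    also have "\<dots> = (\<Prod>i<n. \<integral>z. gauss_monom t (\<sigma> (e' (e i))) (\<tau> (e' (e i))) z \<partial>lborel)"
      by (rule prod.reindex_bij_betw[OF e, symmetric])
    also have "\<dots> = (\<Prod>i<n. if \<sigma> i = \<tau> i then of_real (gauss_moment t (\<sigma> i)) else 0)"
    proof (intro prod.cong refl)
      fix i assume "i \<in> {..<n}"
      hence "e' (e i) = i" using e unfolding e'_def by (auto simp: bij_betw_def inv_into_f_f)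
      thus "(\<integral>z. gauss_monom t (\<sigma> (e' (e i))) (\<tau> (e' (e i))) z \<partial>lborel) = (if \<sigma> i = \<tau> i then of_real (gauss_moment t (\<sigma> i)) else 0)"
        by (simp add: integral_gauss_monom[OF t])
    qed
    also have "\<dots> = (if \<sigma> = \<tau> then of_real (\<Prod>i<n. gauss_moment t (\<sigma> i)) else 0)"
    proof (cases "\<sigma> = \<tau>")
      case False
      have "\<exists>i<n. \<sigma> i \<noteq> \<tau> i"
      proof (rule ccontr)
        assume "\<not> (\<exists>i<n. \<sigma> i \<noteq> \<tau> i)"
        hence "\<sigma> = \<tau>" using that by (intro permutes_eqI_last[of \<sigma> n \<tau>]) (auto simp: S_def)
        thus False using False by simp
      qed
      thus ?thesis using False by (auto intro!: prod_zero)
    qed simp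
    finally show ?thesis .
  qed
  have intG': "integrable (lborel_Pi I) (\<lambda>x. complex_of_real (G x))"
    unfolding G by (intro Bochner_Integration.integrable_sum integrable_mult_right intP)
  have intG: "integrable (lborel_Pi I) G"
    using integrable_Re[OF intG'] by simp
  have "complex_of_real (\<integral>x. G x \<partial>lborel_Pi I) = (\<integral>x. complex_of_real (G x) \<partial>lborel_Pi I)"
    by (rule integral_complex_of_real[symmetric])
  also have "\<dots> = (\<Sum>\<sigma>\<in>S. \<Sum>\<tau>\<in>S. c \<sigma> \<tau> * (\<integral>x. P \<sigma> \<tau> x \<partial>lborel_Pi I))"
    unfolding G by (subst Bochner_Integration.integral_sum; (intro Bochner_Integration.integrable_sum integrable_mult_right intP)?)
       (subst Bochner_Integration.integral_sum; (intro integrable_mult_right intP)?; simp)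
  also have "\<dots> = (\<Sum>\<sigma>\<in>S. \<Sum>\<tau>\<in>S. if \<sigma> = \<tau> then c \<sigma> \<tau> * of_real (\<Prod>i<n. gauss_moment t (\<sigma> i)) else 0)"
    by (intro sum.cong refl) (simp add: P)
  also have "\<dots> = (\<Sum>\<sigma>\<in>S. c \<sigma> \<sigma> * of_real (\<Prod>i<n. gauss_moment t (\<sigma> i)))"
    using finS by (intro sum.cong refl) (simp add: sum.delta)
  also have "\<dots> = (\<Sum>\<sigma>\<in>S. of_real ((\<Prod>k\<le>n. gauss_moment t k) * (cmod w ^ (2 * \<sigma> n) / gauss_moment t (\<sigma> n))))"
  proof (intro sum.cong refl)
    fix \<sigma> assume "\<sigma> \<in> S"
    hence \<sigma>: "\<sigma> permutes {0..<Suc n}" by (simp add: S_def)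
    \<comment> \<open>The product over \<open>i < n\<close> lacks just the moment with index
      \<open>\<sigma> n\<close>, which becomes the denominator in the kernel.\<close>
    have "(\<Prod>k\<le>n. gauss_moment t k) = (\<Prod>k\<in>{0..<Suc n}. gauss_moment t k)" by (intro prod.cong) auto
    also have "\<dots> = (\<Prod>i\<in>{0..<Suc n}. gauss_moment t (\<sigma> i))"
      by (rule prod.permute[OF \<sigma>, unfolded o_def])
    also have "\<dots> = (\<Prod>i<n. gauss_moment t (\<sigma> i)) * gauss_moment t (\<sigma> n)"
      by (simp add: atLeast0LessThan)
    finally have *: "(\<Prod>i<n. gauss_moment t (\<sigma> i)) = (\<Prod>k\<le>n. gauss_moment t k) / gauss_moment t (\<sigma> n)"
      using gauss_moment_pos[OF t, of "\<sigma> n"] by simp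
    have "c \<sigma> \<sigma> = (of_int (sign \<sigma>) * of_int (sign \<sigma>)) * (w * cnj w) ^ \<sigma> n"
      by (simp add: c_def power_mult_distrib)
    also have "of_int (sign \<sigma>) * of_int (sign \<sigma>) = (1::complex)"
      by (simp add: sign_def)
    also have "(w * cnj w) ^ \<sigma> n = of_real (cmod w ^ (2 * \<sigma> n))"
      by (simp only: power_mult complex_norm_square[symmetric] of_real_power)
    finally show "c \<sigma> \<sigma> * of_real (\<Prod>i<n. gauss_moment t (\<sigma> i)) =
       of_real ((\<Prod>k\<le>n. gauss_moment t k) * (cmod w ^ (2 * \<sigma> n) / gauss_moment t (\<sigma> n)))"
      unfolding * by simp
  qed
  also have "\<dots> = of_real (\<Sum>\<sigma>\<in>S. (\<Prod>k\<le>n. gauss_moment t k) * (cmod w ^ (2 * \<sigma> n) / gauss_moment t (\<sigma> n)))"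
    by simp
  also have "(\<Sum>\<sigma>\<in>S. (\<Prod>k\<le>n. gauss_moment t k) * (cmod w ^ (2 * \<sigma> n) / gauss_moment t (\<sigma> n))) =
     fact n * (\<Prod>k\<le>n. gauss_moment t k) * (\<Sum>k\<le>n. cmod w ^ (2 * k) / gauss_moment t k)"
    unfolding S_def sum_permutes_last[of "\<lambda>k. (\<Prod>k\<le>n. gauss_moment t k) * (cmod w ^ (2 * k) / gauss_moment t k)"]
    by (simp add: sum_distrib_left mult_ac)
  finally have "(\<integral>x. G x \<partial>lborel_Pi I) =
     fact n * (\<Prod>k\<le>n. gauss_moment t k) * (\<Sum>k\<le>n. cmod w ^ (2 * k) / gauss_moment t k)"
    by (simp only: of_real_eq_iff)
  moreover have "0 \<le> G x" for x
    unfolding G_def by (intro mult_nonneg_nonneg prod_nonneg vandermonde_sq_nonneg) auto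
  ultimately have "(\<integral>\<^sup>+x. ennreal (G x) \<partial>lborel_Pi I) =
     ennreal (fact n * (\<Prod>k\<le>n. gauss_moment t k) * (\<Sum>k\<le>n. cmod w ^ (2 * k) / gauss_moment t k))"
    using nn_integral_eq_integral[OF intG] by simp
  thus ?thesis unfolding G_def .
qed

text \<open>The unnormalised Ginibre density. \<open>t\<close> is independent of the number of
  points because splitting off one of \<open>N\<close> points leaves \<open>N - 1\<close> points
  that still carry the weight with \<open>t = N\<close>.\<close>

definition coulomb_weight :: "real \<Rightarrow> 'i set \<Rightarrow> ('i \<Rightarrow> complex) \<Rightarrow> real" where
  "coulomb_weight t I x = vandermonde_sq I x * exp (- t * (\<Sum>j\<in>I. (cmod (x j))\<^sup>2))"

lemma coulomb_weight_nonneg: "0 \<le> coulomb_weight t I x"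
  unfolding coulomb_weight_def by (intro mult_nonneg_nonneg vandermonde_sq_nonneg) auto

lemma vandermonde_sq_measurable [measurable]:
  "vandermonde_sq I \<in> borel_measurable (lborel_Pi I)"
  unfolding vandermonde_sq_def[abs_def] by measurable

lemma coulomb_weight_measurable [measurable]:
  "coulomb_weight t I \<in> borel_measurable (lborel_Pi I)"
  unfolding coulomb_weight_def[abs_def] by measurable

lemma coulomb_weight_insert:
  assumes "finite I" "i \<notin> I"
  shows "coulomb_weight t (insert i I) (x(i := y)) =
    exp (- t * (cmod y)\<^sup>2) * (coulomb_weight t I x * (\<Prod>j\<in>I. (cmod (y - x j))\<^sup>2))"
proof -
  have "vandermonde_sq I (x(i := y)) = vandermonde_sq I x"
    using assms by (intro vandermonde_sq_cong) auto
  moreover have "(\<Prod>j\<in>I. (cmod ((x(i := y)) i - (x(i := y)) j))\<^sup>2) = (\<Prod>j\<in>I. (cmod (y - x j))\<^sup>2)"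
    using assms by (intro prod.cong) auto
  moreover have "(\<Sum>j\<in>I. (cmod ((x(i := y)) j))\<^sup>2) = (\<Sum>j\<in>I. (cmod (x j))\<^sup>2)"
    using assms by (intro sum.cong) auto
  ultimately show ?thesis
    unfolding coulomb_weight_def vandermonde_sq_insert[OF assms] using assms
    by (simp add: distrib_left exp_add[symmetric] mult_ac)
qed

text \<open>Integrating coordinate \<open>i\<close> first while \<open>g x\<close> stays constant by
  \<open>indep\<close>, the exceptional set is a single point on each fibre.\<close>

lemma AE_lborel_Pi_neq:
  fixes I :: "'i set"
  assumes I: "finite I" "i \<in> I" and g [measurable]: "g \<in> borel_measurable (lborel_Pi I)"
    and indep: "\<And>x y. g (x(i := y)) = g x"
  shows "AE x in lborel_Pi I. x i \<noteq> g x"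
proof -
  interpret product_sigma_finite "\<lambda>_::'i. lborel :: complex measure" ..
  define J where "J = I - {i}"
  have J: "I = insert i J" "finite J" "i \<notin> J" using I by (auto simp: J_def)
  have [measurable]: "(\<lambda>x. x i) \<in> borel_measurable (lborel_Pi I)"
    using measurable_component_singleton[OF I(2), of "\<lambda>_. lborel :: complex measure"] by simp
  have meas: "(\<lambda>x. indicator {0} (x i - g x) :: ennreal) \<in> borel_measurable (lborel_Pi I)"
    by measurable
  have "(\<integral>\<^sup>+x. indicator {0} (x i - g x) \<partial>lborel_Pi I) = (\<integral>\<^sup>+x. (\<integral>\<^sup>+y. indicator {0} ((x(i := y)) i - g (x(i := y))) \<partial>lborel) \<partial>lborel_Pi J)"
    unfolding J(1) by (rule product_nn_integral_insert[OF J(2,3) meas[unfolded J(1)]])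
  also have "\<dots> = (\<integral>\<^sup>+x. (\<integral>\<^sup>+y. indicator {g x} y \<partial>lborel) \<partial>lborel_Pi J)"
    by (intro nn_integral_cong) (auto simp: indep split: split_indicator)
  also have "\<dots> = 0" by simp
  finally have "AE x in lborel_Pi I. indicator {0} (x i - g x) = (0::ennreal)"
    by (simp only: nn_integral_0_iff_AE[OF meas])
  thus ?thesis by (simp add: indicator_def)
qed

lemma AE_lborel_Pi_inj:
  assumes fin: "finite I"
  shows "AE x in lborel_Pi I. inj_on x I"
proof -
  have "AE x in lborel_Pi I. x i \<noteq> x k" if ik: "i \<in> I" "k \<in> I" "i \<noteq> k" for i k
    using measurable_component_singleton[OF ik(2), of "\<lambda>_. lborel :: complex measure"] ik fin
    by (intro AE_lborel_Pi_neq) auto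
  hence "AE x in lborel_Pi I. \<forall>p\<in>{p\<in>I \<times> I. fst p \<noteq> snd p}. x (fst p) \<noteq> x (snd p)"
    using fin by (intro AE_finite_allI) auto
  thus ?thesis by eventually_elim (auto simp: inj_on_def)
qed

lemma AE_lborel_Pi_avoid:
  assumes fin: "finite I"
  shows "AE x in lborel_Pi I. \<forall>j\<in>I. x j \<noteq> w"
  using fin by (intro AE_finite_allI AE_lborel_Pi_neq) auto

text \<open>Injectivity excludes the coincidences, at which \<open>ln 0 = 0\<close> would put the
  factor 1 on the left where the right-hand side has 0. They form a null set.\<close>

lemma exp_ginibre_hamiltonian:
  assumes "inj_on x {..<N}"
  shows "exp (- ginibre_hamiltonian N x) = coulomb_weight (real N) {..<N} x"
proof -
  have "(\<Sum>j<N. \<Sum>k\<in>{..<N} - {j}. ln (inverse (cmod (x j - x k)))) = (\<Sum>j<N. \<Sum>k\<in>{..<N} - {j}. - ln (cmod (x j - x k)))"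
    by (simp add: ln_inverse)
  also have "\<dots> = - (\<Sum>j<N. \<Sum>k\<in>{..<N} - {j}. ln (cmod (x j - x k)))" by (simp add: sum_negf)
  finally have "exp (- ginibre_hamiltonian N x) = exp (\<Sum>j<N. \<Sum>k\<in>{..<N} - {j}. ln (cmod (x j - x k))) * exp (- real N * (\<Sum>j<N. (cmod (x j))\<^sup>2))"
    by (simp add: ginibre_hamiltonian_def exp_add[symmetric])
  also have "exp (\<Sum>j<N. \<Sum>k\<in>{..<N} - {j}. ln (cmod (x j - x k))) = vandermonde_sq {..<N} x"
    unfolding vandermonde_sq_def exp_sum[OF finite_lessThan]
  proof (intro prod.cong refl)
    fix j assume j: "j \<in> {..<N}"
    have "exp (\<Sum>k\<in>{..<N} - {j}. ln (cmod (x j - x k))) = (\<Prod>k\<in>{..<N} - {j}. exp (ln (cmod (x j - x k))))"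
      by (rule exp_sum) auto
    also have "\<dots> = (\<Prod>k\<in>{..<N} - {j}. cmod (x j - x k))"
      using assms j by (intro prod.cong refl exp_ln) (auto simp: inj_on_def)
    finally show "exp (\<Sum>k\<in>{..<N} - {j}. ln (cmod (x j - x k))) = (\<Prod>k\<in>{..<N} - {j}. cmod (x j - x k))" .
  qed
  finally show ?thesis by (simp add: coulomb_weight_def)
qed

section \<open>Normalisation of the density\<close>

definition coulomb_partition :: "real \<Rightarrow> nat \<Rightarrow> real" where
  "coulomb_partition t n = fact n * (\<Prod>k<n. gauss_moment t k)"

lemma coulomb_partition_pos: "0 < t \<Longrightarrow> 0 < coulomb_partition t n"
  unfolding coulomb_partition_def by (intro mult_pos_pos prod_pos gauss_moment_pos) auto

text \<open>At \<open>s = t |y|^2\<close> and up to the factor \<open>t / pi\<close>, this is the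
  diagonal of the reproducing kernel of the polynomials of degree less than
  \<open>n\<close>.\<close>

definition trunc_exp :: "nat \<Rightarrow> real \<Rightarrow> real" where
  "trunc_exp n s = (\<Sum>k<n. s ^ k / fact k)"

lemma trunc_exp_nonneg: "0 \<le> s \<Longrightarrow> 0 \<le> trunc_exp n s"
  unfolding trunc_exp_def by (intro sum_nonneg) auto

lemma trunc_exp_le_exp: "0 \<le> s \<Longrightarrow> trunc_exp n s \<le> exp s"
proof -
  assume s: "0 \<le> s"
  have "(\<lambda>k. s ^ k / fact k) sums exp s"
    using exp_converges[of s] by (simp add: field_simps)
  hence "summable (\<lambda>k. s ^ k / fact k)" "(\<Sum>k. s ^ k / fact k) = exp s"
    by (auto simp: sums_iff)
  thus ?thesis unfolding trunc_exp_def using s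
    using sum_le_suminf[of "\<lambda>k. s ^ k / fact k" "{..<n}"] by simp
qed

text \<open>Markov's inequality for a Poisson variable with mean \<open>s\<close>: termwise,
  \<open>1 - k / n \<le> 1\<close> for \<open>k < n\<close>, and \<open>1 - k / n \<le> 0\<close> for \<open>k \<ge> n\<close>.\<close>

lemma trunc_exp_ge:
  assumes s: "0 \<le> s" and n: "0 < n"
  shows "(1 - s / real n) * exp s \<le> trunc_exp n s"
proof -
  have 1: "(\<lambda>k. s ^ k / fact k) sums exp s"
    using exp_converges[of s] by (simp add: field_simps)
  have "(\<lambda>k. s * (s ^ k / fact k)) sums (s * exp s)" by (intro sums_mult 1)
  also have "(\<lambda>k. s * (s ^ k / fact k)) = (\<lambda>k. real (Suc k) * (s ^ Suc k / fact (Suc k)))"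
    by (simp add: fun_eq_iff field_simps del: of_nat_Suc)
  finally have 2: "(\<lambda>k. real k * (s ^ k / fact k)) sums (s * exp s)"
    by (subst (asm) sums_Suc_iff) simp
  have "(\<lambda>k. s ^ k / fact k - 1 / real n * (real k * (s ^ k / fact k))) sums (exp s - 1 / real n * (s * exp s))"
    by (intro sums_diff sums_mult 1 2)
  moreover have "(\<lambda>k. if k \<in> {..<n} then s ^ k / fact k else 0) sums trunc_exp n s"
    unfolding trunc_exp_def by (rule sums_If_finite_set) simp
  ultimately have "exp s - 1 / real n * (s * exp s) \<le> trunc_exp n s"
  proof (rule sums_le[rotated])
    fix k
    have "0 \<le> s ^ k / fact k" using s by simp
    moreover have "1 * (s ^ k / fact k) \<le> real k / real n * (s ^ k / fact k)" if "n \<le> k"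
      using that n s by (intro mult_right_mono) auto
    moreover have "0 \<le> 1 / real n * (real k * (s ^ k / fact k))" using s by simp
    ultimately show "s ^ k / fact k - 1 / real n * (real k * (s ^ k / fact k)) \<le> (if k \<in> {..<n} then s ^ k / fact k else 0)"
      by auto
  qed
  thus ?thesis by (simp add: algebra_simps)
qed

lemma sum_div_gauss_moment:
  assumes "0 < t"
  shows "(\<Sum>k<n. cmod y ^ (2 * k) / gauss_moment t k) = t / pi * trunc_exp n (t * (cmod y)\<^sup>2)"
proof -
  have "cmod y ^ (2 * k) / gauss_moment t k = t / pi * ((t * (cmod y)\<^sup>2) ^ k / fact k)" for k
    using assms power_mult[of "cmod y" 2 k] by (simp add: gauss_moment_def power_mult_distrib field_simps)
  thus ?thesis by (simp add: trunc_exp_def sum_distrib_left)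
qed

text \<open>The point \<open>w\<close> counts as a further particle, hence the kernel of
  \<open>Suc n\<close> rather than \<open>n\<close> monomials.\<close>

lemma nn_integral_coulomb_weight_mult_sq:
  assumes "finite I" "card I = n" "0 < t"
  shows "(\<integral>\<^sup>+x. ennreal (coulomb_weight t I x * (\<Prod>j\<in>I. (cmod (w - x j))\<^sup>2)) \<partial>lborel_Pi I) =
    ennreal (coulomb_partition t n * (gauss_moment t n * (t / pi * trunc_exp (Suc n) (t * (cmod w)\<^sup>2))))"
proof -
  have "(\<integral>\<^sup>+x. ennreal (coulomb_weight t I x * (\<Prod>j\<in>I. (cmod (w - x j))\<^sup>2)) \<partial>lborel_Pi I) =
    (\<integral>\<^sup>+x. ennreal (vandermonde_sq I x * (\<Prod>j\<in>I. (cmod (w - x j))\<^sup>2) * exp (- t * (\<Sum>j\<in>I. (cmod (x j))\<^sup>2))) \<partial>lborel_Pi I)"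
    by (simp add: coulomb_weight_def mult_ac)
  also have "\<dots> = ennreal (fact n * (\<Prod>k\<le>n. gauss_moment t k) * (\<Sum>k\<le>n. cmod w ^ (2 * k) / gauss_moment t k))"
    by (rule nn_integral_vandermonde_sq_mult[OF assms])
  also have "(\<Prod>k\<le>n. gauss_moment t k) = (\<Prod>k<n. gauss_moment t k) * gauss_moment t n"
    by (simp add: lessThan_Suc_atMost[symmetric])
  also have "(\<Sum>k\<le>n. cmod w ^ (2 * k) / gauss_moment t k) = t / pi * trunc_exp (Suc n) (t * (cmod w)\<^sup>2)"
    using sum_div_gauss_moment[OF assms(3), of w "Suc n"] by (simp add: lessThan_Suc_atMost)
  finally show ?thesis by (simp add: coulomb_partition_def mult_ac)
qed

text \<open>Up to normalisation this is the trace of the projection onto an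
  \<open>n\<close>-dimensional space: every monomial contributes the same mass
  \<open>pi / t\<close>.\<close>

lemma nn_integral_trunc_exp:
  assumes t: "0 < t"
  shows "(\<integral>\<^sup>+y. ennreal (exp (- t * (cmod y)\<^sup>2) * trunc_exp n (t * (cmod y)\<^sup>2)) \<partial>lborel) = ennreal (real n * pi / t)"
proof -
  have "(\<integral>\<^sup>+y. ennreal (exp (- t * (cmod y)\<^sup>2) * trunc_exp n (t * (cmod y)\<^sup>2)) \<partial>lborel) =
     (\<integral>\<^sup>+y. (\<Sum>k<n. ennreal (t ^ k / fact k) * ennreal (cmod y ^ (2 * k) * exp (- t * (cmod y)\<^sup>2))) \<partial>lborel)"
  proof (intro nn_integral_cong)
    fix y
    have "exp (- t * (cmod y)\<^sup>2) * trunc_exp n (t * (cmod y)\<^sup>2) = (\<Sum>k<n. (t ^ k / fact k) * (cmod y ^ (2 * k) * exp (- t * (cmod y)\<^sup>2)))"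
      unfolding trunc_exp_def sum_distrib_left power_mult
      by (intro sum.cong refl) (simp add: power_mult_distrib mult_ac)
    also have "ennreal \<dots> = (\<Sum>k<n. ennreal ((t ^ k / fact k) * (cmod y ^ (2 * k) * exp (- t * (cmod y)\<^sup>2))))"
      using t by (intro sum_ennreal[symmetric]) auto
    also have "\<dots> = (\<Sum>k<n. ennreal (t ^ k / fact k) * ennreal (cmod y ^ (2 * k) * exp (- t * (cmod y)\<^sup>2)))"
      using t by (intro sum.cong refl ennreal_mult) auto
    finally show "ennreal (exp (- t * (cmod y)\<^sup>2) * trunc_exp n (t * (cmod y)\<^sup>2)) = \<dots>" .
  qed
  also have "\<dots> = (\<Sum>k<n. ennreal (t ^ k / fact k) * (\<integral>\<^sup>+y. ennreal (cmod y ^ (2 * k) * exp (- t * (cmod y)\<^sup>2)) \<partial>lborel))"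
    by (subst nn_integral_sum, measurable) (intro sum.cong refl nn_integral_cmult, measurable)
  also have "\<dots> = (\<Sum>k<n. ennreal (t ^ k / fact k) * ennreal (gauss_moment t k))"
    by (simp only: nn_integral_gauss_moment[OF t])
  also have "\<dots> = (\<Sum>k<n. ennreal (pi / t))"
    using t gauss_moment_pos[OF t]
    by (intro sum.cong refl) (simp add: gauss_moment_def flip: ennreal_mult)
  also have "\<dots> = ennreal (real n * pi / t)"
    using t by (subst sum_ennreal) auto
  finally show ?thesis .
qed

text \<open>For a distinguished point \<open>y\<close>, the other points see the squared
  characteristic polynomial at \<open>y\<close>. Their integral is the second moment already
  computed, a multiple of the kernel diagonal at \<open>y\<close>, whose mass is
  \<open>n * pi / t\<close>. This avoids both induction and another determinant expansion.\<close>

lemma nn_integral_coulomb_weight: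
  fixes I :: "'i set"
  assumes fin: "finite I" and n: "card I = n" and t: "0 < t"
  shows "(\<integral>\<^sup>+x. ennreal (coulomb_weight t I x) \<partial>lborel_Pi I) = ennreal (coulomb_partition t n)"
proof (cases "I = {}")
  interpret product_sigma_finite "\<lambda>_::'i. lborel :: complex measure" ..
  case True
  thus ?thesis using n by (simp add: PiM_empty nn_integral_count_space_finite coulomb_weight_def vandermonde_sq_def coulomb_partition_def)
next
  interpret product_sigma_finite "\<lambda>_::'i. lborel :: complex measure" ..
  case False
  then obtain i where "i \<in> I" by blast
  define J where "J = I - {i}"
  define m where "m = n - 1"
  have J: "I = insert i J" "finite J" "i \<notin> J" using \<open>i \<in> I\<close> fin by (auto simp: J_def)
  have m: "card J = m" "n = Suc m" using n J by (auto simp: m_def)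
  define B where "B = coulomb_partition t m * gauss_moment t m * (t / pi)"
  have B: "0 \<le> B" unfolding B_def using coulomb_partition_pos[OF t, of m] gauss_moment_pos[OF t, of m] t by auto
  have "(\<integral>\<^sup>+x. ennreal (coulomb_weight t I x) \<partial>lborel_Pi I) =
     (\<integral>\<^sup>+y. (\<integral>\<^sup>+x. ennreal (coulomb_weight t (insert i J) (x(i := y))) \<partial>lborel_Pi J) \<partial>lborel)"
    unfolding J(1) using J by (intro product_nn_integral_insert_rev) auto
  also have "\<dots> = (\<integral>\<^sup>+y. ennreal B * ennreal (exp (- t * (cmod y)\<^sup>2) * trunc_exp n (t * (cmod y)\<^sup>2)) \<partial>lborel)"
  proof (intro nn_integral_cong)
    fix y
    have "(\<integral>\<^sup>+x. ennreal (coulomb_weight t (insert i J) (x(i := y))) \<partial>lborel_Pi J) =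
       (\<integral>\<^sup>+x. ennreal (exp (- t * (cmod y)\<^sup>2)) * ennreal (coulomb_weight t J x * (\<Prod>j\<in>J. (cmod (y - x j))\<^sup>2)) \<partial>lborel_Pi J)"
      unfolding coulomb_weight_insert[OF J(2,3)]
      by (intro nn_integral_cong ennreal_mult mult_nonneg_nonneg coulomb_weight_nonneg prod_nonneg) auto
    also have "\<dots> = ennreal (exp (- t * (cmod y)\<^sup>2)) * (\<integral>\<^sup>+x. ennreal (coulomb_weight t J x * (\<Prod>j\<in>J. (cmod (y - x j))\<^sup>2)) \<partial>lborel_Pi J)"
      by (rule nn_integral_cmult) measurable
    also have "\<dots> = ennreal (exp (- t * (cmod y)\<^sup>2)) * ennreal (B * trunc_exp n (t * (cmod y)\<^sup>2))"
      unfolding nn_integral_coulomb_weight_mult_sq[OF J(2) m(1) t] B_def m(2) by (simp add: mult_ac)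
    also have "\<dots> = ennreal B * ennreal (exp (- t * (cmod y)\<^sup>2) * trunc_exp n (t * (cmod y)\<^sup>2))"
      using B t trunc_exp_nonneg[of "t * (cmod y)\<^sup>2" n] by (simp add: mult_ac flip: ennreal_mult)
    finally show "(\<integral>\<^sup>+x. ennreal (coulomb_weight t (insert i J) (x(i := y))) \<partial>lborel_Pi J) = \<dots>" .
  qed
  also have "\<dots> = ennreal B * (\<integral>\<^sup>+y. ennreal (exp (- t * (cmod y)\<^sup>2) * trunc_exp n (t * (cmod y)\<^sup>2)) \<partial>lborel)"
    unfolding trunc_exp_def by (rule nn_integral_cmult) measurable
  also have "\<dots> = ennreal (B * (real n * pi / t))"
    unfolding nn_integral_trunc_exp[OF t] using B t by (simp flip: ennreal_mult)
  also have "B * (real n * pi / t) = coulomb_partition t n"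
    using t by (simp add: B_def m(2) coulomb_partition_def field_simps)
  finally show ?thesis .
qed

section \<open>The inverse characteristic polynomial\<close>

lemma Lagrange_interpolation:
  fixes x :: "nat \<Rightarrow> complex"
  assumes inj: "inj_on x {..<n}" and deg: "Polynomial.degree p < n"
  shows "poly p w = (\<Sum>j<n. poly p (x j) * (\<Prod>k\<in>{..<n} - {j}. (w - x k) / (x j - x k)))"
proof -
  define L where "L = (\<lambda>j. \<Prod>k\<in>{..<n} - {j}. Polynomial.smult (inverse (x j - x k)) [:- x k, 1:])"
  define Q where "Q = p - (\<Sum>j<n. Polynomial.smult (poly p (x j)) (L j))"
  have L: "poly (L j) w = (\<Prod>k\<in>{..<n} - {j}. (w - x k) / (x j - x k))" for j w
    by (simp add: L_def poly_prod divide_inverse algebra_simps)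
  have degL: "Polynomial.degree (L j) \<le> n - 1" if "j < n" for j
  proof -
    have "Polynomial.degree (L j) \<le> sum (Polynomial.degree \<circ> (\<lambda>k. Polynomial.smult (inverse (x j - x k)) [:- x k, 1:])) ({..<n} - {j})"
      unfolding L_def by (rule degree_prod_sum_le) simp
    also have "\<dots> \<le> (\<Sum>k\<in>{..<n} - {j}. 1)" by (intro sum_mono) (simp add: degree_smult_eq)
    also have "\<dots> = n - 1" using that by simp
    finally show ?thesis .
  qed
  have root: "poly Q (x i) = 0" if i: "i < n" for i
  proof -
    have "poly (L j) (x i) = (if j = i then 1 else 0)" if j: "j < n" for j
    proof (cases "j = i")
      case True
      thus ?thesis using inj i unfolding L by (auto simp: inj_on_def intro!: prod.neutral split: if_splits)
    next
      case False
      thus ?thesis using i unfolding L by (auto intro!: prod_zero bexI[of _ i])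
    qed
    hence "(\<Sum>j<n. poly p (x j) * poly (L j) (x i)) = (\<Sum>j<n. if j = i then poly p (x i) else 0)"
      by (intro sum.cong) auto
    also have "\<dots> = poly p (x i)" using i by simp
    finally show ?thesis by (simp add: Q_def poly_sum)
  qed
  have "Q = 0"
  proof (rule ccontr)
    assume nz: "Q \<noteq> 0"
    have "Polynomial.degree Q \<le> n - 1"
      unfolding Q_def using deg degL
      by (intro degree_diff_le degree_sum_le order.trans[OF degree_smult_le]) auto
    moreover have "card (x ` {..<n}) \<le> card {w. poly Q w = 0}"
      using nz root by (intro card_mono poly_roots_finite) auto
    moreover have "card (x ` {..<n}) = n" using inj by (simp add: card_image)
    ultimately show False using card_poly_roots_bound[OF nz] deg by linarith
  qed
  hence "poly p w = poly (\<Sum>j<n. Polynomial.smult (poly p (x j)) (L j)) w" by (simp add: Q_def)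
  thus ?thesis by (simp add: poly_sum L)
qed

text \<open>The reproducing kernel of the polynomials of degree less than \<open>n\<close> with respect to the weight \<open>exp (- t |z|\<^sup>2)\<close>,
  up to normalization.\<close>

definition kernel_poly :: "real \<Rightarrow> nat \<Rightarrow> complex \<Rightarrow> complex poly" where
  "kernel_poly t n w = (\<Sum>k<n. Polynomial.monom ((of_real t * cnj w) ^ k / fact k) k)"

lemma poly_kernel_poly: "poly (kernel_poly t n w) z = (\<Sum>k<n. (of_real t * cnj w * z) ^ k / fact k)"
  by (simp add: kernel_poly_def poly_sum poly_monom power_mult_distrib)

lemma poly_kernel_poly_self: "poly (kernel_poly t n w) w = of_real (trunc_exp n (t * (cmod w)\<^sup>2))"
proof -
  have eq: "of_real t * cnj w * w = of_real (t * (cmod w)\<^sup>2)"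
    using complex_norm_square[of w] by (simp add: mult_ac)
  show ?thesis unfolding poly_kernel_poly eq trunc_exp_def by simp
qed

lemma degree_kernel_poly: "0 < n \<Longrightarrow> Polynomial.degree (kernel_poly t n w) < n"
  unfolding kernel_poly_def
  by (intro degree_sum_less) (auto intro: le_less_trans[OF degree_monom_le])

text \<open>The Cauchy-Schwarz inequality \<open>|K(w, z)|^2 \<le> K(w, w) K(z, z)\<close> of a
  reproducing kernel.\<close>

lemma norm_kernel_poly_le:
  assumes t: "0 < t"
  shows "cmod (poly (kernel_poly t n w) z) \<le> sqrt (trunc_exp n (t * (cmod w)\<^sup>2)) * sqrt (trunc_exp n (t * (cmod z)\<^sup>2))"
proof -
  have "cmod (poly (kernel_poly t n w) z) \<le> (\<Sum>k<n. cmod ((of_real t * cnj w * z) ^ k / fact k))"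
    unfolding poly_kernel_poly by (rule norm_sum)
  also have "\<dots> = (\<Sum>k<n. sqrt ((t * (cmod w)\<^sup>2) ^ k / fact k) * sqrt ((t * (cmod z)\<^sup>2) ^ k / fact k))"
  proof (intro sum.cong refl)
    fix k
    have "(t * (cmod w)\<^sup>2) ^ k / fact k * ((t * (cmod z)\<^sup>2) ^ k / fact k) = ((t * cmod w * cmod z) ^ k / fact k)\<^sup>2"
      by (simp add: power_mult_distrib power_divide power2_eq_square)
    hence "sqrt ((t * (cmod w)\<^sup>2) ^ k / fact k) * sqrt ((t * (cmod z)\<^sup>2) ^ k / fact k) = \<bar>(t * cmod w * cmod z) ^ k / fact k\<bar>"
      by (simp only: real_sqrt_mult[symmetric] real_sqrt_abs)
    thus "cmod ((of_real t * cnj w * z) ^ k / fact k) = sqrt ((t * (cmod w)\<^sup>2) ^ k / fact k) * sqrt ((t * (cmod z)\<^sup>2) ^ k / fact k)"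
      using t by (simp add: norm_divide norm_power norm_mult abs_mult)
  qed
  also have "\<dots> \<le> sqrt ((\<Sum>k<n. (sqrt ((t * (cmod w)\<^sup>2) ^ k / fact k))\<^sup>2) * (\<Sum>k<n. (sqrt ((t * (cmod z)\<^sup>2) ^ k / fact k))\<^sup>2))"
    by (intro real_le_rsqrt Cauchy_Schwarz_ineq_sum)
  also have "\<dots> = sqrt (trunc_exp n (t * (cmod w)\<^sup>2)) * sqrt (trunc_exp n (t * (cmod z)\<^sup>2))"
    using t by (simp add: real_sqrt_mult trunc_exp_def)
  finally show ?thesis .
qed

lemma trunc_exp_pos:
  assumes "0 < n" "0 \<le> s"
  shows "0 < trunc_exp n s"
proof -
  have "(\<Sum>k\<in>{0}. s ^ k / fact k) \<le> (\<Sum>k<n. s ^ k / fact k)"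
    using assms by (intro sum_mono2) auto
  thus ?thesis by (simp add: trunc_exp_def)
qed

text \<open>Lagrange interpolation of \<open>kernel_poly t n w\<close> at the points \<open>x j\<close> turns the inverse characteristic polynomial
  into a sum over its residues, and the residue at \<open>x j\<close> is tamed by the repulsion between \<open>x j\<close> and the other points.\<close>

lemma coulomb_weight_inverse_le:
  fixes x :: "nat \<Rightarrow> complex"
  assumes inj: "inj_on x {..<n}" and w: "\<And>j. j < n \<Longrightarrow> x j \<noteq> w" and n: "0 < n" and t: "0 < t"
  shows "trunc_exp n (t * (cmod w)\<^sup>2) * (coulomb_weight t {..<n} x * (\<Prod>j<n. inverse (cmod (w - x j)))) \<le>
    (\<Sum>j<n. exp (- t * (cmod (x j))\<^sup>2) * (cmod (poly (kernel_poly t n w) (x j)) * inverse (cmod (w - x j))) *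
       (coulomb_weight t ({..<n} - {j}) x * (\<Prod>k\<in>{..<n} - {j}. cmod (x j - x k))))"
proof -
  define W where "W = coulomb_weight t {..<n} x * (\<Prod>j<n. inverse (cmod (w - x j)))"
  have W: "0 \<le> W" unfolding W_def by (intro mult_nonneg_nonneg coulomb_weight_nonneg prod_nonneg) auto
  have "trunc_exp n (t * (cmod w)\<^sup>2) = cmod (poly (kernel_poly t n w) w)"
    using t by (simp add: poly_kernel_poly_self trunc_exp_nonneg)
  also have "\<dots> \<le> (\<Sum>j<n. cmod (poly (kernel_poly t n w) (x j) * (\<Prod>k\<in>{..<n} - {j}. (w - x k) / (x j - x k))))"
    by (subst Lagrange_interpolation[OF inj degree_kernel_poly[OF n]]) (rule norm_sum)
  finally have "trunc_exp n (t * (cmod w)\<^sup>2) * W \<le> (\<Sum>j<n. cmod (poly (kernel_poly t n w) (x j) * (\<Prod>k\<in>{..<n} - {j}. (w - x k) / (x j - x k)))) * W"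
    using W by (rule mult_right_mono)
  also have "\<dots> = (\<Sum>j<n. exp (- t * (cmod (x j))\<^sup>2) * (cmod (poly (kernel_poly t n w) (x j)) * inverse (cmod (w - x j))) *
       (coulomb_weight t ({..<n} - {j}) x * (\<Prod>k\<in>{..<n} - {j}. cmod (x j - x k))))"
    unfolding sum_distrib_right
  proof (intro sum.cong refl)
    fix j assume "j \<in> {..<n}"
    hence j: "j < n" by simp
    define J where "J = {..<n} - {j}"
    have J: "{..<n} = insert j J" "finite J" "j \<notin> J" using j by (auto simp: J_def)
    define a where "a = (\<Prod>k\<in>J. cmod (w - x k))"
    define b where "b = (\<Prod>k\<in>J. cmod (x j - x k))"
    have "w \<noteq> x k" if "k \<in> J" for k using w[of k] that by (auto simp: J_def)
    hence a: "a \<noteq> 0" using J(2) by (simp add: a_def)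
    have "x j \<noteq> x k" if "k \<in> J" for k using inj_onD[OF inj, of j k] that j by (auto simp: J_def)
    hence b: "b \<noteq> 0" using J(2) by (simp add: b_def)
    \<comment> \<open>\<open>a\<close> cancels between the Lagrange basis polynomial and the inverse
      characteristic polynomial, which leaves only the pole at \<open>x j\<close>. The denominator
      \<open>b\<close> is paid for by one of the two powers of \<open>b\<close> in the
      density.\<close>
    have key: "P * (a / b) * (E * (V * b\<^sup>2) * (c * inverse a)) = E * (P * c) * (V * b)" for P E V c :: real
    proof -
      have "P * (a / b) * (E * (V * b\<^sup>2) * (c * inverse a)) = E * (P * c) * (V * b) * ((a * inverse a) * (b * inverse b))"
        by (simp only: power2_eq_square divide_inverse mult_ac)
      thus ?thesis using a b by simp
    qed
    have "coulomb_weight t {..<n} x = exp (- t * (cmod (x j))\<^sup>2) * (coulomb_weight t J x * b\<^sup>2)"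
      using coulomb_weight_insert[OF J(2,3), of t x "x j"] unfolding J(1) b_def by (simp add: prod_power_distrib)
    moreover have "(\<Prod>j<n. inverse (cmod (w - x j))) = inverse (cmod (w - x j)) * inverse a"
      unfolding J(1) a_def using J by (simp add: prod_inversef[symmetric] o_def)
    ultimately have W_eq: "W = exp (- t * (cmod (x j))\<^sup>2) * (coulomb_weight t J x * b\<^sup>2) * (inverse (cmod (w - x j)) * inverse a)"
      by (simp only: W_def)
    have "cmod (poly (kernel_poly t n w) (x j) * (\<Prod>k\<in>J. (w - x k) / (x j - x k))) = cmod (poly (kernel_poly t n w) (x j)) * (a / b)"
      unfolding a_def b_def by (simp add: norm_mult prod_norm[symmetric] norm_divide prod_dividef)
    thus "cmod (poly (kernel_poly t n w) (x j) * (\<Prod>k\<in>{..<n} - {j}. (w - x k) / (x j - x k))) * W =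
       exp (- t * (cmod (x j))\<^sup>2) * (cmod (poly (kernel_poly t n w) (x j)) * inverse (cmod (w - x j))) *
       (coulomb_weight t ({..<n} - {j}) x * (\<Prod>k\<in>{..<n} - {j}. cmod (x j - x k)))"
      unfolding J_def[symmetric] b_def[symmetric] by (simp only: W_eq key)
  qed
  finally show ?thesis by (simp add: W_def)
qed

text \<open>Cauchy-Schwarz between the moments of order 0 and 2, in the form
  \<open>q \<le> q^2 / (2 s) + s / 2\<close>. With \<open>s\<close> the root of the normalised
  second moment \<open>B\<close>, both halves contribute equally.\<close>

lemma nn_integral_coulomb_weight_mult_le:
  assumes fin: "finite J" and m: "card J = m" and t: "0 < t"
  shows "(\<integral>\<^sup>+x. ennreal (coulomb_weight t J x * (\<Prod>j\<in>J. cmod (y - x j))) \<partial>lborel_Pi J) \<le>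
    ennreal (coulomb_partition t m * sqrt (gauss_moment t m * (t / pi) * trunc_exp (Suc m) (t * (cmod y)\<^sup>2)))"
proof -
  define B where "B = gauss_moment t m * (t / pi) * trunc_exp (Suc m) (t * (cmod y)\<^sup>2)"
  define s where "s = sqrt B"
  have "0 < B" unfolding B_def using gauss_moment_pos[OF t, of m] trunc_exp_pos[of "Suc m" "t * (cmod y)\<^sup>2"] t by simp
  hence s: "0 < s" "B = s * s" by (auto simp: s_def)
  have "(\<integral>\<^sup>+x. ennreal (coulomb_weight t J x * (\<Prod>j\<in>J. cmod (y - x j))) \<partial>lborel_Pi J) \<le>
     (\<integral>\<^sup>+x. ennreal (1 / (2 * s)) * ennreal (coulomb_weight t J x * (\<Prod>j\<in>J. (cmod (y - x j))\<^sup>2)) + ennreal (s / 2) * ennreal (coulomb_weight t J x) \<partial>lborel_Pi J)"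
  proof (intro nn_integral_mono)
    fix x :: "'a \<Rightarrow> complex"
    define q where "q = (\<Prod>j\<in>J. cmod (y - x j))"
    have "0 \<le> (q - s)\<^sup>2 / (2 * s)" using s by simp
    hence "q \<le> 1 / (2 * s) * q\<^sup>2 + s / 2" using s by (simp add: field_simps power2_eq_square)
    hence "coulomb_weight t J x * q \<le> coulomb_weight t J x * (1 / (2 * s) * q\<^sup>2 + s / 2)"
      by (intro mult_left_mono coulomb_weight_nonneg)
    hence "ennreal (coulomb_weight t J x * q) \<le> ennreal (1 / (2 * s) * (coulomb_weight t J x * q\<^sup>2) + s / 2 * coulomb_weight t J x)"
      by (intro ennreal_leI) (simp add: algebra_simps)
    also have "\<dots> = ennreal (1 / (2 * s)) * ennreal (coulomb_weight t J x * q\<^sup>2) + ennreal (s / 2) * ennreal (coulomb_weight t J x)"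
      using s coulomb_weight_nonneg[of t J x] by (simp add: ennreal_plus[symmetric] ennreal_mult[symmetric] del: ennreal_plus)
    finally show "ennreal (coulomb_weight t J x * (\<Prod>j\<in>J. cmod (y - x j))) \<le>
      ennreal (1 / (2 * s)) * ennreal (coulomb_weight t J x * (\<Prod>j\<in>J. (cmod (y - x j))\<^sup>2)) + ennreal (s / 2) * ennreal (coulomb_weight t J x)"
      by (simp add: q_def prod_power_distrib)
  qed
  also have "\<dots> = (\<integral>\<^sup>+x. ennreal (1 / (2 * s)) * ennreal (coulomb_weight t J x * (\<Prod>j\<in>J. (cmod (y - x j))\<^sup>2)) \<partial>lborel_Pi J)
      + (\<integral>\<^sup>+x. ennreal (s / 2) * ennreal (coulomb_weight t J x) \<partial>lborel_Pi J)"
    by (rule nn_integral_add) measurable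
  also have "\<dots> = ennreal (1 / (2 * s)) * ennreal (coulomb_partition t m * (s * s)) + ennreal (s / 2) * ennreal (coulomb_partition t m)"
  proof (rule arg_cong2[where f = "(+)"])
    have "(\<integral>\<^sup>+x. ennreal (1 / (2 * s)) * ennreal (coulomb_weight t J x * (\<Prod>j\<in>J. (cmod (y - x j))\<^sup>2)) \<partial>lborel_Pi J)
      = ennreal (1 / (2 * s)) * (\<integral>\<^sup>+x. ennreal (coulomb_weight t J x * (\<Prod>j\<in>J. (cmod (y - x j))\<^sup>2)) \<partial>lborel_Pi J)"
      by (rule nn_integral_cmult) measurable
    also have "\<dots> = ennreal (1 / (2 * s)) * ennreal (coulomb_partition t m * (s * s))"
      unfolding nn_integral_coulomb_weight_mult_sq[OF fin m t] s(2)[symmetric] B_def by (simp only: mult_ac)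
    finally show "(\<integral>\<^sup>+x. ennreal (1 / (2 * s)) * ennreal (coulomb_weight t J x * (\<Prod>j\<in>J. (cmod (y - x j))\<^sup>2)) \<partial>lborel_Pi J) = \<dots>" .
    have "(\<integral>\<^sup>+x. ennreal (s / 2) * ennreal (coulomb_weight t J x) \<partial>lborel_Pi J)
      = ennreal (s / 2) * (\<integral>\<^sup>+x. ennreal (coulomb_weight t J x) \<partial>lborel_Pi J)"
      by (rule nn_integral_cmult) measurable
    thus "(\<integral>\<^sup>+x. ennreal (s / 2) * ennreal (coulomb_weight t J x) \<partial>lborel_Pi J) = ennreal (s / 2) * ennreal (coulomb_partition t m)"
      unfolding nn_integral_coulomb_weight[OF fin m t] .
  qed
  also have "\<dots> = ennreal (1 / (2 * s) * (coulomb_partition t m * (s * s)) + s / 2 * coulomb_partition t m)"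
  proof -
    have nonneg: "0 \<le> 1 / (2 * s)" "0 \<le> s / 2" "0 \<le> 1 / (2 * s) * (coulomb_partition t m * (s * s))" "0 \<le> s / 2 * coulomb_partition t m"
      using s(1) coulomb_partition_pos[OF t, of m] by auto
    show ?thesis
      unfolding ennreal_mult'[OF nonneg(1), symmetric] ennreal_mult'[OF nonneg(2), symmetric]
      by (rule ennreal_plus[OF nonneg(3,4), symmetric])
  qed
  also have "1 / (2 * s) * (coulomb_partition t m * (s * s)) + s / 2 * coulomb_partition t m = coulomb_partition t m * s"
    using s(1) by (simp add: field_simps)
  finally show ?thesis unfolding s_def B_def .
qed

text \<open>The induction step rests on \<open>(1 - 1 / (n + 1)) ^ (n + 1) \<le> exp (-1)\<close>.
  The factor \<open>n\<close>, instead of the root of \<open>n\<close> in Stirling's formula, is the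
  source of the linear growth in the bound for the moment of order 2.\<close>

lemma fact_mult_exp_le: "0 < n \<Longrightarrow> fact n * exp (real n) \<le> exp 1 * real n * real n ^ n"
proof (induction n rule: nat_induct_non_zero)
  case (Suc n)
  have "1 - 1 / real (Suc n) \<le> exp (- (1 / real (Suc n)))"
    using exp_ge_add_one_self[of "- (1 / real (Suc n))"] by simp
  hence "(1 - 1 / real (Suc n)) ^ Suc n \<le> exp (- (1 / real (Suc n))) ^ Suc n"
    by (intro power_mono) auto
  also have "\<dots> = exp (- 1)" by (subst exp_of_nat_mult[symmetric]) (simp del: of_nat_Suc)
  finally have "(1 - 1 / real (Suc n)) ^ Suc n * real (Suc n) ^ Suc n \<le> exp (- 1) * real (Suc n) ^ Suc n"
    by (intro mult_right_mono) auto
  also have "(1 - 1 / real (Suc n)) ^ Suc n * real (Suc n) ^ Suc n = real n ^ Suc n"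
    unfolding power_mult_distrib[symmetric] by (simp add: left_diff_distrib)
  finally have 1: "exp 1 * real n ^ Suc n \<le> real (Suc n) ^ Suc n"
    by (simp add: exp_minus field_simps)
  have "fact (Suc n) * exp (real (Suc n)) = real (Suc n) * exp 1 * (fact n * exp (real n))"
    by (simp add: exp_add algebra_simps)
  also have "\<dots> \<le> real (Suc n) * exp 1 * (exp 1 * real n * real n ^ n)"
    using Suc.IH by (intro mult_left_mono) auto
  also have "\<dots> = real (Suc n) * exp 1 * (exp 1 * real n ^ Suc n)" by (simp add: mult_ac)
  also have "\<dots> \<le> real (Suc n) * exp 1 * real (Suc n) ^ Suc n"
    using 1 by (intro mult_left_mono) auto
  finally show ?case by (simp add: mult_ac)
qed simp

lemma power_le_fact_mult_exp: "real n ^ n \<le> fact n * exp (real n)"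
proof -
  have "(\<Sum>k\<in>{n}. real n ^ k / fact k) \<le> trunc_exp (Suc n) (real n)"
    unfolding trunc_exp_def by (intro sum_mono2) auto
  also have "\<dots> \<le> exp (real n)" by (rule trunc_exp_le_exp) simp
  finally show ?thesis by (simp add: field_simps)
qed

text \<open>Split at distance 1 from \<open>w\<close>: outside, the pole is at most 1 and the
  density has total mass \<open>n * pi / t\<close>; inside, the density is at most 1 because the
  truncated series is below \<open>exp\<close>, and the pole has mass \<open>2 * pi\<close>.\<close>

lemma nn_integral_kernel_le:
  assumes t: "0 < t"
  shows "(\<integral>\<^sup>+y. ennreal (exp (- t * (cmod y)\<^sup>2) * trunc_exp n (t * (cmod y)\<^sup>2) * inverse (cmod (w - y))) \<partial>lborel) \<le> ennreal (real n * pi / t + 2 * pi)"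
proof -
  have [measurable]: "ball w 1 \<in> sets borel" by simp
  have [measurable]: "(\<lambda>y. trunc_exp n (t * (cmod y)\<^sup>2)) \<in> borel_measurable borel"
    unfolding trunc_exp_def by measurable
  define D where "D = (\<lambda>y. exp (- t * (cmod y)\<^sup>2) * trunc_exp n (t * (cmod y)\<^sup>2))"
  have D: "0 \<le> D y" "D y \<le> 1" for y
  proof -
    have s: "0 \<le> t * (cmod y)\<^sup>2" using t by simp
    show "0 \<le> D y" unfolding D_def using trunc_exp_nonneg[OF s] by simp
    have "D y \<le> exp (- t * (cmod y)\<^sup>2) * exp (t * (cmod y)\<^sup>2)"
      unfolding D_def using trunc_exp_le_exp[OF s] by (intro mult_left_mono) auto
    thus "D y \<le> 1" by (simp add: exp_add[symmetric])
  qed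
  have "(\<integral>\<^sup>+y. ennreal (D y * inverse (cmod (w - y))) \<partial>lborel) \<le>
     (\<integral>\<^sup>+y. ennreal (D y) + indicator (ball w 1) y * ennreal (inverse (cmod (w - y))) \<partial>lborel)"
  proof (intro nn_integral_mono)
    fix y
    show "ennreal (D y * inverse (cmod (w - y))) \<le> ennreal (D y) + indicator (ball w 1) y * ennreal (inverse (cmod (w - y)))"
    proof (cases "y \<in> ball w 1")
      case True
      have "D y * inverse (cmod (w - y)) \<le> 1 * inverse (cmod (w - y))"
        using D by (intro mult_right_mono) auto
      hence "ennreal (D y * inverse (cmod (w - y))) \<le> ennreal (inverse (cmod (w - y)))" by (intro ennreal_leI) simp
      also have "\<dots> \<le> ennreal (D y) + ennreal (inverse (cmod (w - y)))" by simp
      finally show ?thesis using True by simp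
    next
      case False
      hence "1 \<le> cmod (w - y)" by (simp add: dist_norm)
      hence "inverse (cmod (w - y)) \<le> 1" by (simp add: inverse_le_1_iff)
      hence "D y * inverse (cmod (w - y)) \<le> D y * 1" using D by (intro mult_left_mono) auto
      thus ?thesis using False by (simp add: ennreal_leI)
    qed
  qed
  also have "\<dots> = (\<integral>\<^sup>+y. ennreal (D y) \<partial>lborel) + (\<integral>\<^sup>+y. indicator (ball w 1) y * ennreal (inverse (cmod (w - y))) \<partial>lborel)"
    by (rule nn_integral_add) (auto simp: D_def)
  also have "\<dots> = ennreal (real n * pi / t) + ennreal (2 * pi)"
    unfolding D_def nn_integral_trunc_exp[OF t] using nn_integral_inverse_cmod_ball[of 1 w] by simp
  also have "\<dots> = ennreal (real n * pi / t + 2 * pi)" using t by (simp add: ennreal_plus)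
  finally show ?thesis unfolding D_def .
qed

text \<open>With \<open>y\<close> in place of \<open>x j\<close>, integrating the other
  \<open>n - 1\<close> points gives the root of the kernel of \<open>n\<close> monomials at
  \<open>y\<close>, since \<open>Suc (n - 1) = n\<close>. Cauchy-Schwarz for the interpolated kernel
  supplies the same root once more. Their product is the full kernel diagonal, which the Gaussian
  weight turns into a bounded integrable density.\<close>

lemma nn_integral_coulomb_weight_residue_le:
  fixes n :: nat and w :: complex
  assumes j: "j < n" and t: "0 < t"
  defines "c \<equiv> coulomb_partition t (n - 1) * sqrt (gauss_moment t (n - 1) * (t / pi)) * sqrt (trunc_exp n (t * (cmod w)\<^sup>2))"
  shows "(\<integral>\<^sup>+x. ennreal (exp (- t * (cmod (x j))\<^sup>2) * (cmod (poly (kernel_poly t n w) (x j)) * inverse (cmod (w - x j))) *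
       (coulomb_weight t ({..<n} - {j}) x * (\<Prod>k\<in>{..<n} - {j}. cmod (x j - x k)))) \<partial>lborel_Pi {..<n}) \<le>
    ennreal (c * (real n * pi / t + 2 * pi))"
proof -
  interpret product_sigma_finite "\<lambda>_::nat. lborel :: complex measure" ..
  define J where "J = {..<n} - {j}"
  have J: "{..<n} = insert j J" "finite J" "j \<notin> J" "card J = n - 1" "Suc (n - 1) = n" using j by (auto simp: J_def)
  have meas_J: "(\<lambda>x. ennreal (coulomb_weight t J x * (\<Prod>k\<in>J. cmod (y - x k)))) \<in> borel_measurable (lborel_Pi J)" for y
    by measurable
  define V where "V = (\<lambda>y. \<integral>\<^sup>+x. ennreal (coulomb_weight t J x * (\<Prod>k\<in>J. cmod (y - x k))) \<partial>lborel_Pi J)"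
  define R where "R = (\<lambda>y. exp (- t * (cmod y)\<^sup>2) * (cmod (poly (kernel_poly t n w) y) * inverse (cmod (w - y))))"
  have R: "0 \<le> R y" for y by (simp add: R_def)
  have [measurable]: "(\<lambda>y. poly (kernel_poly t n w) y) \<in> borel_measurable borel"
    unfolding poly_kernel_poly by measurable
  have [measurable]: "R \<in> borel_measurable borel" unfolding R_def by measurable
  have [measurable]: "(\<lambda>y. trunc_exp n (t * (cmod y)\<^sup>2)) \<in> borel_measurable borel"
    unfolding trunc_exp_def by measurable
  have meas_K: "(\<lambda>y. ennreal (exp (- t * (cmod y)\<^sup>2) * trunc_exp n (t * (cmod y)\<^sup>2) * inverse (cmod (w - y)))) \<in> borel_measurable lborel"
    by measurable
  have c: "0 \<le> c" unfolding c_def using coulomb_partition_pos[OF t, of "n - 1"] gauss_moment_pos[OF t, of "n - 1"] t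
      trunc_exp_nonneg[of "t * (cmod w)\<^sup>2" n] by simp
  have [measurable]: "(\<lambda>x. x k) \<in> borel_measurable (lborel_Pi (insert j J))" if "k \<in> insert j J" for k
    using measurable_component_singleton[OF that, of "\<lambda>_. lborel :: complex measure"] by simp
  have [measurable]: "coulomb_weight t J \<in> borel_measurable (lborel_Pi (insert j J))"
    unfolding coulomb_weight_def[abs_def] vandermonde_sq_def[abs_def]
    by (intro borel_measurable_times borel_measurable_prod borel_measurable_sum borel_measurable_exp borel_measurable_norm
         borel_measurable_diff borel_measurable_power borel_measurable_const measurable_compose[OF _ borel_measurable_exp]) simp_all
  have "(\<integral>\<^sup>+x. ennreal (R (x j) * (coulomb_weight t J x * (\<Prod>k\<in>J. cmod (x j - x k)))) \<partial>lborel_Pi (insert j J)) =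
     (\<integral>\<^sup>+y. (\<integral>\<^sup>+x. ennreal (R ((x(j := y)) j) * (coulomb_weight t J (x(j := y)) * (\<Prod>k\<in>J. cmod ((x(j := y)) j - (x(j := y)) k)))) \<partial>lborel_Pi J) \<partial>lborel)"
    by (rule product_nn_integral_insert_rev[OF J(2,3)]) measurable
  also have "\<dots> = (\<integral>\<^sup>+y. ennreal (R y) * V y \<partial>lborel)"
  proof (intro nn_integral_cong)
    fix y
    have "R ((x(j := y)) j) * (coulomb_weight t J (x(j := y)) * (\<Prod>k\<in>J. cmod ((x(j := y)) j - (x(j := y)) k))) =
       R y * (coulomb_weight t J x * (\<Prod>k\<in>J. cmod (y - x k)))" for x
    proof -
      have "vandermonde_sq J (x(j := y)) = vandermonde_sq J x" using J by (intro vandermonde_sq_cong) auto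
      moreover have "(\<Sum>k\<in>J. (cmod ((x(j := y)) k))\<^sup>2) = (\<Sum>k\<in>J. (cmod (x k))\<^sup>2)" using J by (intro sum.cong) auto
      moreover have "(\<Prod>k\<in>J. cmod ((x(j := y)) j - (x(j := y)) k)) = (\<Prod>k\<in>J. cmod (y - x k))" using J by (intro prod.cong) auto
      ultimately show ?thesis by (simp only: coulomb_weight_def fun_upd_same)
    qed
    hence "(\<integral>\<^sup>+x. ennreal (R ((x(j := y)) j) * (coulomb_weight t J (x(j := y)) * (\<Prod>k\<in>J. cmod ((x(j := y)) j - (x(j := y)) k)))) \<partial>lborel_Pi J)
      = (\<integral>\<^sup>+x. ennreal (R y) * ennreal (coulomb_weight t J x * (\<Prod>k\<in>J. cmod (y - x k))) \<partial>lborel_Pi J)"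
      using R[of y] by (simp only: ennreal_mult'[OF R])
    also have "\<dots> = ennreal (R y) * V y"
      unfolding V_def by (rule nn_integral_cmult[OF meas_J])
    finally show "(\<integral>\<^sup>+x. ennreal (R ((x(j := y)) j) * (coulomb_weight t J (x(j := y)) * (\<Prod>k\<in>J. cmod ((x(j := y)) j - (x(j := y)) k)))) \<partial>lborel_Pi J) = \<dots>" .
  qed
  also have "\<dots> \<le> (\<integral>\<^sup>+y. ennreal c * ennreal (exp (- t * (cmod y)\<^sup>2) * trunc_exp n (t * (cmod y)\<^sup>2) * inverse (cmod (w - y))) \<partial>lborel)"
  proof (intro nn_integral_mono)
    fix y
    define k where "k = sqrt (trunc_exp n (t * (cmod y)\<^sup>2))"
    have k: "0 \<le> k" "trunc_exp n (t * (cmod y)\<^sup>2) = k * k"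
      using trunc_exp_nonneg[of "t * (cmod y)\<^sup>2" n] t by (auto simp: k_def)
    define P where "P = coulomb_partition t (n - 1)"
    define g where "g = sqrt (gauss_moment t (n - 1) * (t / pi))"
    have P: "0 \<le> P" unfolding P_def using coulomb_partition_pos[OF t, of "n - 1"] by simp
    have g: "0 \<le> g" unfolding g_def using gauss_moment_pos[OF t, of "n - 1"] t by simp
    have "V y \<le> ennreal (P * (g * k))"
      using nn_integral_coulomb_weight_mult_le[OF J(2,4) t, of y] unfolding J(5) P_def g_def k_def V_def by (simp only: real_sqrt_mult mult.assoc)
    hence "ennreal (R y) * V y \<le> ennreal (R y) * ennreal (P * (g * k))"
      by (rule mult_left_mono) simp
    also have "\<dots> = ennreal (R y * (P * (g * k)))" by (rule ennreal_mult'[OF R, symmetric])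
    also have "\<dots> \<le> ennreal (c * (exp (- t * (cmod y)\<^sup>2) * (k * k) * inverse (cmod (w - y))))"
    proof (rule ennreal_leI)
      have "cmod (poly (kernel_poly t n w) y) \<le> sqrt (trunc_exp n (t * (cmod w)\<^sup>2)) * k"
        unfolding k_def by (rule norm_kernel_poly_le[OF t])
      hence "cmod (poly (kernel_poly t n w) y) * inverse (cmod (w - y)) \<le> (sqrt (trunc_exp n (t * (cmod w)\<^sup>2)) * k) * inverse (cmod (w - y))"
        by (rule mult_right_mono) simp
      hence "R y \<le> exp (- t * (cmod y)\<^sup>2) * ((sqrt (trunc_exp n (t * (cmod w)\<^sup>2)) * k) * inverse (cmod (w - y)))"
        unfolding R_def by (rule mult_left_mono) simp
      moreover have "0 \<le> P * (g * k)" using P g k(1) by (intro mult_nonneg_nonneg)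
      ultimately have "R y * (P * (g * k)) \<le> (exp (- t * (cmod y)\<^sup>2) * ((sqrt (trunc_exp n (t * (cmod w)\<^sup>2)) * k) * inverse (cmod (w - y)))) * (P * (g * k))"
        by (rule mult_right_mono)
      also have "\<dots> = c * (exp (- t * (cmod y)\<^sup>2) * (k * k) * inverse (cmod (w - y)))"
        unfolding c_def P_def[symmetric] g_def[symmetric] by (simp only: mult_ac)
      finally show "R y * (P * (g * k)) \<le> c * (exp (- t * (cmod y)\<^sup>2) * (k * k) * inverse (cmod (w - y)))" .
    qed
    also have "\<dots> = ennreal c * ennreal (exp (- t * (cmod y)\<^sup>2) * trunc_exp n (t * (cmod y)\<^sup>2) * inverse (cmod (w - y)))"
      unfolding k(2)[symmetric] by (rule ennreal_mult'[OF c])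
    finally show "ennreal (R y) * V y \<le> \<dots>" .
  qed
  also have "\<dots> = ennreal c * (\<integral>\<^sup>+y. ennreal (exp (- t * (cmod y)\<^sup>2) * trunc_exp n (t * (cmod y)\<^sup>2) * inverse (cmod (w - y))) \<partial>lborel)"
    by (rule nn_integral_cmult[OF meas_K])
  also have "\<dots> \<le> ennreal c * ennreal (real n * pi / t + 2 * pi)"
    by (intro mult_left_mono nn_integral_kernel_le[OF t]) auto
  also have "\<dots> = ennreal (c * (real n * pi / t + 2 * pi))" by (rule ennreal_mult'[OF c, symmetric])
  finally show ?thesis unfolding J(1)[symmetric] J_def[symmetric] R_def .
qed

section \<open>The moment of order -1\<close>

lemma coulomb_partition_Suc: "coulomb_partition t (Suc n) = real (Suc n) * gauss_moment t n * coulomb_partition t n"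
  by (simp add: coulomb_partition_def algebra_simps)

text \<open>All \<open>n\<close> residues have the same bound, proportional to
  \<open>sqrt K\<close>, and interpolation divides by \<open>K\<close>, so the decay is
  \<open>1 / sqrt K\<close>. Inside the disk of radius \<open>r\<close>, at most a proportion
  \<open>r^2\<close> of the exponential series is cut off; the lower bound for \<open>K\<close>
  therefore still has the full exponential rate.\<close>

lemma nn_integral_coulomb_weight_inverse_le:
  fixes w :: complex
  assumes n: "0 < n" and w: "cmod w \<le> r" and r: "0 < r" "r < 1"
  shows "(\<integral>\<^sup>+x. ennreal (coulomb_weight (real n) {..<n} x * (\<Prod>j<n. inverse (cmod (w - x j)))) \<partial>lborel_Pi {..<n}) \<le>
    ennreal (coulomb_partition (real n) n * (3 * real n / sqrt (1 - r\<^sup>2) * exp (real n * (1 - (cmod w)\<^sup>2) / 2)))"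
proof -
  define t where "t = real n"
  define K where "K = trunc_exp n (t * (cmod w)\<^sup>2)"
  define h where "h = gauss_moment t (n - 1)"
  define Z where "Z = coulomb_partition t (n - 1)"
  define T where "T = (\<lambda>j x. exp (- t * (cmod (x j))\<^sup>2) * (cmod (poly (kernel_poly t n w) (x j)) * inverse (cmod (w - x j))) *
       (coulomb_weight t ({..<n} - {j}) x * (\<Prod>k\<in>{..<n} - {j}. cmod (x j - x k))))"
  have t: "0 < t" using n by (simp add: t_def)
  have h: "0 < h" unfolding h_def by (rule gauss_moment_pos[OF t])
  have Z: "0 < Z" unfolding Z_def by (rule coulomb_partition_pos[OF t])
  have K: "0 < K" unfolding K_def using n t by (intro trunc_exp_pos) auto
  have T0: "0 \<le> T j x" for j x
    unfolding T_def by (intro mult_nonneg_nonneg prod_nonneg coulomb_weight_nonneg) auto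
  have r2: "r\<^sup>2 < 1" using r by (simp add: power_less_one_iff abs_square_less_1)
  have [measurable]: "(\<lambda>x. ennreal (T j x)) \<in> borel_measurable (lborel_Pi {..<n})" if j: "j < n" for j
  proof -
    have [measurable]: "(\<lambda>x. x k) \<in> borel_measurable (lborel_Pi {..<n})" if "k < n" for k
      using measurable_component_singleton[of k "{..<n}" "\<lambda>_. lborel :: complex measure"] that by simp
    show ?thesis unfolding T_def poly_kernel_poly coulomb_weight_def vandermonde_sq_def
      using j by (intro measurable_compose[OF _ measurable_ennreal] borel_measurable_times borel_measurable_prod borel_measurable_sum
          borel_measurable_diff borel_measurable_power borel_measurable_const borel_measurable_inverse borel_measurable_divide
          measurable_compose[OF _ borel_measurable_exp] measurable_compose[OF _ borel_measurable_norm]) simp_all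
  qed
  have "(\<integral>\<^sup>+x. ennreal (coulomb_weight t {..<n} x * (\<Prod>j<n. inverse (cmod (w - x j)))) \<partial>lborel_Pi {..<n}) \<le>
     (\<integral>\<^sup>+x. ennreal (1 / K) * (\<Sum>j<n. ennreal (T j x)) \<partial>lborel_Pi {..<n})"
  proof (rule nn_integral_mono_AE)
    show "AE x in lborel_Pi {..<n}. ennreal (coulomb_weight t {..<n} x * (\<Prod>j<n. inverse (cmod (w - x j)))) \<le>
       ennreal (1 / K) * (\<Sum>j<n. ennreal (T j x))"
      using AE_lborel_Pi_inj[OF finite_lessThan] AE_lborel_Pi_avoid[OF finite_lessThan[of n], of w]
    proof eventually_elim
      fix x :: "nat \<Rightarrow> complex" assume x: "inj_on x {..<n}" "\<forall>j\<in>{..<n}. x j \<noteq> w"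
      have "K * (coulomb_weight t {..<n} x * (\<Prod>j<n. inverse (cmod (w - x j)))) \<le> (\<Sum>j<n. T j x)"
        unfolding K_def T_def using x n t by (intro coulomb_weight_inverse_le) auto
      hence "coulomb_weight t {..<n} x * (\<Prod>j<n. inverse (cmod (w - x j))) \<le> 1 / K * (\<Sum>j<n. T j x)"
        using K by (simp add: field_simps)
      hence "ennreal (coulomb_weight t {..<n} x * (\<Prod>j<n. inverse (cmod (w - x j)))) \<le> ennreal (1 / K * (\<Sum>j<n. T j x))"
        by (rule ennreal_leI)
      also have "\<dots> = ennreal (1 / K) * ennreal (\<Sum>j<n. T j x)" using K by (intro ennreal_mult') simp
      also have "ennreal (\<Sum>j<n. T j x) = (\<Sum>j<n. ennreal (T j x))" using T0 by (intro sum_ennreal[symmetric]) auto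
      finally show "ennreal (coulomb_weight t {..<n} x * (\<Prod>j<n. inverse (cmod (w - x j)))) \<le> ennreal (1 / K) * (\<Sum>j<n. ennreal (T j x))" .
    qed
  qed
  also have "\<dots> = ennreal (1 / K) * (\<integral>\<^sup>+x. (\<Sum>j<n. ennreal (T j x)) \<partial>lborel_Pi {..<n})"
    by (rule nn_integral_cmult) simp
  also have "\<dots> = ennreal (1 / K) * (\<Sum>j<n. \<integral>\<^sup>+x. ennreal (T j x) \<partial>lborel_Pi {..<n})"
    by (subst nn_integral_sum) auto
  also have "\<dots> \<le> ennreal (1 / K) * (\<Sum>j<n. ennreal (Z * sqrt (h * (t / pi)) * sqrt K * (real n * pi / t + 2 * pi)))"
    unfolding T_def Z_def h_def K_def
    by (intro mult_left_mono sum_mono nn_integral_coulomb_weight_residue_le t) auto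
  also have "\<dots> = ennreal (1 / K * (real n * (Z * sqrt (h * (t / pi)) * sqrt K * (3 * pi))))"
  proof -
    \<comment> \<open>Origin of the constant 3: at \<open>t = n\<close> the one-point density has
      total mass \<open>pi\<close>, and the pole adds \<open>2 * pi\<close>.\<close>
    have eq: "real n * pi / t + 2 * pi = 3 * pi" using n by (simp add: t_def)
    have "(\<Sum>j<n. ennreal (Z * sqrt (h * (t / pi)) * sqrt K * (3 * pi))) = ennreal (\<Sum>j<n. Z * sqrt (h * (t / pi)) * sqrt K * (3 * pi))"
      using Z h K t by (intro sum_ennreal) auto
    thus ?thesis unfolding eq using K by (simp add: ennreal_mult'[symmetric])
  qed
  also have "\<dots> \<le> ennreal (coulomb_partition t n * (3 * real n / sqrt (1 - r\<^sup>2) * exp (t * (1 - (cmod w)\<^sup>2) / 2)))"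
  proof (rule ennreal_leI)
    have Zn: "coulomb_partition t n = real n * h * Z"
      using coulomb_partition_Suc[of t "n - 1"] n by (simp add: h_def Z_def)
    have "(1 - r\<^sup>2) * exp (t * (cmod w)\<^sup>2) \<le> (1 - t * (cmod w)\<^sup>2 / real n) * exp (t * (cmod w)\<^sup>2)"
      using w n by (intro mult_right_mono) (auto simp: t_def intro!: power_mono)
    also have "\<dots> \<le> K" unfolding K_def using t n by (intro trunc_exp_ge) auto
    finally have K_ge: "(1 - r\<^sup>2) * exp (t * (cmod w)\<^sup>2) \<le> K" .
    have "h = pi * fact (n - 1) / t ^ n" using n by (simp add: h_def gauss_moment_def)
    hence hn: "h * (real n * t ^ n) = pi * fact n" using n t by (simp add: fact_reduce field_simps)
    \<comment> \<open>The lower Stirling bound shows that \<open>h * n\<close> decays no faster than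
      \<open>exp (- t)\<close>. It compensates the passage from \<open>n - 1\<close> to
      \<open>n\<close> points in the partition function, where \<open>h\<close> appears to the first
      power but its root in the residue bound.\<close>
    have "pi * t ^ n \<le> pi * fact n * exp t"
      using power_le_fact_mult_exp[of n] by (simp add: t_def)
    also have "\<dots> = h * real n * t ^ n * exp t" unfolding hn[symmetric] by simp
    finally have "pi \<le> h * real n * exp t" using t by (simp add: field_simps)
    moreover have "1 - r\<^sup>2 \<le> exp (- (t * (cmod w)\<^sup>2)) * K"
    proof -
      have "exp (- (t * (cmod w)\<^sup>2)) * ((1 - r\<^sup>2) * exp (t * (cmod w)\<^sup>2)) \<le> exp (- (t * (cmod w)\<^sup>2)) * K"
        using K_ge by (intro mult_left_mono) auto
      moreover have "exp (- (t * (cmod w)\<^sup>2)) * ((1 - r\<^sup>2) * exp (t * (cmod w)\<^sup>2)) = 1 - r\<^sup>2"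
        by (simp add: exp_minus)
      ultimately show ?thesis by (simp only:)
    qed
    ultimately have main: "pi * (1 - r\<^sup>2) \<le> (h * real n * exp t) * (exp (- (t * (cmod w)\<^sup>2)) * K)"
      using r2 h by (intro mult_mono) auto
    define E where "E = exp (t * (1 - (cmod w)\<^sup>2) / 2)"
    have E2: "E\<^sup>2 = exp t * exp (- (t * (cmod w)\<^sup>2))"
    proof -
      have "E\<^sup>2 = exp (2 * (t * (1 - (cmod w)\<^sup>2) / 2))" unfolding E_def by (rule exp_double[symmetric])
      also have "2 * (t * (1 - (cmod w)\<^sup>2) / 2) = t + - (t * (cmod w)\<^sup>2)" by (simp add: right_diff_distrib)
      finally show ?thesis by (simp only: exp_add)
    qed
    have E0: "0 < E" by (simp add: E_def)
    define q where "q = sqrt (1 - r\<^sup>2)"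
    define k where "k = sqrt K"
    define g where "g = sqrt (h * (t / pi))"
    have q: "0 < q" "q\<^sup>2 = 1 - r\<^sup>2" using r2 by (auto simp: q_def)
    have k: "0 < k" "k\<^sup>2 = K" using K by (auto simp: k_def)
    have g: "0 < g" "g\<^sup>2 = h * (t / pi)" using h t by (auto simp: g_def)
    \<comment> \<open>Squaring removes the roots in \<open>g\<close>, \<open>q\<close> and
      \<open>k\<close> and the factor 1/2 in the exponent of \<open>E\<close>, and leaves exactly
      \<open>main\<close> times \<open>h * t\<close>.\<close>
    have "(pi * g * q)\<^sup>2 = h * t * (pi * (1 - r\<^sup>2))"
      unfolding power_mult_distrib q(2) g(2) by (simp add: power2_eq_square)
    also have "\<dots> \<le> h * t * ((h * real n * exp t) * (exp (- (t * (cmod w)\<^sup>2)) * K))"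
      using main h t by (intro mult_left_mono) auto
    also have "\<dots> = (h * real n * E * k)\<^sup>2"
      unfolding power_mult_distrib k(2) E2 by (simp add: t_def power2_eq_square)
    finally have "pi * g * q \<le> h * real n * E * k"
      by (rule power2_le_imp_le) (use h E0 k in auto)
    hence "pi * g / k \<le> h * real n * E / q" using k(1) q(1) by (simp add: field_simps)
    hence "3 * real n * Z * (pi * g / k) \<le> 3 * real n * Z * (h * real n * E / q)"
      using Z by (intro mult_left_mono) auto
    moreover have "1 / K * (real n * (Z * g * k * (3 * pi))) = 3 * real n * Z * (pi * g / k)"
      unfolding k(2)[symmetric] using k(1) by (simp add: power2_eq_square field_simps)
    ultimately show "1 / K * (real n * (Z * sqrt (h * (t / pi)) * sqrt K * (3 * pi))) \<le>
        coulomb_partition t n * (3 * real n / sqrt (1 - r\<^sup>2) * exp (t * (1 - (cmod w)\<^sup>2) / 2))"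
      unfolding Zn q_def[symmetric] k_def[symmetric] g_def[symmetric] E_def[symmetric] by (simp add: mult_ac)
  qed
  finally show ?thesis unfolding t_def .
qed

section \<open>The Ginibre measure\<close>

lemma exp_log_field:
  assumes "\<And>j. j < n \<Longrightarrow> x j \<noteq> w"
  shows "exp (2 * log_field n x w) = exp (real n * (1 - (cmod w)\<^sup>2)) * (\<Prod>j<n. (cmod (w - x j))\<^sup>2)"
    and "exp (- log_field n x w) = exp (- (real n * (1 - (cmod w)\<^sup>2) / 2)) * (\<Prod>j<n. inverse (cmod (w - x j)))"
proof -
  have 1: "exp (\<Sum>j<n. ln (cmod (x j - w))) = (\<Prod>j<n. cmod (w - x j))"
  proof -
    have "exp (ln (cmod (x j - w))) = cmod (w - x j)" if "j < n" for j
      using assms[OF that] by (simp add: norm_minus_commute)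
    thus ?thesis by (simp add: exp_sum)
  qed
  have 2: "2 * log_field n x w = real n * (1 - (cmod w)\<^sup>2) + (\<Sum>j<n. ln (cmod (x j - w))) + (\<Sum>j<n. ln (cmod (x j - w)))"
    by (simp add: log_field_def field_simps)
  show "exp (2 * log_field n x w) = exp (real n * (1 - (cmod w)\<^sup>2)) * (\<Prod>j<n. (cmod (w - x j))\<^sup>2)"
    unfolding 2 exp_add 1 by (simp add: power2_eq_square prod.distrib)
  have 3: "- log_field n x w = - (real n * (1 - (cmod w)\<^sup>2) / 2) + - (\<Sum>j<n. ln (cmod (x j - w)))"
    by (simp add: log_field_def field_simps)
  have "exp (- (\<Sum>j<n. ln (cmod (x j - w)))) = (\<Prod>j<n. inverse (cmod (w - x j)))"
    unfolding exp_minus 1 by (simp add: prod_inversef[symmetric] o_def)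
  thus "exp (- log_field n x w) = exp (- (real n * (1 - (cmod w)\<^sup>2) / 2)) * (\<Prod>j<n. inverse (cmod (w - x j)))"
    unfolding 3 exp_add by simp
qed

lemma exp_half_abs_le: "exp (\<bar>a\<bar> / 2) \<le> 1 + exp (2 * a) + exp (- a)" for a :: real
proof (cases "0 \<le> a")
  case True
  hence "exp (\<bar>a\<bar> / 2) \<le> exp (2 * a)" by simp
  thus ?thesis using exp_gt_zero[of "- a"] by linarith
next
  case False
  hence "exp (\<bar>a\<bar> / 2) \<le> exp (- a)" by simp
  thus ?thesis using exp_gt_zero[of "2 * a"] by linarith
qed

text \<open>The summands 1, \<open>exp 1\<close> and \<open>3 / sqrt (1 - r^2)\<close> stem from the
  moments of order 0, 2 and -1. In the last two, the factors depending on \<open>cmod w\<close>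
  cancel in the bounds; the first is absorbed into the linear growth by
  \<open>n \<ge> 1\<close>.\<close>

lemma nn_integral_exp_log_field_le:
  fixes w :: complex
  assumes n: "0 < n" and w: "cmod w \<le> r" and r: "0 < r" "r < 1"
  shows "(\<integral>\<^sup>+x. ennreal (coulomb_weight (real n) {..<n} x) * ennreal (exp (\<bar>log_field n x w\<bar> / 2)) \<partial>lborel_Pi {..<n}) \<le>
    ennreal (coulomb_partition (real n) n * ((1 + exp 1 + 3 / sqrt (1 - r\<^sup>2)) * real n))"
proof -
  define M where "M = (lborel_Pi {..<n})"
  define W where "W = coulomb_weight (real n) {..<n}"
  define Z where "Z = coulomb_partition (real n) n"
  define a where "a = exp (real n * (1 - (cmod w)\<^sup>2))"
  define b where "b = exp (- (real n * (1 - (cmod w)\<^sup>2) / 2))"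
  define q where "q = sqrt (1 - r\<^sup>2)"
  define P where "P = (\<lambda>x. \<Prod>j<n. (cmod (w - x j))\<^sup>2)"
  define Q where "Q = (\<lambda>x. \<Prod>j<n. inverse (cmod (w - x j)))"
  define G where "G = gauss_moment (real n) n * (real n / pi * trunc_exp (Suc n) (real n * (cmod w)\<^sup>2))"
  have ab: "0 < a" "0 < b" by (auto simp: a_def b_def)
  have Z: "0 < Z" unfolding Z_def using n by (intro coulomb_partition_pos) auto
  have r2: "r\<^sup>2 < 1" using r by (simp add: power_less_one_iff abs_square_less_1)
  have q: "0 < q" unfolding q_def using r2 by simp
  have W0: "0 \<le> W x" for x unfolding W_def by (rule coulomb_weight_nonneg)
  have [measurable]: "W \<in> borel_measurable M" unfolding W_def M_def by measurable
  have [measurable]: "P \<in> borel_measurable M" "Q \<in> borel_measurable M"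
    unfolding M_def P_def Q_def by measurable
  have "(\<integral>\<^sup>+x. ennreal (W x) * ennreal (exp (\<bar>log_field n x w\<bar> / 2)) \<partial>M) \<le>
     (\<integral>\<^sup>+x. ennreal (W x) + ennreal a * ennreal (W x * P x) + ennreal b * ennreal (W x * Q x) \<partial>M)"
  proof (rule nn_integral_mono_AE)
    show "AE x in M. ennreal (W x) * ennreal (exp (\<bar>log_field n x w\<bar> / 2)) \<le>
       ennreal (W x) + ennreal a * ennreal (W x * P x) + ennreal b * ennreal (W x * Q x)"
      unfolding M_def using AE_lborel_Pi_avoid[OF finite_lessThan[of n], of w]
    proof eventually_elim
      fix x :: "nat \<Rightarrow> complex" assume "\<forall>j\<in>{..<n}. x j \<noteq> w"
      hence av: "\<And>j. j < n \<Longrightarrow> x j \<noteq> w" by auto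
      have P: "0 \<le> P x" unfolding P_def by (intro prod_nonneg) auto
      have Q: "0 \<le> Q x" unfolding Q_def by (intro prod_nonneg) auto
      have "exp (2 * log_field n x w) = a * P x" unfolding a_def P_def by (rule exp_log_field) (rule av)
      moreover have "exp (- log_field n x w) = b * Q x" unfolding b_def Q_def by (rule exp_log_field) (rule av)
      ultimately have "exp (\<bar>log_field n x w\<bar> / 2) \<le> 1 + a * P x + b * Q x"
        using exp_half_abs_le[of "log_field n x w"] by (simp only:)
      hence "W x * exp (\<bar>log_field n x w\<bar> / 2) \<le> W x * (1 + a * P x + b * Q x)"
        using W0 by (intro mult_left_mono)
      also have "\<dots> = W x + a * (W x * P x) + b * (W x * Q x)" by (simp add: algebra_simps)
      finally have "ennreal (W x * exp (\<bar>log_field n x w\<bar> / 2)) \<le> ennreal (W x + a * (W x * P x) + b * (W x * Q x))"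
        by (rule ennreal_leI)
      also have "\<dots> = ennreal (W x) + ennreal (a * (W x * P x)) + ennreal (b * (W x * Q x))"
        using W0[of x] ab P Q by (simp add: ennreal_plus)
      also have "\<dots> = ennreal (W x) + ennreal a * ennreal (W x * P x) + ennreal b * ennreal (W x * Q x)"
        using ab by (simp only: ennreal_mult' less_imp_le)
      finally show "ennreal (W x) * ennreal (exp (\<bar>log_field n x w\<bar> / 2)) \<le>
         ennreal (W x) + ennreal a * ennreal (W x * P x) + ennreal b * ennreal (W x * Q x)"
        unfolding ennreal_mult'[OF W0] .
    qed
  qed
  also have "\<dots> = (\<integral>\<^sup>+x. ennreal (W x) \<partial>M) + ennreal a * (\<integral>\<^sup>+x. ennreal (W x * P x) \<partial>M)
      + ennreal b * (\<integral>\<^sup>+x. ennreal (W x * Q x) \<partial>M)"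
    by (simp add: nn_integral_add nn_integral_cmult)
  also have "\<dots> \<le> ennreal Z + ennreal (Z * (exp 1 * real n)) + ennreal (Z * (3 * real n / q))"
  proof (intro add_mono)
    show "(\<integral>\<^sup>+x. ennreal (W x) \<partial>M) \<le> ennreal Z"
      unfolding W_def M_def Z_def using n by (subst nn_integral_coulomb_weight[where n = n]) auto
    have "ennreal a * (\<integral>\<^sup>+x. ennreal (W x * P x) \<partial>M) =
       ennreal a * ennreal (Z * G)"
      unfolding W_def M_def Z_def P_def G_def using n by (subst nn_integral_coulomb_weight_mult_sq[where n = n]) auto
    also have "\<dots> = ennreal (a * (Z * G))"
      using ab(1) by (intro ennreal_mult'[symmetric]) simp
    also have "\<dots> \<le> ennreal (Z * (exp 1 * real n))"
    proof (rule ennreal_leI)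
      have g: "gauss_moment (real n) n * (real n / pi) = fact n / real n ^ n"
        using n by (simp add: gauss_moment_def)
      have "a * (Z * G) =
         Z * (fact n / real n ^ n) * (a * trunc_exp (Suc n) (real n * (cmod w)\<^sup>2))"
        unfolding G_def g[symmetric] by (simp only: mult_ac)
      \<comment> \<open>Completing the series costs nothing at the exponential scale:
        \<open>exp (n * |w|^2)\<close> cancels against \<open>a\<close>, and the ratio
        \<open>n! exp n / n ^ n\<close> remains.\<close>
      also have "\<dots> \<le> Z * (fact n / real n ^ n) * (a * exp (real n * (cmod w)\<^sup>2))"
        using Z ab by (intro mult_left_mono trunc_exp_le_exp) auto
      also have "a * exp (real n * (cmod w)\<^sup>2) = exp (real n)"
        by (simp add: a_def exp_add[symmetric] algebra_simps)
      also have "Z * (fact n / real n ^ n) * exp (real n) = Z * ((fact n * exp (real n)) / real n ^ n)" by simp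
      also have "\<dots> \<le> Z * ((exp 1 * real n * real n ^ n) / real n ^ n)"
        using Z fact_mult_exp_le[OF n] by (intro mult_left_mono divide_right_mono) auto
      also have "\<dots> = Z * (exp 1 * real n)" using n by simp
      finally show "a * (Z * G) \<le> Z * (exp 1 * real n)" .
    qed
    finally show "ennreal a * (\<integral>\<^sup>+x. ennreal (W x * P x) \<partial>M) \<le> ennreal (Z * (exp 1 * real n))" .
    have "ennreal b * (\<integral>\<^sup>+x. ennreal (W x * Q x) \<partial>M) \<le>
       ennreal b * ennreal (Z * (3 * real n / q * exp (real n * (1 - (cmod w)\<^sup>2) / 2)))"
      unfolding W_def M_def Z_def q_def Q_def by (intro mult_left_mono nn_integral_coulomb_weight_inverse_le n w r) auto
    also have "\<dots> = ennreal (b * (Z * (3 * real n / q * exp (real n * (1 - (cmod w)\<^sup>2) / 2))))"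
      using ab(2) by (intro ennreal_mult'[symmetric]) simp
    also have "b * (Z * (3 * real n / q * exp (real n * (1 - (cmod w)\<^sup>2) / 2))) = Z * (3 * real n / q)"
      by (simp add: b_def exp_minus)
    finally show "ennreal b * (\<integral>\<^sup>+x. ennreal (W x * Q x) \<partial>M) \<le> ennreal (Z * (3 * real n / q))" .
  qed
  also have "\<dots> = ennreal (Z + Z * (exp 1 * real n) + Z * (3 * real n / q))"
    using Z q by (simp add: ennreal_plus)
  also have "\<dots> \<le> ennreal (Z * ((1 + exp 1 + 3 / q) * real n))"
    using Z q n by (intro ennreal_leI) (simp add: algebra_simps)
  finally show ?thesis unfolding M_def W_def Z_def q_def .
qed

section \<open>Passage to the probability measure\<close>

lemma ginibre_partition_eq:
  "ginibre_partition N = (\<integral>\<^sup>+x. ennreal (coulomb_weight (real N) {..<N} x) \<partial>lebesgue_CN N)"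
  unfolding ginibre_partition_def lebesgue_CN_def
  using AE_lborel_Pi_inj[OF finite_lessThan[of N]]
  by (intro nn_integral_cong_AE) (auto elim!: eventually_mono simp: exp_ginibre_hamiltonian)

lemma ginibre_hamiltonian_measurable [measurable]: "ginibre_hamiltonian N \<in> borel_measurable (lebesgue_CN N)"
  unfolding ginibre_hamiltonian_def[abs_def] lebesgue_CN_def by measurable

lemma sets_ginibre [measurable_cong]: "sets (ginibre N) = sets (lebesgue_CN N)"
  by (simp add: ginibre_def)

lemma nn_integral_ginibre:
  assumes N: "0 < N" and [measurable]: "g \<in> borel_measurable (lebesgue_CN N)"
  shows "(\<integral>\<^sup>+x. g x \<partial>ginibre N) =
    (\<integral>\<^sup>+x. ennreal (coulomb_weight (real N) {..<N} x) * g x \<partial>lebesgue_CN N) / ennreal (coulomb_partition (real N) N)"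
proof -
  have Z: "ginibre_partition N = ennreal (coulomb_partition (real N) N)"
    unfolding ginibre_partition_eq lebesgue_CN_def using N by (intro nn_integral_coulomb_weight) auto
  have [measurable]: "coulomb_weight (real N) {..<N} \<in> borel_measurable (lebesgue_CN N)"
    unfolding lebesgue_CN_def by measurable
  have "(\<integral>\<^sup>+x. g x \<partial>ginibre N) = (\<integral>\<^sup>+x. ennreal (exp (- ginibre_hamiltonian N x)) / ginibre_partition N * g x \<partial>lebesgue_CN N)"
    unfolding ginibre_def by (rule nn_integral_density) measurable
  also have "\<dots> = (\<integral>\<^sup>+x. ennreal (coulomb_weight (real N) {..<N} x) * g x / ginibre_partition N \<partial>lebesgue_CN N)"
  proof (rule nn_integral_cong_AE)
    show "AE x in lebesgue_CN N. ennreal (exp (- ginibre_hamiltonian N x)) / ginibre_partition N * g x =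
       ennreal (coulomb_weight (real N) {..<N} x) * g x / ginibre_partition N"
      using AE_lborel_Pi_inj[OF finite_lessThan[of N]] unfolding lebesgue_CN_def
      by eventually_elim (simp add: exp_ginibre_hamiltonian divide_ennreal_def mult_ac)
  qed
  also have "\<dots> = (\<integral>\<^sup>+x. ennreal (coulomb_weight (real N) {..<N} x) * g x \<partial>lebesgue_CN N) / ginibre_partition N"
    by (rule nn_integral_divide) measurable
  finally show ?thesis unfolding Z .
qed

lemma log_field_measurable_pair [measurable]:
  "(\<lambda>(x, w). log_field N x w) \<in> borel_measurable (lebesgue_CN N \<Otimes>\<^sub>M lborel)"
proof -
  have [measurable]: "(\<lambda>p. fst p j) \<in> borel_measurable (lebesgue_CN N \<Otimes>\<^sub>M (lborel :: complex measure))" if "j < N" for j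
    using measurable_component_singleton[of j "{..<N}" "\<lambda>_. lborel :: complex measure"] that
    unfolding lebesgue_CN_def by (intro measurable_compose[OF measurable_fst]) auto
  have "(\<lambda>p. ln (cmod (fst p j - snd p))) \<in> borel_measurable (lebesgue_CN N \<Otimes>\<^sub>M lborel)" if "j < N" for j
    using that by measurable
  moreover have "(\<lambda>p. real N * (((cmod (snd p))\<^sup>2 - 1) / 2)) \<in> borel_measurable (lebesgue_CN N \<Otimes>\<^sub>M lborel)"
    by measurable
  ultimately show ?thesis unfolding log_field_def split_beta
    by (intro borel_measurable_diff borel_measurable_sum) auto
qed

lemma exp_field_integral_measurable [measurable]: "exp_field_integral r N \<in> borel_measurable (lebesgue_CN N)"
proof -
  have [measurable]: "cball (0::complex) r \<in> sets borel" by simp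
  have "(\<lambda>(x, w). indicator (cball 0 r) w * ennreal (exp (\<bar>log_field N x w\<bar> / 2))) \<in> borel_measurable (lebesgue_CN N \<Otimes>\<^sub>M lborel)"
    using log_field_measurable_pair[of N] unfolding split_beta by measurable
  thus ?thesis unfolding exp_field_integral_def[abs_def] by (rule lborel.borel_measurable_nn_integral)
qed

text \<open>Tonelli's theorem brings the expectation inside, where the moment bound is uniform in
  \<open>w\<close>; the area of the disk is at most \<open>pi\<close>, and dividing by the partition
  function removes it from the bound.\<close>

lemma ginibre_exp_field_integral_le:
  assumes N: "0 < N" and r: "0 < r" "r < 1"
  shows "(\<integral>\<^sup>+x. exp_field_integral r N x \<partial>ginibre N) \<le> ennreal (pi * ((1 + exp 1 + 3 / sqrt (1 - r\<^sup>2)) * real N))"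
proof -
  define Z where "Z = coulomb_partition (real N) N"
  define C where "C = (1 + exp 1 + 3 / sqrt (1 - r\<^sup>2)) * real N"
  have Z: "0 < Z" unfolding Z_def using N by (intro coulomb_partition_pos) auto
  have r2: "r\<^sup>2 \<le> 1" using r by (simp add: power_le_one)
  have C: "0 \<le> C" unfolding C_def using r2 by (intro mult_nonneg_nonneg add_nonneg_nonneg divide_nonneg_nonneg) auto
  interpret product_sigma_finite "\<lambda>_::nat. lborel :: complex measure" ..
  interpret L: finite_product_sigma_finite "\<lambda>_. lborel :: complex measure" "{..<N}" by standard auto
  interpret P: pair_sigma_finite "lebesgue_CN N" "lborel :: complex measure"
    unfolding lebesgue_CN_def ..
  have [measurable]: "coulomb_weight (real N) {..<N} \<in> borel_measurable (lebesgue_CN N)"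
    unfolding lebesgue_CN_def by measurable
  have [measurable]: "cball (0::complex) r \<in> sets borel" by simp
  have pair: "(\<lambda>(x, w). ennreal (coulomb_weight (real N) {..<N} x) * (indicator (cball 0 r) w * ennreal (exp (\<bar>log_field N x w\<bar> / 2))))
      \<in> borel_measurable (lebesgue_CN N \<Otimes>\<^sub>M lborel)"
    using log_field_measurable_pair[of N] unfolding split_beta by measurable
  have "(\<integral>\<^sup>+x. ennreal (coulomb_weight (real N) {..<N} x) * exp_field_integral r N x \<partial>lebesgue_CN N)
     = (\<integral>\<^sup>+x. (\<integral>\<^sup>+w. ennreal (coulomb_weight (real N) {..<N} x) * (indicator (cball 0 r) w * ennreal (exp (\<bar>log_field N x w\<bar> / 2))) \<partial>lborel) \<partial>lebesgue_CN N)"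
    unfolding exp_field_integral_def by (intro nn_integral_cong nn_integral_cmult[symmetric]) measurable
  also have "\<dots> = (\<integral>\<^sup>+w. (\<integral>\<^sup>+x. ennreal (coulomb_weight (real N) {..<N} x) * (indicator (cball 0 r) w * ennreal (exp (\<bar>log_field N x w\<bar> / 2))) \<partial>lebesgue_CN N) \<partial>lborel)"
    by (rule P.Fubini'[OF pair, symmetric])
  also have "\<dots> \<le> (\<integral>\<^sup>+w. ennreal (Z * C) * indicator (cball (0::complex) r) w \<partial>lborel)"
  proof (rule nn_integral_mono)
    fix w :: complex
    show "(\<integral>\<^sup>+x. ennreal (coulomb_weight (real N) {..<N} x) * (indicator (cball 0 r) w * ennreal (exp (\<bar>log_field N x w\<bar> / 2))) \<partial>lebesgue_CN N)
       \<le> ennreal (Z * C) * indicator (cball 0 r) w"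
    proof (cases "w \<in> cball 0 r")
      case True
      hence "cmod w \<le> r" by simp
      from nn_integral_exp_log_field_le[OF N this r] show ?thesis using True
        by (simp add: lebesgue_CN_def Z_def C_def)
    qed simp
  qed
  also have "\<dots> = ennreal (Z * C) * ennreal (pi * r\<^sup>2)"
    using r by (simp add: nn_integral_cmult_indicator emeasure_cball DIM_complex unit_ball_vol_2)
  also have "\<dots> \<le> ennreal (Z * C) * ennreal pi"
    using r2 by (intro mult_left_mono ennreal_leI) auto
  also have "\<dots> = ennreal (pi * C) * ennreal Z" using Z C by (simp add: mult_ac flip: ennreal_mult)
  finally have "(\<integral>\<^sup>+x. ennreal (coulomb_weight (real N) {..<N} x) * exp_field_integral r N x \<partial>lebesgue_CN N) \<le> ennreal (pi * C) * ennreal Z" .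
  hence "(\<integral>\<^sup>+x. exp_field_integral r N x \<partial>ginibre N) \<le> ennreal (pi * C) * ennreal Z / ennreal Z"
    unfolding nn_integral_ginibre[OF N exp_field_integral_measurable] Z_def by (rule divide_right_mono_ennreal)
  also have "\<dots> = ennreal (pi * C)"
    using Z by (intro ennreal_mult_divide_eq) auto
  finally show ?thesis unfolding C_def .
qed

theorem theorem1p2:
  fixes r :: real
  assumes "0 < r" and "r < 1"
  shows "\<exists>C::real. C > 0 \<and>
    (\<forall>\<kappa>::real. \<kappa> > 0 \<longrightarrow> (\<forall>N::nat. N \<ge> 1 \<longrightarrow>
      (\<forall>\<eta>::real. \<eta> > 0 \<and> \<eta> * ln (real N) \<le> real N \<longrightarrow>
        measure (ginibre N)
          {x \<in> space (ginibre N).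
             (SUP f\<in>{f \<in> test_class N r \<kappa>. no_harmonic_part f \<and>
                       (LINT z:ball 0 1|lborel. \<bar>laplacian f z\<bar> / pi) \<le> 1}.
                ereal \<bar>lin_stat N x f\<bar>)
             \<ge> ereal (\<eta> * ln (real N) + 1)}
        \<le> C * real N powr (5/4 + \<kappa> - \<eta>))))"
proof (intro exI conjI allI impI)
  define C where "C = 1 + exp 1 + 3 / sqrt (1 - r\<^sup>2)"
  have "r\<^sup>2 \<le> 1" using assms by (simp add: power_le_one)
  hence "0 \<le> 3 / sqrt (1 - r\<^sup>2)" by simp
  thus C: "0 < C" unfolding C_def using exp_gt_zero[of "1::real"] by linarith
  fix \<kappa> :: real and N :: nat and \<eta> :: real
  assume "0 < \<kappa>" "1 \<le> N" and \<eta>: "0 < \<eta> \<and> \<eta> * ln (real N) \<le> real N"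
  hence N: "0 < N" "1 \<le> real N" by auto
  define F where "F = {f \<in> test_class N r \<kappa>. no_harmonic_part f \<and> (LINT z:ball 0 1|lborel. \<bar>laplacian f z\<bar> / pi) \<le> 1}"
  define S where "S = {x \<in> space (ginibre N). (SUP f\<in>F. ereal \<bar>lin_stat N x f\<bar>) \<ge> ereal (\<eta> * ln (real N) + 1)}"
  define a where "a = real N powr \<kappa> / pi"
  define b where "b = real N powr \<eta>"
  \<comment> \<open>A measurable event containing \<open>S\<close>. The supremum runs over an
    uncountable family, so measurability is established for \<open>A\<close>, the larger set, which
    is where monotonicity of \<open>emeasure\<close> asks for it.\<close>
  define A where "A = {x \<in> space (ginibre N). 1 \<le> ennreal (a / b) * exp_field_integral r N x}"
  have a: "0 < a" unfolding a_def using N by simp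
  have b: "1 \<le> b" unfolding b_def using N \<eta> by (intro ge_one_powr_ge_zero) auto
  have [measurable]: "exp_field_integral r N \<in> borel_measurable (ginibre N)" by measurable
  have A [measurable]: "A \<in> sets (ginibre N)" unfolding A_def by measurable
  have "S \<subseteq> A"
  proof
    fix x assume x: "x \<in> S"
    define Y where "Y = ennreal a * exp_field_integral r N x"
    have "ennreal b \<le> Y"
    \<comment> \<open>If \<open>Y\<close> is infinite there is nothing to show; otherwise its real
      value \<open>y\<close> bounds all test functions at once through
      \<open>ln (1 + y)\<close>.\<close>
    proof (cases Y)
      case (real y)
      have "ereal \<bar>lin_stat N x f\<bar> \<le> ereal (ln (1 + y))" if f: "f \<in> F" for f
      proof -
        have "ennreal (exp \<bar>lin_stat N x f\<bar>) \<le> 1 + Y"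
          unfolding Y_def a_def using f assms by (intro exp_lin_stat_le) (auto simp: F_def)
        also have "\<dots> = ennreal (1 + y)" using real by (simp add: ennreal_plus)
        finally have "exp \<bar>lin_stat N x f\<bar> \<le> 1 + y" by (subst (asm) ennreal_le_iff) (use real in auto)
        hence "\<bar>lin_stat N x f\<bar> \<le> ln (1 + y)" using real by (simp add: ln_ge_iff)
        thus ?thesis by simp
      qed
      hence "(SUP f\<in>F. ereal \<bar>lin_stat N x f\<bar>) \<le> ereal (ln (1 + y))" by (rule SUP_least)
      moreover have "ereal (\<eta> * ln (real N) + 1) \<le> (SUP f\<in>F. ereal \<bar>lin_stat N x f\<bar>)" using x by (simp add: S_def)
      ultimately have "ereal (\<eta> * ln (real N) + 1) \<le> ereal (ln (1 + y))" by (rule order_trans[rotated])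
      hence "\<eta> * ln (real N) + 1 \<le> ln (1 + y)" by simp
      hence "exp (\<eta> * ln (real N) + 1) \<le> 1 + y" using real by (simp add: ln_ge_iff)
      moreover have "exp (\<eta> * ln (real N) + 1) = b * exp 1" unfolding b_def using N by (simp add: powr_def exp_add)
      \<comment> \<open>The summand 1 in the threshold provides the factor
        \<open>exp 1 \<ge> 2\<close>. Since \<open>b \<ge> 1\<close>, the second copy of
        \<open>b\<close> absorbs the summand 1 left by Jensen's inequality.\<close>
      moreover have "b * 2 \<le> b * exp 1" using b exp_ge_add_one_self[of 1] by (intro mult_left_mono) auto
      ultimately have "b \<le> y" using b by linarith
      thus ?thesis using real by (simp add: ennreal_leI)
    qed simp
    hence "ennreal (1 / b) * ennreal b \<le> ennreal (1 / b) * Y" by (rule mult_left_mono) simp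
    also have "ennreal (1 / b) * Y = ennreal (a / b) * exp_field_integral r N x"
      unfolding Y_def mult.assoc[symmetric] using a b by (simp flip: ennreal_mult)
    also have "ennreal (1 / b) * ennreal b = 1" using b by (simp flip: ennreal_mult)
    finally show "x \<in> A" using x by (simp add: A_def S_def)
  qed
  have "emeasure (ginibre N) A \<le> ennreal (a / b) * (\<integral>\<^sup>+x. exp_field_integral r N x * indicator (space (ginibre N)) x \<partial>ginibre N)"
    unfolding A_def by (rule nn_integral_Markov_inequality) measurable
  also have "\<dots> = ennreal (a / b) * (\<integral>\<^sup>+x. exp_field_integral r N x \<partial>ginibre N)"
    by (intro arg_cong2[where f = "(*)"] nn_integral_cong refl) auto
  also have "\<dots> \<le> ennreal (a / b) * ennreal (pi * (C * real N))"
    unfolding C_def by (intro mult_left_mono ginibre_exp_field_integral_le N(1) assms) simp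
  also have "\<dots> = ennreal (a / b * (pi * (C * real N)))" using a b by (intro ennreal_mult'[symmetric]) simp
  also have "a / b * (pi * (C * real N)) = C * (real N powr 1 * real N powr \<kappa> / real N powr \<eta>)"
    using N by (simp add: a_def b_def)
  also have "\<dots> = C * real N powr (1 + \<kappa> - \<eta>)"
    using N by (simp only: powr_add[symmetric] powr_diff[symmetric])
  \<comment> \<open>The expectation is linear in \<open>N\<close>, hence the exponent 1 in place of
    5/4; \<open>N \<ge> 1\<close> allows it to be raised.\<close>
  also have "ennreal \<dots> \<le> ennreal (C * real N powr (5/4 + \<kappa> - \<eta>))"
    using C N by (intro ennreal_leI mult_left_mono powr_mono) auto
  finally have "emeasure (ginibre N) A \<le> ennreal (C * real N powr (5/4 + \<kappa> - \<eta>))" .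
  hence "emeasure (ginibre N) S \<le> ennreal (C * real N powr (5/4 + \<kappa> - \<eta>))"
    using emeasure_mono[OF \<open>S \<subseteq> A\<close> A] by (rule order_trans[rotated])
  hence "measure (ginibre N) S \<le> C * real N powr (5/4 + \<kappa> - \<eta>)"
    using C unfolding measure_def by (intro enn2real_leI) auto
  thus "measure (ginibre N)
          {x \<in> space (ginibre N).
             (SUP f\<in>{f \<in> test_class N r \<kappa>. no_harmonic_part f \<and>
                       (LINT z:ball 0 1|lborel. \<bar>laplacian f z\<bar> / pi) \<le> 1}.
                ereal \<bar>lin_stat N x f\<bar>)
             \<ge> ereal (\<eta> * ln (real N) + 1)}
        \<le> C * real N powr (5/4 + \<kappa> - \<eta>)"
    unfolding S_def F_def .
qed

end
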